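(* Let $K$ be a field, let $(A,d_A)$ and $(B,d_B)$ be graded commutative dg-division rings over $K$, and let $\varphi:(B,d_B)\to(A,d_A)$ be a dg-extension. (1) Then $\ker(d_A)$ and $\ker(d_B)$ are graded-commutative graded-division rings. (2) If $(B,d_B)$ is acyclic, then $(A,d_A)$ is also acyclic, and (2a) the dg-extension $\varphi$ is dg-separable if the induced graded extension $\ker(d_B)\to\ker(d_A)$ is graded-separable; (2b) if the characteristic of $K$ is different from $2$, then the dg-extension $\varphi$ is dg-separable if and only if the induced graded extension $\ker(d_B)\to\ker(d_A)$ is graded-separable. Suppose now that the characteristic of $K$ is different from $2$. (3) If $d_B=0$ and $(A,d_A)$ is acyclic, then the dg-extension $\varphi$ is not dg-separable. (4) If $(B,d_B)$ is acyclic and $\ker(d_B)$ is concentrated in degree $0$, and if $\ker(d_A)$ is not concentrated in degree $0$, then the dg-extension $\varphi$ is not dg-separable. (5) If $(C,d_C)$ is a graded-commutative acyclic dg-division ring over $K$ such that $\ker(d_C)$ is not concentrated in degree $0$, then there is a field $D$ such that $\ker(d_C)\simeq D[T,T^{-1}]$ for some $T$ in nonzero even degree. An extension $D_1[T^n,T^{-n}]\to D_2[T,T^{-1}]$ of such graded rings (with $D_1\to D_2$ an extension of fields, $n\geq 1$ an integer, and $T^n\mapsto T^n$) is graded-separable if and only if the field extension $D_1\to D_2$ is separable and $n$ is invertible in $D_1$.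
   Context: A differential graded $K$-algebra (dg-algebra) $(A,d)$ is a $\mathbb{Z}$-graded unital associative $K$-algebra $A$ ($K$ in degree $0$) together with a $K$-linear graded endomorphism $d:A\to A$ of degree $1$ such that $d^2=0$ and $d(ab)=d(a)b+(-1)^{|a|}a\,d(b)$ for all homogeneous $a,b\in A$. It is graded commutative if $ab=(-1)^{|a||b|}ba$ for all homogeneous $a,b$. It is acyclic if $H(A,d)=\ker(d)/\mathrm{im}(d)=0$. A dg-left (resp. dg-right) ideal of $(A,d)$ is a graded left (resp. right) ideal $I$ with $d(I)\subseteq I$. A dg-division algebra (dg-division ring) is a nonzero dg-algebra $(A,d)$ such that the only dg-left ideals are $0$ and $A$ and the only dg-right ideals are $0$ and $A$. A graded-division ring is a nonzero $\mathbb{Z}$-graded ring in which every nonzero homogeneous element is invertible. A dg-extension of dg-algebras is a homomorphism of dg-algebras (a unital, degree $0$ algebra homomorphism commuting with the differentials). A dg-extension $R\to S$, with differentials $d_R,d_S$, restricts to a homomorphism of graded rings $\ker(d_R)\to\ker(d_S)$, called the induced graded extension. The tensor product $S\otimes_RS$ is a differential graded $S$-$S$-bimodule with differential $d(s\otimes s')=d_S(s)\otimes s'+(-1)^{|s|}s\otimes d_S(s')$ for homogeneous $s,s'$. The dg-extension is dg-separable if the multiplication map $\mu:S\otimes_RS\to S$ is split as a morphism of differential graded $S$-$S$-bimodules, i.e. there is a degree $0$ homomorphism of $S$-$S$-bimodules $\rho:S\to S\otimes_RS$ commuting with the differentials with $\mu\circ\rho=\mathrm{id}_S$. A homomorphism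 of graded rings $R\to S$ is graded-separable if the multiplication map $S\otimes_RS\to S$ is split as a morphism of graded $S$-$S$-bimodules (by a degree $0$ map). A field extension $D_1\to D_2$ is separable if the multiplication map $D_2\otimes_{D_1}D_2\to D_2$ splits as a morphism of $D_2$-$D_2$-bimodules. *)

theory Defs
  imports "HOL-Algebra.Algebra"
begin

section \<open>Graded rings\<close>

definition homogeneous_decomposition ::
  "('a, 'm) ring_scheme \<Rightarrow> (int \<Rightarrow> 'a set) \<Rightarrow> 'a \<Rightarrow> (int \<Rightarrow> 'a) \<Rightarrow> bool"
  where "homogeneous_decomposition R G x f \<longleftrightarrow>
    (\<forall>i. f i \<in> G i) \<and> finite {i. f i \<noteq> \<zero>\<^bsub>R\<^esub>} \<and> x = (\<Oplus>\<^bsub>R\<^esub>i\<in>{i. f i \<noteq> \<zero>\<^bsub>R\<^esub>}. f i)"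

text \<open>The family \<open>G\<close> is the grading: \<open>G n\<close> is the set of homogeneous elements of degree \<open>n\<close>
  (together with zero), and the ring is the internal direct sum of the \<open>G n\<close>.\<close>

locale graded_ring = ring R for R :: "('a, 'm) ring_scheme" (structure) and G :: "int \<Rightarrow> 'a set" +
  assumes comp_subgroup: "additive_subgroup (G n) R"
    and comp_mult: "\<lbrakk>x \<in> G i; y \<in> G j\<rbrakk> \<Longrightarrow> x \<otimes> y \<in> G (i + j)"
    and one_comp: "\<one> \<in> G 0"
    and direct_sum: "x \<in> carrier R \<Longrightarrow> \<exists>!f. homogeneous_decomposition R G x f"

definition comp_of :: "('a, 'm) ring_scheme \<Rightarrow> (int \<Rightarrow> 'a set) \<Rightarrow> 'a \<Rightarrow> int \<Rightarrow> 'a"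
  where "comp_of R G x = (THE f. homogeneous_decomposition R G x f)"

definition sgn_mult :: "('a, 'm) ring_scheme \<Rightarrow> int \<Rightarrow> 'a \<Rightarrow> 'a"
  where \<comment> \<open>\<open>(-1)^i x\<close>\<close>
    "sgn_mult R i x = (if even i then x else \<ominus>\<^bsub>R\<^esub> x)"

definition graded_commutative :: "('a, 'm) ring_scheme \<Rightarrow> (int \<Rightarrow> 'a set) \<Rightarrow> bool"
  where "graded_commutative R G \<longleftrightarrow>
    (\<forall>i j. \<forall>a \<in> G i. \<forall>b \<in> G j. a \<otimes>\<^bsub>R\<^esub> b = sgn_mult R (i * j) (b \<otimes>\<^bsub>R\<^esub> a))"

definition graded_division_ring :: "('a, 'm) ring_scheme \<Rightarrow> (int \<Rightarrow> 'a set) \<Rightarrow> bool"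
  where "graded_division_ring R G \<longleftrightarrow>
    graded_ring R G \<and> carrier R \<noteq> {\<zero>\<^bsub>R\<^esub>} \<and>
    (\<forall>n. \<forall>x \<in> G n. x \<noteq> \<zero>\<^bsub>R\<^esub> \<longrightarrow> x \<in> Units R)"

definition concentrated_in_degree_zero :: "('a, 'm) ring_scheme \<Rightarrow> (int \<Rightarrow> 'a set) \<Rightarrow> bool"
  where "concentrated_in_degree_zero R G \<longleftrightarrow> (\<forall>n. n \<noteq> 0 \<longrightarrow> G n = {\<zero>\<^bsub>R\<^esub>})"

definition graded_ring_iso ::
  "('a, 'm) ring_scheme \<Rightarrow> (int \<Rightarrow> 'a set) \<Rightarrow> ('b, 'n) ring_scheme \<Rightarrow> (int \<Rightarrow> 'b set) \<Rightarrow> ('a \<Rightarrow> 'b) \<Rightarrow> bool"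
  where "graded_ring_iso R G S H h \<longleftrightarrow> h \<in> ring_iso R S \<and> (\<forall>n. h ` G n = H n)"

definition ring_char :: "('a, 'm) ring_scheme \<Rightarrow> nat"
  where "ring_char R =
    (if \<exists>n::nat. n > 0 \<and> [n] \<cdot>\<^bsub>R\<^esub> \<one>\<^bsub>R\<^esub> = \<zero>\<^bsub>R\<^esub>
     then LEAST n. n > 0 \<and> [n] \<cdot>\<^bsub>R\<^esub> \<one>\<^bsub>R\<^esub> = \<zero>\<^bsub>R\<^esub> else 0)"


section \<open>Differential graded algebras\<close>

locale dg_algebra = module K A + graded_ring A G
  for K :: "('k, 'l) ring_scheme" and A :: "('k, 'a, 'm) module_scheme" (structure)
    and G :: "int \<Rightarrow> 'a set" +
  fixes d :: "'a \<Rightarrow> 'a"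
  assumes smult_mult_left: "\<lbrakk>k \<in> carrier K; x \<in> carrier A; y \<in> carrier A\<rbrakk>
      \<Longrightarrow> (k \<odot> x) \<otimes> y = k \<odot> (x \<otimes> y)"
    and smult_mult_right: "\<lbrakk>k \<in> carrier K; x \<in> carrier A; y \<in> carrier A\<rbrakk>
      \<Longrightarrow> x \<otimes> (k \<odot> y) = k \<odot> (x \<otimes> y)"
    and scalars_degree_zero: "k \<in> carrier K \<Longrightarrow> k \<odot> \<one> \<in> G 0"
    and d_add: "\<lbrakk>x \<in> carrier A; y \<in> carrier A\<rbrakk> \<Longrightarrow> d (x \<oplus> y) = d x \<oplus> d y"
    and d_smult: "\<lbrakk>k \<in> carrier K; x \<in> carrier A\<rbrakk> \<Longrightarrow> d (k \<odot> x) = k \<odot> d x"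
    and d_degree: "x \<in> G n \<Longrightarrow> d x \<in> G (n + 1)"
    and d_squared: "x \<in> carrier A \<Longrightarrow> d (d x) = \<zero>"
    and leibniz: "\<lbrakk>a \<in> G i; b \<in> G j\<rbrakk> \<Longrightarrow> d (a \<otimes> b) = (d a \<otimes> b) \<oplus> sgn_mult A i (a \<otimes> d b)"

definition dker :: "('a, 'm) ring_scheme \<Rightarrow> ('a \<Rightarrow> 'a) \<Rightarrow> ('a, 'm) ring_scheme"
  where "dker A d = A\<lparr>carrier := {x \<in> carrier A. d x = \<zero>\<^bsub>A\<^esub>}\<rparr>"

definition dker_grading ::
  "('a, 'm) ring_scheme \<Rightarrow> (int \<Rightarrow> 'a set) \<Rightarrow> ('a \<Rightarrow> 'a) \<Rightarrow> int \<Rightarrow> 'a set"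
  where "dker_grading A G d n = G n \<inter> carrier (dker A d)"

definition cohomology :: "('a, 'm) ring_scheme \<Rightarrow> ('a \<Rightarrow> 'a) \<Rightarrow> 'a set monoid"
  where "cohomology A d = add_monoid (dker A d) Mod (d ` carrier A)"

definition acyclic_dg :: "('a, 'm) ring_scheme \<Rightarrow> ('a \<Rightarrow> 'a) \<Rightarrow> bool"
  where "acyclic_dg A d \<longleftrightarrow> carrier (cohomology A d) = {\<one>\<^bsub>cohomology A d\<^esub>}"

definition left_ideal :: "'a set \<Rightarrow> ('a, 'm) ring_scheme \<Rightarrow> bool"
  where "left_ideal I R \<longleftrightarrow>
    additive_subgroup I R \<and> (\<forall>r \<in> carrier R. \<forall>x \<in> I. r \<otimes>\<^bsub>R\<^esub> x \<in> I)"

definition right_ideal :: "'a set \<Rightarrow> ('a, 'm) ring_scheme \<Rightarrow> bool"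
  where "right_ideal I R \<longleftrightarrow>
    additive_subgroup I R \<and> (\<forall>r \<in> carrier R. \<forall>x \<in> I. x \<otimes>\<^bsub>R\<^esub> r \<in> I)"

definition graded_subset :: "'a set \<Rightarrow> ('a, 'm) ring_scheme \<Rightarrow> (int \<Rightarrow> 'a set) \<Rightarrow> bool"
  where "graded_subset I R G \<longleftrightarrow> (\<forall>x \<in> I. \<forall>n. comp_of R G x n \<in> I)"

definition dg_left_ideal ::
  "'a set \<Rightarrow> ('a, 'm) ring_scheme \<Rightarrow> (int \<Rightarrow> 'a set) \<Rightarrow> ('a \<Rightarrow> 'a) \<Rightarrow> bool"
  where "dg_left_ideal I A G d \<longleftrightarrow> left_ideal I A \<and> graded_subset I A G \<and> d ` I \<subseteq> I"

definition dg_right_ideal ::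
  "'a set \<Rightarrow> ('a, 'm) ring_scheme \<Rightarrow> (int \<Rightarrow> 'a set) \<Rightarrow> ('a \<Rightarrow> 'a) \<Rightarrow> bool"
  where "dg_right_ideal I A G d \<longleftrightarrow> right_ideal I A \<and> graded_subset I A G \<and> d ` I \<subseteq> I"

definition dg_division_ring ::
  "('k, 'l) ring_scheme \<Rightarrow> ('k, 'a, 'm) module_scheme \<Rightarrow> (int \<Rightarrow> 'a set) \<Rightarrow> ('a \<Rightarrow> 'a) \<Rightarrow> bool"
  where "dg_division_ring K A G d \<longleftrightarrow>
    dg_algebra K A G d \<and> carrier A \<noteq> {\<zero>\<^bsub>A\<^esub>} \<and>
    (\<forall>I. dg_left_ideal I A G d \<longrightarrow> I = {\<zero>\<^bsub>A\<^esub>} \<or> I = carrier A) \<and>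
    (\<forall>I. dg_right_ideal I A G d \<longrightarrow> I = {\<zero>\<^bsub>A\<^esub>} \<or> I = carrier A)"

definition dg_extension ::
  "('k, 'l) ring_scheme \<Rightarrow>
   ('k, 'b, 'n) module_scheme \<Rightarrow> (int \<Rightarrow> 'b set) \<Rightarrow> ('b \<Rightarrow> 'b) \<Rightarrow>
   ('k, 'a, 'm) module_scheme \<Rightarrow> (int \<Rightarrow> 'a set) \<Rightarrow> ('a \<Rightarrow> 'a) \<Rightarrow> ('b \<Rightarrow> 'a) \<Rightarrow> bool"
  where "dg_extension K B GB dB A GA dA \<phi> \<longleftrightarrow>
    dg_algebra K B GB dB \<and> dg_algebra K A GA dA \<and> \<phi> \<in> ring_hom B A \<and>
    (\<forall>k \<in> carrier K. \<forall>b \<in> carrier B. \<phi> (k \<odot>\<^bsub>B\<^esub> b) = k \<odot>\<^bsub>A\<^esub> \<phi> b) \<and>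
    (\<forall>n. \<phi> ` GB n \<subseteq> GA n) \<and>
    (\<forall>b \<in> carrier B. \<phi> (dB b) = dA (\<phi> b))"


section \<open>The bimodule \<open>S \<otimes>\<^sub>R S\<close> and separability\<close>

text \<open>For a ring homomorphism \<open>\<phi>\<close> from \<open>R\<close> to \<open>S\<close>, the tensor product is the quotient of the free
  abelian group on \<open>S \<times> S\<close> by the usual relations; it is written multiplicatively, as all groups
  in \<open>HOL-Algebra\<close> are.\<close>

abbreviation tensor_free :: "('s, 'm) ring_scheme \<Rightarrow> ('s \<times> 's \<Rightarrow>\<^sub>0 int) monoid"
  where "tensor_free S \<equiv> free_Abelian_group (carrier S \<times> carrier S)"

definition tensor_relators ::
  "('r, 'n) ring_scheme \<Rightarrow> ('s, 'm) ring_scheme \<Rightarrow> ('r \<Rightarrow> 's) \<Rightarrow> ('s \<times> 's \<Rightarrow>\<^sub>0 int) set"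
  where "tensor_relators R S \<phi> =
    {frag_of (x \<oplus>\<^bsub>S\<^esub> x', y) - frag_of (x, y) - frag_of (x', y) | x x' y.
        x \<in> carrier S \<and> x' \<in> carrier S \<and> y \<in> carrier S} \<union>
    {frag_of (x, y \<oplus>\<^bsub>S\<^esub> y') - frag_of (x, y) - frag_of (x, y') | x y y'.
        x \<in> carrier S \<and> y \<in> carrier S \<and> y' \<in> carrier S} \<union>
    {frag_of (x \<otimes>\<^bsub>S\<^esub> \<phi> r, y) - frag_of (x, \<phi> r \<otimes>\<^bsub>S\<^esub> y) | x r y.
        x \<in> carrier S \<and> r \<in> carrier R \<and> y \<in> carrier S}"

definition tensor_rel ::
  "('r, 'n) ring_scheme \<Rightarrow> ('s, 'm) ring_scheme \<Rightarrow> ('r \<Rightarrow> 's) \<Rightarrow> ('s \<times> 's \<Rightarrow>\<^sub>0 int) set"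
  where "tensor_rel R S \<phi> = generate (tensor_free S) (tensor_relators R S \<phi>)"

definition tensor ::
  "('r, 'n) ring_scheme \<Rightarrow> ('s, 'm) ring_scheme \<Rightarrow> ('r \<Rightarrow> 's) \<Rightarrow> ('s \<times> 's \<Rightarrow>\<^sub>0 int) set monoid"
  where "tensor R S \<phi> = tensor_free S Mod tensor_rel R S \<phi>"

definition pure_tensor ::
  "('r, 'n) ring_scheme \<Rightarrow> ('s, 'm) ring_scheme \<Rightarrow> ('r \<Rightarrow> 's) \<Rightarrow> 's \<Rightarrow> 's \<Rightarrow> ('s \<times> 's \<Rightarrow>\<^sub>0 int) set"
  where "pure_tensor R S \<phi> x y = tensor_rel R S \<phi> #>\<^bsub>tensor_free S\<^esub> frag_of (x, y)"

text \<open>The endomorphism of the tensor product induced by a map on generators: it sends the coset of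
  \<open>c\<close> to the coset of \<open>frag_extend b c\<close>.\<close>

definition tensor_map ::
  "('r, 'n) ring_scheme \<Rightarrow> ('s, 'm) ring_scheme \<Rightarrow> ('r \<Rightarrow> 's) \<Rightarrow> ('s \<times> 's \<Rightarrow> ('s \<times> 's \<Rightarrow>\<^sub>0 int))
    \<Rightarrow> ('s \<times> 's \<Rightarrow>\<^sub>0 int) set \<Rightarrow> ('s \<times> 's \<Rightarrow>\<^sub>0 int) set"
  where "tensor_map R S \<phi> b Z = tensor_rel R S \<phi> <#>\<^bsub>tensor_free S\<^esub> (frag_extend b ` Z)"

definition tensor_lact ::
  "('r, 'n) ring_scheme \<Rightarrow> ('s, 'm) ring_scheme \<Rightarrow> ('r \<Rightarrow> 's) \<Rightarrow> 's
    \<Rightarrow> ('s \<times> 's \<Rightarrow>\<^sub>0 int) set \<Rightarrow> ('s \<times> 's \<Rightarrow>\<^sub>0 int) set"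
  where "tensor_lact R S \<phi> s = tensor_map R S \<phi> (\<lambda>(x, y). frag_of (s \<otimes>\<^bsub>S\<^esub> x, y))"

definition tensor_ract ::
  "('r, 'n) ring_scheme \<Rightarrow> ('s, 'm) ring_scheme \<Rightarrow> ('r \<Rightarrow> 's) \<Rightarrow> 's
    \<Rightarrow> ('s \<times> 's \<Rightarrow>\<^sub>0 int) set \<Rightarrow> ('s \<times> 's \<Rightarrow>\<^sub>0 int) set"
  where "tensor_ract R S \<phi> s = tensor_map R S \<phi> (\<lambda>(x, y). frag_of (x, y \<otimes>\<^bsub>S\<^esub> s))"

definition tensor_mult :: "('s, 'm) ring_scheme \<Rightarrow> ('s \<times> 's \<Rightarrow>\<^sub>0 int) set \<Rightarrow> 's"
  where \<comment> \<open>the multiplication map \<open>\<mu>\<close>; the value below does not depend on the representative \<open>c\<close>\<close>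
    "tensor_mult S Z = the_elem
      ((\<lambda>c. \<Oplus>\<^bsub>S\<^esub>p\<in>Poly_Mapping.keys c. [Poly_Mapping.lookup c p] \<cdot>\<^bsub>S\<^esub> (fst p \<otimes>\<^bsub>S\<^esub> snd p)) ` Z)"

definition tensor_grading ::
  "('r, 'n) ring_scheme \<Rightarrow> ('s, 'm) ring_scheme \<Rightarrow> (int \<Rightarrow> 's set) \<Rightarrow> ('r \<Rightarrow> 's)
    \<Rightarrow> int \<Rightarrow> ('s \<times> 's \<Rightarrow>\<^sub>0 int) set set"
  where "tensor_grading R S G \<phi> n = generate (tensor R S \<phi>)
    {pure_tensor R S \<phi> x y | x y. \<exists>i j. i + j = n \<and> x \<in> G i \<and> y \<in> G j}"

definition parity_twist :: "('s, 'm) ring_scheme \<Rightarrow> (int \<Rightarrow> 's set) \<Rightarrow> 's \<Rightarrow> 's"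
  where \<comment> \<open>the additive map with \<open>s \<mapsto> (-1)^i s\<close> for \<open>s\<close> homogeneous of degree \<open>i\<close>\<close>
    "parity_twist S G s =
      (\<Oplus>\<^bsub>S\<^esub>i\<in>{i. comp_of S G s i \<noteq> \<zero>\<^bsub>S\<^esub>}. sgn_mult S i (comp_of S G s i))"

definition tensor_diff ::
  "('r, 'n) ring_scheme \<Rightarrow> ('s, 'm) ring_scheme \<Rightarrow> (int \<Rightarrow> 's set) \<Rightarrow> ('s \<Rightarrow> 's) \<Rightarrow> ('r \<Rightarrow> 's)
    \<Rightarrow> ('s \<times> 's \<Rightarrow>\<^sub>0 int) set \<Rightarrow> ('s \<times> 's \<Rightarrow>\<^sub>0 int) set"
  where "tensor_diff R S G d \<phi> =
    tensor_map R S \<phi> (\<lambda>(x, y). frag_of (d x, y) + frag_of (parity_twist S G x, d y))"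

definition bimodule_splitting ::
  "('r, 'n) ring_scheme \<Rightarrow> ('s, 'm) ring_scheme \<Rightarrow> ('r \<Rightarrow> 's)
    \<Rightarrow> ('s \<Rightarrow> ('s \<times> 's \<Rightarrow>\<^sub>0 int) set) \<Rightarrow> bool"
  where "bimodule_splitting R S \<phi> \<rho> \<longleftrightarrow>
    \<rho> \<in> hom (add_monoid S) (tensor R S \<phi>) \<and>
    (\<forall>s \<in> carrier S. \<forall>x \<in> carrier S. \<rho> (s \<otimes>\<^bsub>S\<^esub> x) = tensor_lact R S \<phi> s (\<rho> x)) \<and>
    (\<forall>s \<in> carrier S. \<forall>x \<in> carrier S. \<rho> (x \<otimes>\<^bsub>S\<^esub> s) = tensor_ract R S \<phi> s (\<rho> x)) \<and>
    (\<forall>x \<in> carrier S. tensor_mult S (\<rho> x) = x)"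

definition separable_ring_hom ::
  "('r, 'n) ring_scheme \<Rightarrow> ('s, 'm) ring_scheme \<Rightarrow> ('r \<Rightarrow> 's) \<Rightarrow> bool"
  where "separable_ring_hom R S \<phi> \<longleftrightarrow> (\<exists>\<rho>. bimodule_splitting R S \<phi> \<rho>)"

definition graded_separable ::
  "('r, 'n) ring_scheme \<Rightarrow> ('s, 'm) ring_scheme \<Rightarrow> (int \<Rightarrow> 's set) \<Rightarrow> ('r \<Rightarrow> 's) \<Rightarrow> bool"
  where "graded_separable R S G \<phi> \<longleftrightarrow>
    (\<exists>\<rho>. bimodule_splitting R S \<phi> \<rho> \<and> (\<forall>n. \<rho> ` G n \<subseteq> tensor_grading R S G \<phi> n))"

definition dg_separable ::
  "('r, 'n) ring_scheme \<Rightarrow> ('s, 'm) ring_scheme \<Rightarrow> (int \<Rightarrow> 's set) \<Rightarrow> ('s \<Rightarrow> 's) \<Rightarrow> ('r \<Rightarrow> 's) \<Rightarrow> bool"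
  where "dg_separable R S G d \<phi> \<longleftrightarrow>
    (\<exists>\<rho>. bimodule_splitting R S \<phi> \<rho> \<and> (\<forall>n. \<rho> ` G n \<subseteq> tensor_grading R S G \<phi> n) \<and>
      (\<forall>x \<in> carrier S. \<rho> (d x) = tensor_diff R S G d \<phi> (\<rho> x)))"


section \<open>Laurent polynomials\<close>

text \<open>\<open>D[T, T\<^sup>-\<^sup>1]\<close>: the function \<open>f\<close> stands for the sum of the \<open>f i T^i\<close>.\<close>

definition laurent_ring :: "('d, 'm) ring_scheme \<Rightarrow> (int \<Rightarrow> 'd) ring"
  where "laurent_ring D =
    \<lparr>carrier = {f. (\<forall>i. f i \<in> carrier D) \<and> finite {i. f i \<noteq> \<zero>\<^bsub>D\<^esub>}},
     monoid.mult = (\<lambda>f g n. \<Oplus>\<^bsub>D\<^esub>i\<in>{i. f i \<noteq> \<zero>\<^bsub>D\<^esub>}. f i \<otimes>\<^bsub>D\<^esub> g (n - i)),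
     one = (\<lambda>i. if i = 0 then \<one>\<^bsub>D\<^esub> else \<zero>\<^bsub>D\<^esub>),
     ring.zero = (\<lambda>i. \<zero>\<^bsub>D\<^esub>),
     ring.add = (\<lambda>f g i. f i \<oplus>\<^bsub>D\<^esub> g i)\<rparr>"

definition laurent_grading :: "('d, 'm) ring_scheme \<Rightarrow> int \<Rightarrow> int \<Rightarrow> (int \<Rightarrow> 'd) set"
  where \<comment> \<open>coefficients in degree \<open>0\<close>, and \<open>T\<close> in degree \<open>t\<close>\<close>
    "laurent_grading D t m = {f \<in> carrier (laurent_ring D). \<forall>i. f i \<noteq> \<zero>\<^bsub>D\<^esub> \<longrightarrow> i * t = m}"

definition laurent_subring :: "('d, 'm) ring_scheme \<Rightarrow> nat \<Rightarrow> (int \<Rightarrow> 'd) ring"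
  where \<comment> \<open>\<open>D[T^n, T^(-n)]\<close> as a subring of \<open>D[T, T\<^sup>-\<^sup>1]\<close>\<close>
    "laurent_subring D n = (laurent_ring D)\<lparr>carrier :=
      {f \<in> carrier (laurent_ring D). \<forall>i. f i \<noteq> \<zero>\<^bsub>D\<^esub> \<longrightarrow> int n dvd i}\<rparr>"

definition laurent_map :: "('d \<Rightarrow> 'e) \<Rightarrow> (int \<Rightarrow> 'd) \<Rightarrow> int \<Rightarrow> 'e"
  where \<comment> \<open>\<open>\<iota>\<close> on coefficients and \<open>T^i \<mapsto> T^i\<close> on monomials\<close>
    "laurent_map \<iota> f = \<iota> \<circ> f"

end

theory Submission
  imports Defs
begin

text \<open>Write \<open>ker A\<close> for the ring of cycles of \<open>A\<close>. Everything rests on two elements. The first is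
  the class \<open>e = \<rho> 1\<close> of the tensor square: a splitting \<open>\<rho>\<close> of the multiplication \<open>\<mu>\<close> is the same
  thing as an \<open>e\<close> with \<open>\<mu> e = 1\<close> that commutes with \<open>S\<close>, and gradings and differentials only ask
  that \<open>e\<close> have degree zero and be a cycle (\<open>separable_iff\<close>, \<open>graded_separable_iff\<close>). The second is
  an element \<open>z\<close> of degree \<open>-1\<close> with \<open>d z = 1\<close>, which exists exactly when the algebra is acyclic;
  it gives \<open>A = ker A \<oplus> z ker A\<close>. If \<open>B\<close> has such a \<open>z\<close>, then its image is one for \<open>A\<close>, so \<open>A\<close> is
  acyclic too, and \<open>A\<close> arises from \<open>ker A\<close> by the same adjunction of \<open>z\<close> that yields \<open>B\<close> from
  \<open>ker B\<close>.

  Nonzero homogeneous cycles are units because each of them generates a dg-ideal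
  (\<open>homogeneous_cycle_inverse\<close>).

  A degree zero \<open>e\<close> over the cycles stays such an element over \<open>A\<close>, because it commutes with
  \<open>z\<close>, which comes from \<open>B\<close> and can be moved across the tensor sign
  (\<open>dg_separable_of_cycles\<close>). Conversely, outside characteristic two \<open>z z = 0\<close>, and
  \<open>x \<mapsto> d (z x)\<close> is a ring homomorphism from \<open>A\<close> onto \<open>ker A\<close> that maps the image of \<open>B\<close> to that of
  \<open>ker B\<close>. Elements \<open>e\<close> are transported along surjective ring homomorphisms of this kind
  (\<open>separability_element_image\<close>), so separability descends to the cycles. Sending \<open>T\<close> to \<open>1\<close> is
  another instance: it descends separability from Laurent polynomials to their coefficients.

  Extensions are shown not to be separable by one obstruction (\<open>separability_obstruction\<close>): a
  separable extension admits no (graded) derivation over the base that is not inner. The derivation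
  is \<open>d\<close> itself if \<open>B\<close> has zero differential, and \<open>T d/dT\<close> for Laurent polynomials; the latter kills
  \<open>T^n\<close> if \<open>n = 0\<close> in the field, and it kills every scalar if these are concentrated in degree zero.

  Finally, outside characteristic two there are no nonzero odd cycles, so that the cycles are a
  commutative graded-division ring. Unless it is concentrated in degree zero, such a ring is a
  field in degree zero with the powers of one unit \<open>T\<close> adjoined (\<open>laurent_isomorphism\<close>). If \<open>n\<close> is
  invertible and \<open>e\<close> is a separability element of the coefficients, then \<open>1/n \<Sum> T^j e T^(-j)\<close>,
  summed over \<open>0 \<le> j < n\<close>, is one of the Laurent polynomials (\<open>laurent_separable\<close>).\<close>


section \<open>Formal sums evaluated in an abelian group\<close>

text \<open>For \<open>F p = fst p \<otimes> snd p\<close> this is the expression that defines \<open>tensor_mult\<close>; other choices of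
  \<open>F\<close> describe the additive maps from the tensor square to \<open>M\<close>.\<close>

definition frag_eval :: "('m, 'z) ring_scheme \<Rightarrow> ('q \<Rightarrow> 'm) \<Rightarrow> ('q \<Rightarrow>\<^sub>0 int) \<Rightarrow> 'm"
  where "frag_eval M F c =
    (\<Oplus>\<^bsub>M\<^esub>p\<in>Poly_Mapping.keys c. [Poly_Mapping.lookup c p] \<cdot>\<^bsub>M\<^esub> F p)"

context abelian_group
begin

lemma int_multiple_closed [simp]: "x \<in> carrier G \<Longrightarrow> [(k::int)] \<cdot> x \<in> carrier G"
  using group.int_pow_closed[OF a_group, of x k] by (simp add: add_pow_def)

lemma int_multiple_0 [simp]: "[(0::int)] \<cdot> x = \<zero>"
  by (simp add: add_pow_def int_pow_def nat_pow_def)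

lemma int_multiple_zero [simp]: "[(k::int)] \<cdot> \<zero> = \<zero>"
  using group.int_pow_one[OF a_group, of k] by (simp add: add_pow_def)

lemma int_multiple_1 [simp]: "x \<in> carrier G \<Longrightarrow> [(1::int)] \<cdot> x = x"
  using group.int_pow_1[OF a_group, of x] by (simp add: add_pow_def)

lemma int_multiple_add:
  "x \<in> carrier G \<Longrightarrow> [(k + l :: int)] \<cdot> x = [k] \<cdot> x \<oplus> [l] \<cdot> x"
  using group.int_pow_mult[OF a_group, of x k l] by (simp add: add_pow_def)

lemma frag_eval_superset:
  assumes "finite U" "Poly_Mapping.keys c \<subseteq> U" "F \<in> U \<rightarrow> carrier G"
  shows "frag_eval G F c = (\<Oplus>p\<in>U. [Poly_Mapping.lookup c p] \<cdot> F p)"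
  unfolding frag_eval_def
proof (rule add.finprod_mono_neutral_cong_left[OF assms(1,2)])
  show "[Poly_Mapping.lookup c i] \<cdot> F i = \<zero>" if "i \<in> U - Poly_Mapping.keys c" for i
    using that by (auto simp: in_keys_iff)
  show "(\<lambda>p. [Poly_Mapping.lookup c p] \<cdot> F p) \<in> U \<rightarrow> carrier G"
    using assms by auto
qed auto

lemma frag_eval_0 [simp]: "frag_eval G F 0 = \<zero>"
  by (simp add: frag_eval_def)

lemma frag_eval_of [simp]: "F p \<in> carrier G \<Longrightarrow> frag_eval G F (frag_of p) = F p"
  by (simp add: frag_eval_def)

lemma frag_eval_closed:
  assumes "F \<in> Poly_Mapping.keys c \<rightarrow> carrier G"
  shows "frag_eval G F c \<in> carrier G"
  unfolding frag_eval_def by (rule finsum_closed) (use assms in auto)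

lemma frag_eval_add:
  assumes "Poly_Mapping.keys a \<subseteq> U" "Poly_Mapping.keys b \<subseteq> U" "F \<in> U \<rightarrow> carrier G"
  shows "frag_eval G F (a + b) = frag_eval G F a \<oplus> frag_eval G F b"
proof -
  define Y where "Y = Poly_Mapping.keys a \<union> Poly_Mapping.keys b"
  have Y: "finite Y" "Poly_Mapping.keys a \<subseteq> Y" "Poly_Mapping.keys b \<subseteq> Y"
    "Poly_Mapping.keys (a + b) \<subseteq> Y" "F \<in> Y \<rightarrow> carrier G"
    using assms keys_add[of a b] by (auto simp: Y_def)
  have "(\<Oplus>p\<in>Y. [Poly_Mapping.lookup (a + b) p] \<cdot> F p) =
      (\<Oplus>p\<in>Y. [Poly_Mapping.lookup a p] \<cdot> F p \<oplus> [Poly_Mapping.lookup b p] \<cdot> F p)"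
    by (rule add.finprod_cong') (use Y in \<open>auto simp: lookup_add int_multiple_add Pi_iff\<close>)
  also have "\<dots> = (\<Oplus>p\<in>Y. [Poly_Mapping.lookup a p] \<cdot> F p) \<oplus> (\<Oplus>p\<in>Y. [Poly_Mapping.lookup b p] \<cdot> F p)"
    by (rule add.finprod_multf) (use Y in auto)
  finally show ?thesis
    using Y by (simp add: frag_eval_superset)
qed

lemma frag_eval_diff:
  assumes "Poly_Mapping.keys a \<subseteq> U" "Poly_Mapping.keys b \<subseteq> U" "F \<in> U \<rightarrow> carrier G"
  shows "frag_eval G F (a - b) = frag_eval G F a \<ominus> frag_eval G F b"
proof -
  have *: "Poly_Mapping.keys (a - b) \<subseteq> U"
    using assms keys_diff[of a b] by auto
  have cl: "frag_eval G F c \<in> carrier G" if "Poly_Mapping.keys c \<subseteq> U" for c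
    using that assms by (intro frag_eval_closed) auto
  have "frag_eval G F a = frag_eval G F (a - b) \<oplus> frag_eval G F b"
    using frag_eval_add[OF * assms(2,3)] by simp
  then show ?thesis
    using cl[OF *] cl[OF assms(2)] by (simp add: minus_eq a_assoc r_neg)
qed

end

lemma additive_zero:
  assumes "abelian_group M" "abelian_group N" "f \<in> hom (add_monoid M) (add_monoid N)"
  shows "f \<zero>\<^bsub>M\<^esub> = \<zero>\<^bsub>N\<^esub>"
  using hom_one[OF assms(3)] assms(1,2) by (simp add: abelian_group.a_group)

lemma additive_uminus:
  assumes "abelian_group M" "abelian_group N" "f \<in> hom (add_monoid M) (add_monoid N)"
    "x \<in> carrier M"
  shows "f (\<ominus>\<^bsub>M\<^esub> x) = \<ominus>\<^bsub>N\<^esub> f x"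
  using group_hom.hom_inv[of "add_monoid M" "add_monoid N" f x] assms
  by (simp add: abelian_group.a_group group_hom_def group_hom_axioms_def a_inv_def)

lemma additive_minus:
  assumes "abelian_group M" "abelian_group N" "f \<in> hom (add_monoid M) (add_monoid N)"
    "x \<in> carrier M" "y \<in> carrier M"
  shows "f (x \<ominus>\<^bsub>M\<^esub> y) = f x \<ominus>\<^bsub>N\<^esub> f y"
  using assms additive_uminus[OF assms(1-3,5)] abelian_group.a_inv_closed[OF assms(1,5)]
  by (simp add: a_minus_def hom_def)

lemma additiveI:
  assumes "\<And>x. x \<in> carrier M \<Longrightarrow> f x \<in> carrier N"
    "\<And>x y. x \<in> carrier M \<Longrightarrow> y \<in> carrier M \<Longrightarrow> f (x \<oplus>\<^bsub>M\<^esub> y) = f x \<oplus>\<^bsub>N\<^esub> f y"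
  shows "f \<in> hom (add_monoid M) (add_monoid N)"
  using assms by (auto simp: hom_def)

lemma additive_closed:
  "f \<in> hom (add_monoid M) (add_monoid N) \<Longrightarrow> x \<in> carrier M \<Longrightarrow> f x \<in> carrier N"
  by (auto simp: hom_def)

lemma additive_add:
  "f \<in> hom (add_monoid M) (add_monoid N) \<Longrightarrow> x \<in> carrier M \<Longrightarrow> y \<in> carrier M
    \<Longrightarrow> f (x \<oplus>\<^bsub>M\<^esub> y) = f x \<oplus>\<^bsub>N\<^esub> f y"
  by (auto simp: hom_def)


section \<open>The tensor square through its representatives\<close>

lemma keys_diff_subset:
  "Poly_Mapping.keys a \<subseteq> U \<Longrightarrow> Poly_Mapping.keys b \<subseteq> U \<Longrightarrow> Poly_Mapping.keys (a - b) \<subseteq> U"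
  for a b :: "'q \<Rightarrow>\<^sub>0 int"
  using keys_diff[of a b] by blast

definition frag_map :: "('s \<Rightarrow> 't) \<Rightarrow> ('s \<Rightarrow> 't) \<Rightarrow> ('s \<times> 's \<Rightarrow>\<^sub>0 int) \<Rightarrow> ('t \<times> 't \<Rightarrow>\<^sub>0 int)"
  where "frag_map g h = frag_extend (\<lambda>(x, y). frag_of (g x, h y))"

lemma frag_map_0 [simp]: "frag_map g h 0 = 0"
  and frag_map_of [simp]: "frag_map g h (frag_of (x, y)) = frag_of (g x, h y)"
  and frag_map_diff: "frag_map g h (a - b) = frag_map g h a - frag_map g h b"
  and frag_map_add: "frag_map g h (a + b) = frag_map g h a + frag_map g h b"
  by (simp_all add: frag_map_def frag_extend_diff frag_extend_add)

lemma keys_frag_map: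
  assumes "Poly_Mapping.keys c \<subseteq> U" "\<And>x y. (x, y) \<in> U \<Longrightarrow> (g x, h y) \<in> Y"
  shows "Poly_Mapping.keys (frag_map g h c) \<subseteq> Y"
proof -
  have "Poly_Mapping.keys (frag_map g h c) \<subseteq>
      (\<Union>p\<in>Poly_Mapping.keys c. Poly_Mapping.keys ((\<lambda>(x, y). frag_of (g x, h y)) p))"
    unfolding frag_map_def by (rule keys_frag_extend)
  also have "\<dots> \<subseteq> Y"
    using assms by (auto simp: keys_frag_of)
  finally show ?thesis .
qed

lemma frag_map_compose:
  "frag_map g h (frag_map g' h' c) = frag_map (\<lambda>x. g (g' x)) (\<lambda>y. h (h' y)) c"
proof -
  have "Poly_Mapping.keys c \<subseteq> UNIV" by simp
  then show ?thesis
    by (induction c rule: frag_induction) (auto simp: frag_map_diff)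
qed

lemma frag_map_ident [simp]: "frag_map (\<lambda>x. x) (\<lambda>y. y) c = c"
proof -
  have "Poly_Mapping.keys c \<subseteq> UNIV" by simp
  then show ?thesis
    by (induction c rule: frag_induction) (auto simp: frag_map_diff)
qed

lemma frag_map_cong:
  assumes "Poly_Mapping.keys c \<subseteq> U" "\<And>x y. (x, y) \<in> U \<Longrightarrow> g x = g' x" "\<And>x y. (x, y) \<in> U \<Longrightarrow> h y = h' y"
  shows "frag_map g h c = frag_map g' h' c"
  unfolding frag_map_def
  by (rule frag_extend_eq) (use assms in \<open>fastforce\<close>)

definition balanced :: "('r, 'n) ring_scheme \<Rightarrow> ('s, 'm) ring_scheme \<Rightarrow> ('r \<Rightarrow> 's)
    \<Rightarrow> ('t, 'z) ring_scheme \<Rightarrow> ('s \<Rightarrow> 's \<Rightarrow> 't) \<Rightarrow> bool"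
  where "balanced R S \<phi> M F \<longleftrightarrow>
    (\<forall>x\<in>carrier S. F x \<in> hom (add_monoid S) (add_monoid M)) \<and>
    (\<forall>y\<in>carrier S. (\<lambda>x. F x y) \<in> hom (add_monoid S) (add_monoid M)) \<and>
    (\<forall>x\<in>carrier S. \<forall>r\<in>carrier R. \<forall>y\<in>carrier S. F (x \<otimes>\<^bsub>S\<^esub> \<phi> r) y = F x (\<phi> r \<otimes>\<^bsub>S\<^esub> y))"

lemma balancedI:
  assumes "\<And>x y. x \<in> carrier S \<Longrightarrow> y \<in> carrier S \<Longrightarrow> F x y \<in> carrier M"
    "\<And>x x' y. x \<in> carrier S \<Longrightarrow> x' \<in> carrier S \<Longrightarrow> y \<in> carrier S \<Longrightarrow>
      F (x \<oplus>\<^bsub>S\<^esub> x') y = F x y \<oplus>\<^bsub>M\<^esub> F x' y"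
    "\<And>x y y'. x \<in> carrier S \<Longrightarrow> y \<in> carrier S \<Longrightarrow> y' \<in> carrier S \<Longrightarrow>
      F x (y \<oplus>\<^bsub>S\<^esub> y') = F x y \<oplus>\<^bsub>M\<^esub> F x y'"
    "\<And>x r y. x \<in> carrier S \<Longrightarrow> r \<in> carrier R \<Longrightarrow> y \<in> carrier S \<Longrightarrow>
      F (x \<otimes>\<^bsub>S\<^esub> \<phi> r) y = F x (\<phi> r \<otimes>\<^bsub>S\<^esub> y)"
  shows "balanced R S \<phi> M F"
  using assms unfolding balanced_def by (auto intro!: additiveI)

locale tensor_square = ring S
  for R :: "('r, 'n) ring_scheme" and S :: "('s, 'm) ring_scheme" (structure)
    and \<phi> :: "'r \<Rightarrow> 's" +
  assumes \<phi>_closed: "r \<in> carrier R \<Longrightarrow> \<phi> r \<in> carrier S"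
begin

abbreviation pairs where "pairs \<equiv> carrier S \<times> carrier S"
abbreviation rels where "rels \<equiv> tensor_rel R S \<phi>"

lemma tensor_relators_keys:
  assumes "c \<in> tensor_relators R S \<phi>"
  shows "Poly_Mapping.keys c \<subseteq> pairs"
proof -
  show ?thesis
    using assms \<phi>_closed unfolding tensor_relators_def
    by (elim UnE CollectE exE conjE; hypsubst; intro keys_diff_subset) (simp_all add: keys_frag_of)
qed

lemma rels_subgroup: "subgroup rels (tensor_free S)"
  unfolding tensor_rel_def
  by (rule group.generate_is_subgroup) (use tensor_relators_keys in auto)

lemma rels_keys: "c \<in> rels \<Longrightarrow> Poly_Mapping.keys c \<subseteq> pairs"
  using subgroup.subset[OF rels_subgroup] by (meson carrier_free_Abelian_group_iff subsetD)

lemma rels_0 [simp]: "0 \<in> rels"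
  using subgroup.one_closed[OF rels_subgroup] by simp

lemma rels_add: "a \<in> rels \<Longrightarrow> b \<in> rels \<Longrightarrow> a + b \<in> rels"
  using subgroup.m_closed[OF rels_subgroup] by simp

lemma rels_uminus: "a \<in> rels \<Longrightarrow> - a \<in> rels"
  using subgroup.m_inv_closed[OF rels_subgroup, of a] rels_keys[of a] by simp

lemma rels_diff: "a \<in> rels \<Longrightarrow> b \<in> rels \<Longrightarrow> a - b \<in> rels"
  using rels_add[of a "- b"] rels_uminus[of b] by simp

lemma rels_incl: "c \<in> tensor_relators R S \<phi> \<Longrightarrow> c \<in> rels"
  unfolding tensor_rel_def by (rule generate.incl)

lemma rels_add_left:
  assumes "x \<in> carrier S" "x' \<in> carrier S" "y \<in> carrier S"
  shows "frag_of (x \<oplus> x', y) - frag_of (x, y) - frag_of (x', y) \<in> rels"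
  by (rule rels_incl) (use assms in \<open>auto simp: tensor_relators_def\<close>)

lemma rels_add_right:
  assumes "x \<in> carrier S" "y \<in> carrier S" "y' \<in> carrier S"
  shows "frag_of (x, y \<oplus> y') - frag_of (x, y) - frag_of (x, y') \<in> rels"
  by (rule rels_incl) (use assms in \<open>auto simp: tensor_relators_def\<close>)

lemma rels_balance:
  assumes "x \<in> carrier S" "r \<in> carrier R" "y \<in> carrier S"
  shows "frag_of (x \<otimes> \<phi> r, y) - frag_of (x, \<phi> r \<otimes> y) \<in> rels"
  by (rule rels_incl) (use assms in \<open>auto simp: tensor_relators_def\<close>)

lemma rels_zero_right:
  assumes "x \<in> carrier S" shows "frag_of (x, \<zero>) \<in> rels"
  using rels_uminus[OF rels_add_right[OF assms zero_closed zero_closed]] by simp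

text \<open>A map on formal sums descends to the tensor square once it behaves well on each of the three
  families of relators.\<close>

lemma rels_induct [consumes 1, case_names zero add_left add_right balance diff]:
  assumes "c \<in> rels" "Q 0"
    and "\<And>x x' y. x \<in> carrier S \<Longrightarrow> x' \<in> carrier S \<Longrightarrow> y \<in> carrier S \<Longrightarrow>
      Q (frag_of (x \<oplus> x', y) - frag_of (x, y) - frag_of (x', y))"
    and "\<And>x y y'. x \<in> carrier S \<Longrightarrow> y \<in> carrier S \<Longrightarrow> y' \<in> carrier S \<Longrightarrow>
      Q (frag_of (x, y \<oplus> y') - frag_of (x, y) - frag_of (x, y'))"
    and "\<And>x r y. x \<in> carrier S \<Longrightarrow> r \<in> carrier R \<Longrightarrow> y \<in> carrier S \<Longrightarrow>
      Q (frag_of (x \<otimes> \<phi> r, y) - frag_of (x, \<phi> r \<otimes> y))"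
    and diff: "\<And>a b. a \<in> rels \<Longrightarrow> b \<in> rels \<Longrightarrow> Q a \<Longrightarrow> Q b \<Longrightarrow> Q (a - b)"
  shows "Q c"
proof -
  have rel: "Q h" if "h \<in> tensor_relators R S \<phi>" for h
    using that assms(3-5) unfolding tensor_relators_def by auto
  have "c \<in> rels \<and> Q c"
    using assms(1) unfolding tensor_rel_def
  proof (induction c rule: generate.induct)
    case one
    then show ?case using assms(2) by (simp flip: tensor_rel_def)
  next
    case (incl h)
    then show ?case using rel rels_incl by (auto simp flip: tensor_rel_def)
  next
    case (inv h)
    then have "inv\<^bsub>tensor_free S\<^esub> h = 0 - h" "h \<in> rels"
      using tensor_relators_keys rels_incl by auto
    then show ?case
      using diff[of 0 h] rel[OF inv] assms(2) rels_uminus[of h] by (simp flip: tensor_rel_def)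
  next
    case (eng h1 h2)
    then have *: "h1 \<in> rels" "h2 \<in> rels" "Q h1" "Q h2"
      by (auto simp flip: tensor_rel_def)
    then have "Q (0 - h2)" "0 - h2 \<in> rels" using diff[of 0 h2] assms(2) rels_uminus by auto
    then have "Q (h1 - (0 - h2))" using * diff[of h1 "0 - h2"] by blast
    then show ?case
      using * rels_add by (simp flip: tensor_rel_def)
  qed
  then show ?thesis ..
qed

lemma frag_eval_rels:
  assumes M: "abelian_group M" and F: "balanced R S \<phi> M F" and c: "c \<in> rels"
  shows "frag_eval M (\<lambda>p. F (fst p) (snd p)) c = \<zero>\<^bsub>M\<^esub>"
proof -
  interpret M: abelian_group M by fact
  let ?F = "\<lambda>p. F (fst p) (snd p)"
  have cl: "?F \<in> pairs \<rightarrow> carrier M"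
    using F unfolding balanced_def by (auto simp: hom_def Pi_iff)
  have cl': "F x y \<in> carrier M" if "x \<in> carrier S" "y \<in> carrier S" for x y
    using cl that by (auto simp: Pi_iff)
  have D: "frag_eval M ?F (a - b) = frag_eval M ?F a \<ominus>\<^bsub>M\<^esub> frag_eval M ?F b"
    if "Poly_Mapping.keys a \<subseteq> pairs" "Poly_Mapping.keys b \<subseteq> pairs" for a b
    using M.frag_eval_diff[OF that cl] .
  have K: "Poly_Mapping.keys (a - b) \<subseteq> pairs"
    if "Poly_Mapping.keys a \<subseteq> pairs" "Poly_Mapping.keys b \<subseteq> pairs" for a b :: "'s \<times> 's \<Rightarrow>\<^sub>0 int"
    using that keys_diff[of a b] by blast
  have sub: "(u \<oplus>\<^bsub>M\<^esub> v) \<ominus>\<^bsub>M\<^esub> u \<ominus>\<^bsub>M\<^esub> v = \<zero>\<^bsub>M\<^esub>" if "u \<in> carrier M" "v \<in> carrier M" for u v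
    using that M.a_comm[of u v] by (simp add: a_minus_def M.a_assoc M.r_neg)
  from c show ?thesis
  proof (induction c rule: rels_induct)
    case (add_left x x' y)
    have "F (x \<oplus> x') y = F x y \<oplus>\<^bsub>M\<^esub> F x' y"
      using F add_left unfolding balanced_def by (auto simp: hom_def)
    then show ?case
      using add_left by (simp add: D K keys_frag_of cl' sub)
  next
    case (add_right x y y')
    have "F x (y \<oplus> y') = F x y \<oplus>\<^bsub>M\<^esub> F x y'"
      using F add_right unfolding balanced_def by (auto simp: hom_def)
    then show ?case
      using add_right by (simp add: D K keys_frag_of cl' sub)
  next
    case (balance x r y)
    have "F (x \<otimes> \<phi> r) y = F x (\<phi> r \<otimes> y)"
      using F balance unfolding balanced_def by auto
    then show ?case
      using balance \<phi>_closed by (simp add: D K keys_frag_of cl' a_minus_def M.r_neg)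
  next
    case (diff a b)
    then show ?case
      using D[OF rels_keys rels_keys, of a b] by (simp add: a_minus_def M.r_neg)
  qed simp
qed

lemma balanced_mult: "balanced R S \<phi> S (\<otimes>)"
  by (rule balancedI) (auto simp: l_distr r_distr m_assoc \<phi>_closed)

text \<open>A pair of additive maps induces a map of tensor squares as soon as it moves scalars to
  scalars; that the new scalar may depend on the two arguments makes multiplications by an element
  on one side an instance, too.\<close>

lemma frag_map_rels:
  assumes S': "tensor_square R' S' \<phi>'"
    and gh: "g \<in> hom (add_monoid S) (add_monoid S')" "h \<in> hom (add_monoid S) (add_monoid S')"
    and bal: "\<And>x r y. x \<in> carrier S \<Longrightarrow> r \<in> carrier R \<Longrightarrow> y \<in> carrier S \<Longrightarrow>
      \<exists>r'\<in>carrier R'. g (x \<otimes> \<phi> r) = g x \<otimes>\<^bsub>S'\<^esub> \<phi>' r' \<and> h (\<phi> r \<otimes> y) = \<phi>' r' \<otimes>\<^bsub>S'\<^esub> h y"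
    and c: "c \<in> rels"
  shows "frag_map g h c \<in> tensor_rel R' S' \<phi>'"
proof -
  interpret S': tensor_square R' S' \<phi>' by fact
  note cl = additive_closed[OF gh(1)] additive_closed[OF gh(2)]
  from c show ?thesis
  proof (induction c rule: rels_induct)
    case (add_left x x' y)
    then show ?case
      using S'.rels_add_left by (simp add: frag_map_diff additive_add[OF gh(1)] cl)
  next
    case (add_right x y y')
    then show ?case
      using S'.rels_add_right by (simp add: frag_map_diff additive_add[OF gh(2)] cl)
  next
    case (balance x r y)
    then obtain r' where "r' \<in> carrier R'" "g (x \<otimes> \<phi> r) = g x \<otimes>\<^bsub>S'\<^esub> \<phi>' r'"
      "h (\<phi> r \<otimes> y) = \<phi>' r' \<otimes>\<^bsub>S'\<^esub> h y"
      using bal by blast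
    then show ?case
      using balance S'.rels_balance[of "g x" r' "h y"] by (simp add: frag_map_diff cl)
  qed (auto simp: frag_map_diff S'.rels_diff)
qed

abbreviation lact where "lact s \<equiv> frag_map (\<lambda>x. s \<otimes> x) (\<lambda>y. y)"
abbreviation ract where "ract s \<equiv> frag_map (\<lambda>x. x) (\<lambda>y. y \<otimes> s)"

lemma lact_rels: "s \<in> carrier S \<Longrightarrow> c \<in> rels \<Longrightarrow> lact s c \<in> rels"
  using tensor_square_axioms
  by (rule frag_map_rels) (auto intro!: additiveI simp: r_distr m_assoc \<phi>_closed)

lemma ract_rels: "s \<in> carrier S \<Longrightarrow> c \<in> rels \<Longrightarrow> ract s c \<in> rels"
  using tensor_square_axioms
  by (rule frag_map_rels) (auto intro!: additiveI simp: l_distr m_assoc \<phi>_closed)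

lemma lact_keys: "s \<in> carrier S \<Longrightarrow> Poly_Mapping.keys c \<subseteq> pairs \<Longrightarrow> Poly_Mapping.keys (lact s c) \<subseteq> pairs"
  by (rule keys_frag_map) auto

lemma ract_keys: "s \<in> carrier S \<Longrightarrow> Poly_Mapping.keys c \<subseteq> pairs \<Longrightarrow> Poly_Mapping.keys (ract s c) \<subseteq> pairs"
  by (rule keys_frag_map) auto

lemma lact_add:
  assumes "s \<in> carrier S" "s' \<in> carrier S" "Poly_Mapping.keys c \<subseteq> pairs"
  shows "lact (s \<oplus> s') c - lact s c - lact s' c \<in> rels"
  using assms(3)
proof (induction c rule: frag_induction)
  case (one p)
  then show ?case
    using assms rels_add_left[of "s \<otimes> fst p" "s' \<otimes> fst p" "snd p"]
    by (auto simp: l_distr)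
next
  case (diff a b)
  then show ?case
    using rels_diff by (fastforce simp: frag_map_diff algebra_simps)
qed simp

lemma ract_add:
  assumes "s \<in> carrier S" "s' \<in> carrier S" "Poly_Mapping.keys c \<subseteq> pairs"
  shows "ract (s \<oplus> s') c - ract s c - ract s' c \<in> rels"
  using assms(3)
proof (induction c rule: frag_induction)
  case (one p)
  then show ?case
    using assms rels_add_right[of "fst p" "snd p \<otimes> s" "snd p \<otimes> s'"]
    by (auto simp: r_distr)
next
  case (diff a b)
  then show ?case
    using rels_diff by (fastforce simp: frag_map_diff algebra_simps)
qed simp

lemma lact_mult:
  assumes "s \<in> carrier S" "s' \<in> carrier S" "Poly_Mapping.keys c \<subseteq> pairs"
  shows "lact (s \<otimes> s') c = lact s (lact s' c)"
  unfolding frag_map_compose by (rule frag_map_cong[OF assms(3)]) (use assms in \<open>auto simp: m_assoc\<close>)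

lemma ract_mult:
  assumes "s \<in> carrier S" "s' \<in> carrier S" "Poly_Mapping.keys c \<subseteq> pairs"
  shows "ract (s \<otimes> s') c = ract s' (ract s c)"
  unfolding frag_map_compose by (rule frag_map_cong[OF assms(3)]) (use assms in \<open>auto simp: m_assoc\<close>)

lemma lact_ract: "lact s (ract s' c) = ract s' (lact s c)"
  by (simp add: frag_map_compose)

text \<open>Commutation with the class of \<open>c\<close>. The elements with this property form a subring that is
  closed under inverses, so that it suffices to test generators of \<open>S\<close>.\<close>

definition centralizes :: "('s \<times> 's \<Rightarrow>\<^sub>0 int) \<Rightarrow> 's \<Rightarrow> bool"
  where "centralizes c s \<longleftrightarrow> s \<in> carrier S \<and> lact s c - ract s c \<in> rels"

lemma centralizes_add:
  assumes "Poly_Mapping.keys c \<subseteq> pairs" "centralizes c s" "centralizes c s'"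
  shows "centralizes c (s \<oplus> s')"
proof -
  have s: "s \<in> carrier S" "s' \<in> carrier S" using assms by (auto simp: centralizes_def)
  have "lact s c - ract s c \<in> rels" "lact s' c - ract s' c \<in> rels"
    using assms by (auto simp: centralizes_def)
  note rels_add[OF rels_diff[OF lact_add[OF s assms(1)] ract_add[OF s assms(1)]] rels_add[OF this]]
  moreover have "(lact (s \<oplus> s') c - lact s c - lact s' c) - (ract (s \<oplus> s') c - ract s c - ract s' c)
      + ((lact s c - ract s c) + (lact s' c - ract s' c)) = lact (s \<oplus> s') c - ract (s \<oplus> s') c"
    by simp
  ultimately show ?thesis
    using s by (simp add: centralizes_def)
qed

lemma centralizes_mult:
  assumes "Poly_Mapping.keys c \<subseteq> pairs" "centralizes c s" "centralizes c s'"
  shows "centralizes c (s \<otimes> s')"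
proof -
  have s: "s \<in> carrier S" "s' \<in> carrier S" using assms by (auto simp: centralizes_def)
  have "lact s (lact s' c - ract s' c) + ract s' (lact s c - ract s c) \<in> rels"
    using assms by (intro rels_add lact_rels ract_rels) (auto simp: centralizes_def)
  then show ?thesis
    using s assms(1)
    by (simp add: centralizes_def lact_mult ract_mult frag_map_diff lact_ract)
qed

end


section \<open>Separability elements\<close>

context tensor_square
begin

definition cls :: "('s \<times> 's \<Rightarrow>\<^sub>0 int) \<Rightarrow> ('s \<times> 's \<Rightarrow>\<^sub>0 int) set"
  where "cls c = rels #>\<^bsub>tensor_free S\<^esub> c"

lemma mem_cls: "x \<in> cls c \<longleftrightarrow> x - c \<in> rels"
proof
  assume "x - c \<in> rels"
  then have "(x - c) + c \<in> cls c"
    unfolding cls_def r_coset_def by (intro UN_I[of "x - c"]) auto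
  then show "x \<in> cls c" by simp
qed (auto simp: cls_def r_coset_def)

lemma cls_eq_iff: "cls a = cls b \<longleftrightarrow> a - b \<in> rels"
proof
  assume "cls a = cls b"
  moreover have "a \<in> cls a" by (simp add: mem_cls)
  ultimately show "a - b \<in> rels" by (simp add: mem_cls)
next
  assume ab: "a - b \<in> rels"
  have "x - a \<in> rels \<longleftrightarrow> x - b \<in> rels" for x
    using rels_add[of "x - a" "a - b"] rels_diff[of "x - b" "a - b"] ab by auto
  then show "cls a = cls b" by (auto simp: mem_cls)
qed

lemma carrier_tensor: "carrier (tensor R S \<phi>) = cls ` {c. Poly_Mapping.keys c \<subseteq> pairs}"
  by (auto simp: tensor_def FactGroup_def RCOSETS_def cls_def)

lemma mult_tensor: "cls a \<otimes>\<^bsub>tensor R S \<phi>\<^esub> cls b = cls (a + b)"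
proof -
  have "x \<in> cls a <#>\<^bsub>tensor_free S\<^esub> cls b \<longleftrightarrow> x \<in> cls (a + b)" for x
  proof
    assume "x \<in> cls a <#>\<^bsub>tensor_free S\<^esub> cls b"
    then obtain u v where "u - a \<in> rels" "v - b \<in> rels" "x = u + v"
      by (auto simp: set_mult_def mem_cls)
    then show "x \<in> cls (a + b)"
      using rels_add[of "u - a" "v - b"] by (simp add: mem_cls algebra_simps)
  next
    assume "x \<in> cls (a + b)"
    then have "x - b \<in> cls a" "b \<in> cls b" "x = (x - b) + b"
      by (simp_all add: mem_cls algebra_simps)
    then show "x \<in> cls a <#>\<^bsub>tensor_free S\<^esub> cls b"
      unfolding set_mult_def by force
  qed
  then show ?thesis
    by (auto simp: tensor_def FactGroup_def)
qed

lemma one_tensor: "\<one>\<^bsub>tensor R S \<phi>\<^esub> = cls 0"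
  by (auto simp: tensor_def FactGroup_def mem_cls)

lemma group_tensor: "group (tensor R S \<phi>)"
proof -
  interpret F: comm_group "tensor_free S" by (rule abelian_free_Abelian_group)
  show ?thesis
    unfolding tensor_def
    by (intro normal.factorgroup_is_group F.subgroup_imp_normal rels_subgroup)
qed

lemma inv_tensor:
  assumes "Poly_Mapping.keys c \<subseteq> pairs"
  shows "inv\<^bsub>tensor R S \<phi>\<^esub> cls c = cls (- c)"
  by (rule group.inv_equality[OF group_tensor])
    (use assms in \<open>auto simp: mult_tensor one_tensor carrier_tensor\<close>)

text \<open>The set product with \<open>rels\<close> in \<open>tensor_map\<close> fills up the image of a coset to a full coset, so
  stability of \<open>rels\<close> is all that is needed to compute on representatives.\<close>

lemma tensor_map_cls:
  assumes "\<And>h. h \<in> rels \<Longrightarrow> frag_extend b h \<in> rels"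
  shows "tensor_map R S \<phi> b (cls c) = cls (frag_extend b c)"
proof (intro equalityI subsetI)
  fix x assume "x \<in> tensor_map R S \<phi> b (cls c)"
  then obtain h y where h: "h \<in> rels" "y - c \<in> rels" "x = h + frag_extend b y"
    by (auto simp: tensor_map_def set_mult_def mem_cls)
  have "h + frag_extend b (y - c) \<in> rels"
    using h assms by (intro rels_add) auto
  then show "x \<in> cls (frag_extend b c)"
    using h by (simp add: mem_cls frag_extend_diff algebra_simps)
next
  fix x assume "x \<in> cls (frag_extend b c)"
  then have "x - frag_extend b c \<in> rels" "c \<in> cls c"
    by (simp_all add: mem_cls)
  then show "x \<in> tensor_map R S \<phi> b (cls c)"
    unfolding tensor_map_def set_mult_def by force
qed

lemma tensor_lact_cls: "s \<in> carrier S \<Longrightarrow> tensor_lact R S \<phi> s (cls c) = cls (lact s c)"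
  unfolding tensor_lact_def frag_map_def
  by (rule tensor_map_cls) (use lact_rels in \<open>simp add: frag_map_def\<close>)

lemma tensor_ract_cls: "s \<in> carrier S \<Longrightarrow> tensor_ract R S \<phi> s (cls c) = cls (ract s c)"
  unfolding tensor_ract_def frag_map_def
  by (rule tensor_map_cls) (use ract_rels in \<open>simp add: frag_map_def\<close>)

abbreviation mult_eval where "mult_eval \<equiv> frag_eval S (\<lambda>p. fst p \<otimes> snd p)"

lemma tensor_mult_cls:
  assumes "Poly_Mapping.keys c \<subseteq> pairs"
  shows "tensor_mult S (cls c) = mult_eval c"
proof -
  have "mult_eval x = mult_eval c" if "x \<in> cls c" for x
  proof -
    have x: "x - c \<in> rels" using that by (simp add: mem_cls)
    have "mult_eval (x - c + c) = mult_eval (x - c) \<oplus> mult_eval c"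
      by (rule frag_eval_add[of _ pairs]) (use rels_keys[OF x] assms in auto)
    also have "mult_eval (x - c) = \<zero>"
      using frag_eval_rels[OF is_abelian_group balanced_mult x] .
    finally show ?thesis
      using frag_eval_closed[of "\<lambda>p. fst p \<otimes> snd p" c] assms by (force simp: Pi_iff)
  qed
  moreover have "c \<in> cls c" by (simp add: mem_cls)
  ultimately have "mult_eval ` cls c = {mult_eval c}"
    by blast
  then show ?thesis
    by (simp add: tensor_mult_def frag_eval_def)
qed

end

lemma frag_supported_induct [consumes 1, case_names zero one diff]:
  fixes c :: "'q \<Rightarrow>\<^sub>0 int"
  assumes "Poly_Mapping.keys c \<subseteq> U" "P 0" "\<And>p. p \<in> U \<Longrightarrow> P (frag_of p)"
    and "\<And>a b. Poly_Mapping.keys a \<subseteq> U \<Longrightarrow> Poly_Mapping.keys b \<subseteq> U \<Longrightarrow> P a \<Longrightarrow> P b \<Longrightarrow> P (a - b)"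
  shows "P c"
proof -
  have "Poly_Mapping.keys c \<subseteq> U \<and> P c"
    using assms(1)
  proof (induction c rule: frag_induction)
    case (diff a b)
    then show ?case using assms(4) keys_diff_subset by blast
  qed (use assms(2,3) in \<open>auto simp: keys_frag_of\<close>)
  then show ?thesis ..
qed

lemma frag_eval_frag_map:
  assumes "abelian_group M" "abelian_group N" "Poly_Mapping.keys c \<subseteq> U"
    and k: "k \<in> hom (add_monoid M) (add_monoid N)"
    and F: "\<And>x y. (x, y) \<in> U \<Longrightarrow> F (x, y) \<in> carrier M"
    and F': "\<And>x y. (x, y) \<in> U \<Longrightarrow> F' (g x, h y) = k (F (x, y))"
  shows "frag_eval N F' (frag_map g h c) = k (frag_eval M F c)"
proof -
  interpret M: abelian_group M by fact
  interpret N: abelian_group N by fact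
  define V where "V = (\<lambda>(x, y). (g x, h y)) ` U"
  have FU: "F \<in> U \<rightarrow> carrier M" and FV: "F' \<in> V \<rightarrow> carrier N"
    using F F' additive_closed[OF k] by (auto simp: V_def)
  have V: "Poly_Mapping.keys (frag_map g h a) \<subseteq> V" if "Poly_Mapping.keys a \<subseteq> U" for a
    by (rule keys_frag_map[OF that]) (force simp: V_def)
  from assms(3) show ?thesis
  proof (induction c rule: frag_supported_induct)
    case zero
    then show ?case using additive_zero[OF assms(1,2) k] by simp
  next
    case (one p)
    then show ?case
      using F F' additive_closed[OF k] by (cases p) simp
  next
    case (diff a b)
    have "frag_eval M F a \<in> carrier M" "frag_eval M F b \<in> carrier M"
      using diff FU by (auto intro!: M.frag_eval_closed)
    then show ?case
      using diff N.frag_eval_diff[OF V V FV, of a b] M.frag_eval_diff[OF diff(1,2) FU]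
      by (simp add: frag_map_diff additive_minus[OF assms(1,2) k])
  qed
qed

text \<open>A bimodule map out of \<open>S\<close> is determined by the image of \<open>1\<close>, which can be any element that
  commutes with \<open>S\<close>; here \<open>c\<close> represents that image. Working with representatives keeps the
  tensor square of one ring comparable with that of another.\<close>

definition separability_element ::
  "('r, 'n) ring_scheme \<Rightarrow> ('s, 'm) ring_scheme \<Rightarrow> ('r \<Rightarrow> 's) \<Rightarrow> ('s \<times> 's \<Rightarrow>\<^sub>0 int) \<Rightarrow> bool"
  where "separability_element R S \<phi> c \<longleftrightarrow>
    Poly_Mapping.keys c \<subseteq> carrier S \<times> carrier S \<and>
    frag_eval S (\<lambda>p. fst p \<otimes>\<^bsub>S\<^esub> snd p) c = \<one>\<^bsub>S\<^esub> \<and>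
    (\<forall>s\<in>carrier S. frag_map (\<lambda>x. s \<otimes>\<^bsub>S\<^esub> x) (\<lambda>y. y) c - frag_map (\<lambda>x. x) (\<lambda>y. y \<otimes>\<^bsub>S\<^esub> s) c
      \<in> tensor_rel R S \<phi>)"

lemma separability_elementD:
  assumes "separability_element R S \<phi> c"
  shows "Poly_Mapping.keys c \<subseteq> carrier S \<times> carrier S"
    and "frag_eval S (\<lambda>p. fst p \<otimes>\<^bsub>S\<^esub> snd p) c = \<one>\<^bsub>S\<^esub>"
    and "s \<in> carrier S \<Longrightarrow>
      frag_map (\<lambda>x. s \<otimes>\<^bsub>S\<^esub> x) (\<lambda>y. y) c - frag_map (\<lambda>x. x) (\<lambda>y. y \<otimes>\<^bsub>S\<^esub> s) c
        \<in> tensor_rel R S \<phi>"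
  using assms unfolding separability_element_def by blast+

context tensor_square
begin

lemma mult_eval_closed: "Poly_Mapping.keys c \<subseteq> pairs \<Longrightarrow> mult_eval c \<in> carrier S"
  by (intro frag_eval_closed Pi_I m_closed) (metis mem_Times_iff subsetD)+

lemma mult_eval_lact:
  assumes "s \<in> carrier S" "Poly_Mapping.keys c \<subseteq> pairs"
  shows "mult_eval (lact s c) = s \<otimes> mult_eval c"
proof (rule frag_eval_frag_map[OF is_abelian_group is_abelian_group assms(2), of "\<lambda>x. s \<otimes> x"])
  show "(\<otimes>) s \<in> hom (add_monoid S) (add_monoid S)"
    using assms(1) by (intro additiveI) (simp_all add: r_distr)
qed (use assms(1) in \<open>simp_all add: m_assoc\<close>)

lemma splitting_of_separability_element:
  assumes "separability_element R S \<phi> c"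
  shows "bimodule_splitting R S \<phi> (\<lambda>x. cls (lact x c))"
proof -
  note c = separability_elementD[OF assms]
  have "cls (lact (x \<otimes> s) c) = cls (ract s (lact x c))" if "s \<in> carrier S" "x \<in> carrier S" for s x
  proof -
    have "lact x (lact s c - ract s c) \<in> rels"
      using that c lact_rels by blast
    then show ?thesis
      using that c by (simp add: cls_eq_iff lact_mult frag_map_diff lact_ract)
  qed
  moreover have "(\<lambda>x. cls (lact x c)) \<in> hom (add_monoid S) (tensor R S \<phi>)"
  proof (rule homI)
    fix x y assume "x \<in> carrier (add_monoid S)" "y \<in> carrier (add_monoid S)"
    then show "cls (lact (x \<otimes>\<^bsub>add_monoid S\<^esub> y) c) = cls (lact x c) \<otimes>\<^bsub>tensor R S \<phi>\<^esub> cls (lact y c)"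
      using lact_add[OF _ _ c(1), of x y] by (simp add: mult_tensor cls_eq_iff algebra_simps)
  qed (use c lact_keys in \<open>auto simp: carrier_tensor\<close>)
  ultimately show ?thesis
    using c lact_keys by (simp add: bimodule_splitting_def tensor_lact_cls tensor_ract_cls
      tensor_mult_cls mult_eval_lact lact_mult)
qed

lemma separability_element_of_splitting:
  assumes \<rho>: "bimodule_splitting R S \<phi> \<rho>" and c: "Poly_Mapping.keys c \<subseteq> pairs" "\<rho> \<one> = cls c"
  shows "separability_element R S \<phi> c"
proof -
  have "lact s c - ract s c \<in> rels" if s: "s \<in> carrier S" for s
  proof -
    have "\<rho> (s \<otimes> \<one>) = tensor_lact R S \<phi> s (\<rho> \<one>)" "\<rho> (\<one> \<otimes> s) = tensor_ract R S \<phi> s (\<rho> \<one>)"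
      using \<rho> s one_closed unfolding bimodule_splitting_def by blast+
    then show ?thesis
      using s c by (simp add: tensor_lact_cls tensor_ract_cls flip: cls_eq_iff)
  qed
  moreover have "mult_eval c = \<one>"
    using \<rho> c tensor_mult_cls[OF c(1)] one_closed unfolding bimodule_splitting_def by metis
  ultimately show ?thesis
    using c by (simp add: separability_element_def)
qed

lemma separable_iff: "separable_ring_hom R S \<phi> \<longleftrightarrow> (\<exists>c. separability_element R S \<phi> c)"
proof
  assume "separable_ring_hom R S \<phi>"
  then obtain \<rho> where \<rho>: "bimodule_splitting R S \<phi> \<rho>"
    by (auto simp: separable_ring_hom_def)
  then have "\<rho> \<one> \<in> carrier (tensor R S \<phi>)"
    by (auto simp: bimodule_splitting_def hom_def)
  then show "\<exists>c. separability_element R S \<phi> c"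
    using separability_element_of_splitting[OF \<rho>] by (auto simp: carrier_tensor)
qed (use splitting_of_separability_element in \<open>auto simp: separable_ring_hom_def\<close>)

abbreviation degree_pairs :: "(int \<Rightarrow> 's set) \<Rightarrow> int \<Rightarrow> ('s \<times> 's) set"
  where "degree_pairs G n \<equiv> {(x, y). \<exists>i j. i + j = n \<and> x \<in> G i \<and> y \<in> G j}"

lemma tensor_grading_eq:
  assumes "\<And>i. G i \<subseteq> carrier S"
  shows "tensor_grading R S G \<phi> n = cls ` {c. Poly_Mapping.keys c \<subseteq> degree_pairs G n}"
proof (intro equalityI subsetI)
  have sub: "degree_pairs G n \<subseteq> pairs" using assms by blast
  fix z assume "z \<in> tensor_grading R S G \<phi> n"
  then show "z \<in> cls ` {c. Poly_Mapping.keys c \<subseteq> degree_pairs G n}"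
    unfolding tensor_grading_def
  proof (induction z rule: generate.induct)
    case one
    show ?case by (rule image_eqI[of _ _ 0]) (auto simp: one_tensor)
  next
    case (incl h)
    then obtain x y where "h = cls (frag_of (x, y))" "(x, y) \<in> degree_pairs G n"
      by (auto simp: pure_tensor_def cls_def)
    then show ?case by (intro image_eqI[of _ _ "frag_of (x, y)"]) (auto simp: keys_frag_of)
  next
    case (inv h)
    then obtain x y where h: "h = cls (frag_of (x, y))" "(x, y) \<in> degree_pairs G n"
      by (auto simp: pure_tensor_def cls_def)
    then have "inv\<^bsub>tensor R S \<phi>\<^esub> h = cls (- frag_of (x, y))"
      using subsetD[OF sub h(2)] by (simp add: inv_tensor keys_frag_of)
    then show ?case using h by (intro image_eqI[of _ _ "- frag_of (x, y)"]) (auto simp: keys_frag_of)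
  next
    case (eng h1 h2)
    then obtain a b where "Poly_Mapping.keys a \<subseteq> degree_pairs G n" "Poly_Mapping.keys b \<subseteq> degree_pairs G n"
      "h1 = cls a" "h2 = cls b" by auto
    then show ?case
      using keys_add[of a b] by (intro image_eqI[of _ _ "a + b"]) (auto simp: mult_tensor)
  qed
next
  have sub: "degree_pairs G n \<subseteq> pairs" using assms by blast
  let ?gens = "{pure_tensor R S \<phi> x y | x y. \<exists>i j. i + j = n \<and> x \<in> G i \<and> y \<in> G j}"
  have gens: "subgroup (tensor_grading R S G \<phi> n) (tensor R S \<phi>)"
    unfolding tensor_grading_def
  proof (rule group.generate_is_subgroup[OF group_tensor])
    show "?gens \<subseteq> carrier (tensor R S \<phi>)"
      using sub by (fastforce simp: pure_tensor_def carrier_tensor keys_frag_of simp flip: cls_def)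
  qed
  have "cls c \<in> tensor_grading R S G \<phi> n" if "Poly_Mapping.keys c \<subseteq> degree_pairs G n" for c
    using that
  proof (induction c rule: frag_supported_induct)
    case zero
    show ?case using subgroup.one_closed[OF gens] by (simp add: one_tensor)
  next
    case (one p)
    then have "cls (frag_of p) \<in> ?gens"
      by (auto simp: pure_tensor_def simp flip: cls_def)
    then show ?case
      unfolding tensor_grading_def by (rule generate.incl)
  next
    case (diff a b)
    then have "cls a \<otimes>\<^bsub>tensor R S \<phi>\<^esub> inv\<^bsub>tensor R S \<phi>\<^esub> cls b \<in> tensor_grading R S G \<phi> n"
      by (intro subgroup.m_closed[OF gens] subgroup.m_inv_closed[OF gens])
    moreover have "Poly_Mapping.keys b \<subseteq> pairs" using diff sub by blast
    ultimately show ?case by (simp add: inv_tensor mult_tensor)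
  qed
  then show "z \<in> tensor_grading R S G \<phi> n" if "z \<in> cls ` {c. Poly_Mapping.keys c \<subseteq> degree_pairs G n}" for z
    using that by auto
qed

lemma cls_lact_graded:
  assumes "graded_ring S G" and x: "x \<in> G n" and c: "Poly_Mapping.keys c \<subseteq> degree_pairs G 0"
  shows "cls (lact x c) \<in> tensor_grading R S G \<phi> n"
proof -
  interpret graded_ring S G by fact
  have sub: "G i \<subseteq> carrier S" for i using comp_subgroup additive_subgroup.a_subset by blast
  have "Poly_Mapping.keys (lact x c) \<subseteq> degree_pairs G n"
  proof (rule keys_frag_map[OF c])
    fix u v assume "(u, v) \<in> degree_pairs G 0"
    then obtain i j where "i + j = 0" "u \<in> G i" "v \<in> G j" by blast
    then have "n + i + j = n \<and> x \<otimes> u \<in> G (n + i) \<and> v \<in> G j"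
      using x comp_mult by simp
    then show "(x \<otimes> u, v) \<in> degree_pairs G n" by blast
  qed
  then show ?thesis unfolding tensor_grading_eq[OF sub] by (intro imageI CollectI)
qed

lemma graded_separable_iff:
  assumes "graded_ring S G"
  shows "graded_separable R S G \<phi> \<longleftrightarrow>
    (\<exists>c. separability_element R S \<phi> c \<and> Poly_Mapping.keys c \<subseteq> degree_pairs G 0)"
proof
  interpret graded_ring S G by fact
  have sub: "G i \<subseteq> carrier S" for i using comp_subgroup additive_subgroup.a_subset by blast
  have sub': "degree_pairs G n \<subseteq> pairs" for n using sub by blast
  { assume "graded_separable R S G \<phi>"
    then obtain \<rho> where \<rho>: "bimodule_splitting R S \<phi> \<rho>" "\<rho> ` G 0 \<subseteq> tensor_grading R S G \<phi> 0"
      by (auto simp: graded_separable_def)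
    have "\<rho> \<one> \<in> tensor_grading R S G \<phi> 0"
      using \<rho>(2) imageI[OF one_comp] by (rule subsetD)
    then have "\<rho> \<one> \<in> cls ` {c. Poly_Mapping.keys c \<subseteq> degree_pairs G 0}"
      by (simp only: tensor_grading_eq[OF sub])
    then obtain c where c: "\<rho> \<one> = cls c" "Poly_Mapping.keys c \<subseteq> degree_pairs G 0"
      by (elim imageE CollectE)
    have "separability_element R S \<phi> c"
      using \<rho>(1) subset_trans[OF c(2) sub'] c(1) by (rule separability_element_of_splitting)
    then show "\<exists>c. separability_element R S \<phi> c \<and> Poly_Mapping.keys c \<subseteq> degree_pairs G 0"
      using c(2) by (intro exI conjI) }
  assume "\<exists>c. separability_element R S \<phi> c \<and> Poly_Mapping.keys c \<subseteq> degree_pairs G 0"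
  then obtain c where c: "separability_element R S \<phi> c" "Poly_Mapping.keys c \<subseteq> degree_pairs G 0"
    by blast
  from cls_lact_graded[OF assms _ c(2)] show "graded_separable R S G \<phi>"
    unfolding graded_separable_def
    using splitting_of_separability_element[OF c(1)] by blast
qed

end

text \<open>Surjectivity of \<open>p\<close> enters since the image must commute with all of \<open>S'\<close>, and commutation with
  \<open>p s\<close> is inherited from commutation with \<open>s\<close>.\<close>

lemma separability_element_image:
  assumes "tensor_square R S \<phi>" "tensor_square R' S' \<phi>'"
    and p: "p \<in> ring_hom S S'" "p ` carrier S = carrier S'"
    and scalars: "\<And>r. r \<in> carrier R \<Longrightarrow> p (\<phi> r) \<in> \<phi>' ` carrier R'"
    and c: "separability_element R S \<phi> c"
  shows "separability_element R' S' \<phi>' (frag_map p p c)"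
proof -
  interpret tensor_square R S \<phi> by fact
  interpret S': tensor_square R' S' \<phi>' by fact
  have add: "p \<in> hom (add_monoid S) (add_monoid S')"
    using p(1) by (auto simp: ring_hom_def hom_def)
  note c' = separability_elementD[OF c]
  have cl: "p x \<in> carrier S'" if "x \<in> carrier S" for x
    using p(1) that by (rule ring_hom_closed)
  have "Poly_Mapping.keys (frag_map p p c) \<subseteq> S'.pairs"
    by (rule keys_frag_map[OF c'(1)]) (auto simp: cl)
  moreover have "S'.mult_eval (frag_map p p c) = p (mult_eval c)"
    by (rule frag_eval_frag_map[OF is_abelian_group S'.is_abelian_group c'(1) add])
      (auto simp: ring_hom_mult[OF p(1)])
  moreover have "S'.lact s' (frag_map p p c) - S'.ract s' (frag_map p p c) \<in> S'.rels"
    if s': "s' \<in> carrier S'" for s'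
  proof -
    obtain s where s: "s \<in> carrier S" "s' = p s" using p(2) s' by blast
    have "frag_map p p (lact s c - ract s c) \<in> S'.rels"
      using assms(2) add add _ c'(3)[OF s(1)]
    proof (rule frag_map_rels)
      fix x r y assume *: "x \<in> carrier S" "r \<in> carrier R" "y \<in> carrier S"
      then obtain r' where "r' \<in> carrier R'" "p (\<phi> r) = \<phi>' r'" using scalars by auto
      then show "\<exists>r'\<in>carrier R'. p (x \<otimes>\<^bsub>S\<^esub> \<phi> r) = p x \<otimes>\<^bsub>S'\<^esub> \<phi>' r' \<and> p (\<phi> r \<otimes>\<^bsub>S\<^esub> y) = \<phi>' r' \<otimes>\<^bsub>S'\<^esub> p y"
        using * \<phi>_closed by (auto simp: ring_hom_mult[OF p(1)])
    qed
    moreover have "frag_map p p (lact s c) = S'.lact s' (frag_map p p c)"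
      unfolding frag_map_compose
      by (rule frag_map_cong[OF c'(1)]) (use s in \<open>auto simp: ring_hom_mult[OF p(1)]\<close>)
    moreover have "frag_map p p (ract s c) = S'.ract s' (frag_map p p c)"
      unfolding frag_map_compose
      by (rule frag_map_cong[OF c'(1)]) (use s in \<open>auto simp: ring_hom_mult[OF p(1)]\<close>)
    ultimately show ?thesis by (simp add: frag_map_diff)
  qed
  ultimately show ?thesis
    using c'(2) ring_hom_one[OF p(1)] by (simp add: separability_element_def)
qed

text \<open>Let \<open>e\<close> be the class of \<open>c\<close>. Extended to the tensor square, the hypothesis \<open>leibniz\<close> says
  \<open>F (s e) = F (e s) + g (\<mu> e)\<close>, while \<open>s e = e s\<close> and \<open>\<mu> e = 1\<close>. For a derivation \<open>D\<close> that vanishes on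
  the scalars of a commutative ring, \<open>F x y = D x \<otimes> y\<close> and \<open>g u = D s \<otimes> u\<close> satisfy it, so that
  \<open>D s = 0\<close>.\<close>

lemma separability_obstruction:
  assumes "tensor_square R S \<phi>" and c: "separability_element R S \<phi> c"
    and M: "abelian_group M" and F: "balanced R S \<phi> M F"
    and g: "g \<in> hom (add_monoid S) (add_monoid M)" and s: "s \<in> carrier S"
    and leibniz: "\<And>x y. x \<in> carrier S \<Longrightarrow> y \<in> carrier S \<Longrightarrow>
      F (s \<otimes>\<^bsub>S\<^esub> x) y = F x (y \<otimes>\<^bsub>S\<^esub> s) \<oplus>\<^bsub>M\<^esub> g (x \<otimes>\<^bsub>S\<^esub> y)"
  shows "g \<one>\<^bsub>S\<^esub> = \<zero>\<^bsub>M\<^esub>"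
proof -
  interpret tensor_square R S \<phi> by fact
  interpret M: abelian_group M by fact
  let ?F = "frag_eval M (\<lambda>p. F (fst p) (snd p))"
  have Fcl: "(\<lambda>p. F (fst p) (snd p)) \<in> pairs \<rightarrow> carrier M"
    using F unfolding balanced_def by (auto simp: hom_def Pi_iff)
  then have Fcl': "F x y \<in> carrier M" if "x \<in> carrier S" "y \<in> carrier S" for x y
    using that by (auto simp: Pi_iff)
  have ev: "?F a \<in> carrier M" if "Poly_Mapping.keys a \<subseteq> pairs" for a
    by (rule M.frag_eval_closed) (use that Fcl in auto)
  have keys: "Poly_Mapping.keys c \<subseteq> pairs"
    using c by (rule separability_elementD)
  then have "?F (lact s c) = ?F (ract s c) \<oplus>\<^bsub>M\<^esub> g (mult_eval c)"
  proof (induction c rule: frag_supported_induct)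
    case zero
    then show ?case
      using additive_zero[OF is_abelian_group M g] by simp
  next
    case (one p)
    then show ?case
      using s leibniz[of "fst p" "snd p"] Fcl'[of "s \<otimes>\<^bsub>S\<^esub> fst p" "snd p"] Fcl'[of "fst p" "snd p \<otimes>\<^bsub>S\<^esub> s"]
      by (cases p) (simp add: M.frag_eval_of frag_eval_of)
  next
    case (diff a b)
    have sw: "(u \<oplus>\<^bsub>M\<^esub> v) \<ominus>\<^bsub>M\<^esub> (w \<oplus>\<^bsub>M\<^esub> z) = (u \<ominus>\<^bsub>M\<^esub> w) \<oplus>\<^bsub>M\<^esub> (v \<ominus>\<^bsub>M\<^esub> z)"
      if "u \<in> carrier M" "v \<in> carrier M" "w \<in> carrier M" "z \<in> carrier M" for u v w z
      using that by (simp add: a_minus_def M.minus_add M.a_ac)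
    have m: "mult_eval (a - b) = mult_eval a \<ominus>\<^bsub>S\<^esub> mult_eval b"
      by (rule frag_eval_diff[OF diff(1,2)]) auto
    have "?F (lact s (a - b)) = ?F (lact s a) \<ominus>\<^bsub>M\<^esub> ?F (lact s b)"
      unfolding frag_map_diff
      by (rule M.frag_eval_diff[OF lact_keys lact_keys Fcl]) (use diff s in auto)
    also have "\<dots> = (?F (ract s a) \<ominus>\<^bsub>M\<^esub> ?F (ract s b)) \<oplus>\<^bsub>M\<^esub> (g (mult_eval a) \<ominus>\<^bsub>M\<^esub> g (mult_eval b))"
      unfolding diff using diff(1,2) s
      by (intro sw ev ract_keys additive_closed[OF g] mult_eval_closed)
    also have "?F (ract s a) \<ominus>\<^bsub>M\<^esub> ?F (ract s b) = ?F (ract s (a - b))"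
      unfolding frag_map_diff
      by (rule M.frag_eval_diff[OF ract_keys ract_keys Fcl, symmetric]) (use diff s in auto)
    also have "g (mult_eval a) \<ominus>\<^bsub>M\<^esub> g (mult_eval b) = g (mult_eval (a - b))"
      unfolding m using diff(1,2)
      by (intro additive_minus[OF is_abelian_group M g, symmetric] mult_eval_closed)
    finally show ?case .
  qed
  moreover have "?F (lact s c) = ?F (ract s c)"
  proof -
    have "lact s c - ract s c \<in> rels"
      using c s by (rule separability_elementD)
    then have "?F (lact s c - ract s c) = \<zero>\<^bsub>M\<^esub>"
      using frag_eval_rels[OF M F] by blast
    then show ?thesis
      using M.frag_eval_diff[OF lact_keys ract_keys Fcl, OF s keys s keys] keys s
        M.minus_equality[of "?F (lact s c)" "\<ominus>\<^bsub>M\<^esub> ?F (ract s c)"]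
      by (simp add: ev lact_keys ract_keys a_minus_def)
  qed
  moreover have "mult_eval c = \<one>\<^bsub>S\<^esub>"
    using c by (rule separability_elementD)
  ultimately show ?thesis
    using keys s ev[OF ract_keys, OF s keys] additive_closed[OF g, of "\<one>\<^bsub>S\<^esub>"]
      M.add.l_cancel_one[of "?F (ract s c)" "g \<one>\<^bsub>S\<^esub>"]
    by simp
qed


section \<open>Graded rings\<close>

context graded_ring
begin

lemma comp_carrier: "x \<in> G n \<Longrightarrow> x \<in> carrier R"
  using comp_subgroup[of n] by (rule additive_subgroup.a_Hcarr)

lemma comp_zero [simp]: "\<zero> \<in> G n"
  using comp_subgroup[of n] by (rule additive_subgroup.zero_closed)

lemma comp_add: "x \<in> G n \<Longrightarrow> y \<in> G n \<Longrightarrow> x \<oplus> y \<in> G n"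
  using comp_subgroup[of n] by (rule additive_subgroup.a_closed)

lemma comp_uminus: "x \<in> G n \<Longrightarrow> \<ominus> x \<in> G n"
  using comp_subgroup[of n] abelian_group_axioms comp_carrier
  by (metis a_inv_def additive_subgroup.a_subgroup subgroup.m_inv_closed)

lemma decomposition_comp_of:
  "x \<in> carrier R \<Longrightarrow> homogeneous_decomposition R G x (comp_of R G x)"
  unfolding comp_of_def by (rule theI'[OF direct_sum])

lemma comp_of_in: "x \<in> carrier R \<Longrightarrow> comp_of R G x n \<in> G n"
  using decomposition_comp_of[of x] by (simp add: homogeneous_decomposition_def)

lemma comp_of_closed: "x \<in> carrier R \<Longrightarrow> comp_of R G x n \<in> carrier R"
  using comp_of_in comp_carrier by blast

lemma finite_comp_of: "x \<in> carrier R \<Longrightarrow> finite {i. comp_of R G x i \<noteq> \<zero>}"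
  using decomposition_comp_of[of x] by (simp add: homogeneous_decomposition_def)

lemma comp_of_sum:
  assumes "x \<in> carrier R" "finite I" "{i. comp_of R G x i \<noteq> \<zero>} \<subseteq> I"
  shows "x = (\<Oplus>i\<in>I. comp_of R G x i)"
proof -
  have "x = (\<Oplus>i\<in>{i. comp_of R G x i \<noteq> \<zero>}. comp_of R G x i)"
    using decomposition_comp_of[OF assms(1)] by (simp add: homogeneous_decomposition_def)
  also have "\<dots> = (\<Oplus>i\<in>I. comp_of R G x i)"
    by (rule add.finprod_mono_neutral_cong_left) (use assms comp_of_closed in auto)
  finally show ?thesis .
qed

lemma comp_of_eqI:
  assumes "\<And>i. f i \<in> G i" "finite I" "\<And>i. i \<notin> I \<Longrightarrow> f i = \<zero>" "x = (\<Oplus>i\<in>I. f i)"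
  shows "comp_of R G x = f"
proof -
  have sub: "{i. f i \<noteq> \<zero>} \<subseteq> I" using assms(3) by blast
  have cl: "f i \<in> carrier R" for i using assms(1) comp_carrier by blast
  then have x: "x \<in> carrier R" using assms by (auto intro: finsum_closed)
  have "(\<Oplus>i\<in>{i. f i \<noteq> \<zero>}. f i) = (\<Oplus>i\<in>I. f i)"
    by (rule add.finprod_mono_neutral_cong_left) (use assms(2) sub cl in auto)
  then have "homogeneous_decomposition R G x f"
    using assms finite_subset[OF sub] by (simp add: homogeneous_decomposition_def)
  then show ?thesis
    using direct_sum[OF x] decomposition_comp_of[OF x] by blast
qed

lemma comp_of_homogeneous:
  assumes "x \<in> G n" shows "comp_of R G x = (\<lambda>i. if i = n then x else \<zero>)"
  by (rule comp_of_eqI[of _ "{n}"]) (use assms comp_carrier in auto)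

lemma comp_of_add:
  assumes "x \<in> carrier R" "y \<in> carrier R"
  shows "comp_of R G (x \<oplus> y) = (\<lambda>i. comp_of R G x i \<oplus> comp_of R G y i)"
proof (rule comp_of_eqI)
  let ?I = "{i. comp_of R G x i \<noteq> \<zero>} \<union> {i. comp_of R G y i \<noteq> \<zero>}"
  show "finite ?I" using assms finite_comp_of by simp
  have "(\<Oplus>i\<in>?I. comp_of R G x i \<oplus> comp_of R G y i) =
      (\<Oplus>i\<in>?I. comp_of R G x i) \<oplus> (\<Oplus>i\<in>?I. comp_of R G y i)"
    by (rule finsum_addf) (use assms comp_of_closed in auto)
  then show "x \<oplus> y = (\<Oplus>i\<in>?I. comp_of R G x i \<oplus> comp_of R G y i)"
    using comp_of_sum[OF assms(1) \<open>finite ?I\<close>] comp_of_sum[OF assms(2) \<open>finite ?I\<close>] by simp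
qed (use assms comp_of_in comp_add in auto)

lemma graded_induct [consumes 1, case_names homogeneous add]:
  assumes "x \<in> carrier R"
    and hom: "\<And>n x. x \<in> G n \<Longrightarrow> Q x"
    and add: "\<And>x y. x \<in> carrier R \<Longrightarrow> y \<in> carrier R \<Longrightarrow> Q x \<Longrightarrow> Q y \<Longrightarrow> Q (x \<oplus> y)"
  shows "Q x"
proof -
  have "Q (\<Oplus>i\<in>I. comp_of R G x i)" if "finite I" for I
    using that
  proof (induction I)
    case empty
    show ?case using hom[OF comp_zero] by simp
  next
    case (insert i I)
    have "(\<Oplus>j\<in>insert i I. comp_of R G x j) = comp_of R G x i \<oplus> (\<Oplus>j\<in>I. comp_of R G x j)"
      by (rule finsum_insert) (use insert assms(1) comp_of_closed in auto)
    then show ?case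
      using add[OF _ _ hom insert.IH, of "comp_of R G x i" i] assms(1) comp_of_in[of x i] comp_of_closed
      by (auto intro!: finsum_closed)
  qed
  then show ?thesis
    using comp_of_sum[OF assms(1) finite_comp_of[OF assms(1)] subset_refl]
      finite_comp_of[OF assms(1)] by metis
qed

lemma comp_of_additive:
  assumes "graded_ring S H" and f: "f \<in> hom (add_monoid R) (add_monoid S)"
    and deg: "\<And>n x. x \<in> G n \<Longrightarrow> f x \<in> H (n + k)" and x: "x \<in> carrier R"
  shows "comp_of S H (f x) (n + k) = f (comp_of R G x n)"
proof -
  interpret S: graded_ring S H by fact
  have f0: "f \<zero> = \<zero>\<^bsub>S\<^esub>"
    using additive_zero[OF abelian_group_axioms S.abelian_group_axioms f] .
  from x show ?thesis
  proof (induction x rule: graded_induct)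
    case (homogeneous m x)
    then show ?case
      using S.comp_of_homogeneous[OF deg[OF homogeneous]] f0 by (simp add: comp_of_homogeneous)
  next
    case (add x y)
    then show ?case
      using additive_add[OF f] additive_closed[OF f] comp_of_closed
      by (simp add: comp_of_add S.comp_of_add)
  qed
qed

lemma additive_eq_on_homogeneous:
  assumes "abelian_group M" "f \<in> hom (add_monoid R) (add_monoid M)"
    "g \<in> hom (add_monoid R) (add_monoid M)"
    "\<And>n x. x \<in> G n \<Longrightarrow> f x = g x" "x \<in> carrier R"
  shows "f x = g x"
  using assms(5)
  by (induction x rule: graded_induct) (auto simp: assms(4) additive_add[OF assms(2)] additive_add[OF assms(3)])

lemma sgn_mult_add:
  "x \<in> carrier R \<Longrightarrow> y \<in> carrier R \<Longrightarrow> sgn_mult R i (x \<oplus> y) = sgn_mult R i x \<oplus> sgn_mult R i y"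
  by (simp add: sgn_mult_def minus_add)

lemma sgn_mult_zero [simp]: "sgn_mult R i \<zero> = \<zero>"
  by (simp add: sgn_mult_def)

lemma sgn_mult_closed [simp]: "x \<in> carrier R \<Longrightarrow> sgn_mult R i x \<in> carrier R"
  by (simp add: sgn_mult_def)

lemma parity_twist_superset:
  assumes "x \<in> carrier R" "finite I" "{i. comp_of R G x i \<noteq> \<zero>} \<subseteq> I"
  shows "parity_twist R G x = (\<Oplus>i\<in>I. sgn_mult R i (comp_of R G x i))"
  unfolding parity_twist_def
  by (rule add.finprod_mono_neutral_cong_left) (use assms comp_of_closed in auto)

lemma parity_twist_homogeneous:
  assumes "x \<in> G n" shows "parity_twist R G x = sgn_mult R n x"
proof -
  have "{i. comp_of R G x i \<noteq> \<zero>} \<subseteq> {n}" using assms by (auto simp: comp_of_homogeneous)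
  then show ?thesis
    using parity_twist_superset[of x "{n}"] comp_carrier[OF assms] assms
    by (simp add: comp_of_homogeneous)
qed

lemma parity_twist_additive: "parity_twist R G \<in> hom (add_monoid R) (add_monoid R)"
proof (rule additiveI)
  show "parity_twist R G x \<in> carrier R" if "x \<in> carrier R" for x
    unfolding parity_twist_def using that comp_of_closed by (auto intro!: finsum_closed)
next
  fix x y assume xy: "x \<in> carrier R" "y \<in> carrier R"
  let ?I = "{i. comp_of R G x i \<noteq> \<zero>} \<union> {i. comp_of R G y i \<noteq> \<zero>}"
  have I: "finite ?I" using xy finite_comp_of by simp
  have "(\<Oplus>i\<in>?I. sgn_mult R i (comp_of R G x i) \<oplus> sgn_mult R i (comp_of R G y i)) =
      (\<Oplus>i\<in>?I. sgn_mult R i (comp_of R G x i)) \<oplus> (\<Oplus>i\<in>?I. sgn_mult R i (comp_of R G y i))"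
    by (rule finsum_addf) (use xy comp_of_closed in auto)
  moreover have "{i. comp_of R G (x \<oplus> y) i \<noteq> \<zero>} \<subseteq> ?I" using xy by (auto simp: comp_of_add)
  ultimately show "parity_twist R G (x \<oplus> y) = parity_twist R G x \<oplus> parity_twist R G y"
    using xy I parity_twist_superset[of "x \<oplus> y" ?I] parity_twist_superset[of x ?I]
      parity_twist_superset[of y ?I]
    by (simp add: comp_of_add sgn_mult_add comp_of_closed)
qed

lemma parity_twist_closed [simp]: "x \<in> carrier R \<Longrightarrow> parity_twist R G x \<in> carrier R"
  by (rule additive_closed[OF parity_twist_additive])

lemma sgn_mult_mult:
  assumes "x \<in> carrier R" "y \<in> carrier R"
  shows "sgn_mult R (i + j) (x \<otimes> y) = sgn_mult R i x \<otimes> sgn_mult R j y"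
  using assms by (auto simp: sgn_mult_def l_minus r_minus)

lemma parity_twist_mult:
  assumes "x \<in> carrier R" "y \<in> carrier R"
  shows "parity_twist R G (x \<otimes> y) = parity_twist R G x \<otimes> parity_twist R G y"
proof -
  note tw = parity_twist_homogeneous additive_add[OF parity_twist_additive]
  show ?thesis
    using assms
  proof (induction x rule: graded_induct)
    case (homogeneous m x)
    from homogeneous(2) show ?case
    proof (induction y rule: graded_induct)
      case (homogeneous n y)
      note m = \<open>x \<in> G m\<close>
      show ?case
        using m homogeneous comp_mult[OF m homogeneous]
        by (simp add: tw sgn_mult_mult comp_carrier)
    next
      case (add y y')
      then show ?case
        using comp_carrier[OF homogeneous(1)] by (simp add: r_distr tw)
    qed
  next
    case (add x x')
    then show ?case by (simp add: l_distr tw)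
  qed
qed

end

lemma finsum_subring:
  assumes "ring R" "subring H R" "finite I" "f \<in> I \<rightarrow> H"
  shows "finsum (R\<lparr>carrier := H\<rparr>) f I = finsum R f I"
proof -
  interpret R: ring R by fact
  interpret H: ring "R\<lparr>carrier := H\<rparr>" using R.subring_is_ring[OF assms(2)] .
  have sub: "H \<subseteq> carrier R" using subringE(1)[OF assms(2)] .
  from assms(3,4) show ?thesis
  proof (induction I rule: finite_induct)
    case (insert i I)
    then have "f \<in> I \<rightarrow> carrier R" "f i \<in> carrier R" using sub by auto
    with insert show ?case
      using H.finsum_insert[of I i f] R.finsum_insert[of I i f] by (auto simp: Pi_iff)
  qed simp
qed

lemma a_inv_subring:
  assumes "ring R" "subring H R" "x \<in> H"
  shows "a_inv (R\<lparr>carrier := H\<rparr>) x = a_inv R x"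
proof -
  interpret R: ring R by fact
  interpret H: ring "R\<lparr>carrier := H\<rparr>" using R.subring_is_ring[OF assms(2)] .
  have "a_inv R x \<in> H" using subringE(5)[OF assms(2,3)] .
  then show ?thesis
    using H.minus_equality[of "a_inv R x" x] assms(3) subringE(1)[OF assms(2)]
    by (auto simp: R.l_neg)
qed

text \<open>If the components of the elements of \<open>H\<close> stay in \<open>H\<close>, then homogeneous decompositions in \<open>H\<close>
  are those of the ambient ring, and uniqueness is inherited.\<close>

lemma graded_subring:
  assumes "graded_ring R G" "subring H R" "\<And>x n. x \<in> H \<Longrightarrow> comp_of R G x n \<in> H"
  shows "graded_ring (R\<lparr>carrier := H\<rparr>) (\<lambda>n. G n \<inter> H)"
proof -
  interpret graded_ring R G by fact
  interpret H: ring "R\<lparr>carrier := H\<rparr>" using subring_is_ring[OF assms(2)] .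
  note sub = subringE[OF assms(2)]
  have deco: "homogeneous_decomposition (R\<lparr>carrier := H\<rparr>) (\<lambda>n. G n \<inter> H) x f \<longleftrightarrow>
      homogeneous_decomposition R G x f \<and> (\<forall>i. f i \<in> H)" for x f
    unfolding homogeneous_decomposition_def
    using finsum_subring[OF ring_axioms assms(2), of "{i. f i \<noteq> \<zero>\<^bsub>R\<^esub>}" f] by auto
  show ?thesis
  proof (intro graded_ring.intro graded_ring_axioms.intro H.ring_axioms)
    fix n
    show "additive_subgroup (G n \<inter> H) (R\<lparr>carrier := H\<rparr>)"
    proof (intro additive_subgroup.intro subgroup.intro)
      fix x assume x: "x \<in> G n \<inter> H"
      then have "inv\<^bsub>add_monoid (R\<lparr>carrier := H\<rparr>)\<^esub> x = \<ominus>\<^bsub>R\<^esub> x"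
        using a_inv_subring[OF ring_axioms assms(2), of x] by (simp add: a_inv_def)
      then show "inv\<^bsub>add_monoid (R\<lparr>carrier := H\<rparr>)\<^esub> x \<in> G n \<inter> H"
        using x comp_uminus sub(5) by auto
    qed (use comp_add sub in auto)
  next
    fix x i y j assume "x \<in> G i \<inter> H" "y \<in> G j \<inter> H"
    then show "x \<otimes>\<^bsub>R\<lparr>carrier := H\<rparr>\<^esub> y \<in> G (i + j) \<inter> H"
      using comp_mult sub(6) by auto
  next
    show "\<one>\<^bsub>R\<lparr>carrier := H\<rparr>\<^esub> \<in> G 0 \<inter> H"
      using one_comp sub(3) by simp
  next
    fix x assume "x \<in> carrier (R\<lparr>carrier := H\<rparr>)"
    then have x: "x \<in> H" "x \<in> carrier R" using sub(1) by auto
    show "\<exists>!f. homogeneous_decomposition (R\<lparr>carrier := H\<rparr>) (\<lambda>n. G n \<inter> H) x f"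
      unfolding deco
      using decomposition_comp_of[OF x(2)] direct_sum[OF x(2)] assms(3)[OF x(1)] by blast
  qed
qed


section \<open>Differential graded algebras\<close>

context dg_algebra
begin

lemma d_closed [simp]: "x \<in> carrier A \<Longrightarrow> d x \<in> carrier A"
proof (induction x rule: graded_induct)
  case (homogeneous n x)
  then show ?case using d_degree comp_carrier by blast
qed (simp add: d_add)

lemma d_additive: "d \<in> hom (add_monoid A) (add_monoid A)"
  by (rule additiveI) (simp_all add: d_add)

lemma d_zero [simp]: "d \<zero> = \<zero>"
  using additive_zero[OF abelian_group_axioms abelian_group_axioms d_additive] .

lemma d_uminus: "x \<in> carrier A \<Longrightarrow> d (\<ominus> x) = \<ominus> d x"
  using additive_uminus[OF abelian_group_axioms abelian_group_axioms d_additive] .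

lemma leibniz_left:
  assumes "a \<in> G i" "b \<in> carrier A"
  shows "d (a \<otimes> b) = (d a \<otimes> b) \<oplus> sgn_mult A i (a \<otimes> d b)"
  using assms(2)
proof (induction b rule: graded_induct)
  case (homogeneous n b)
  then show ?case using leibniz[OF assms(1)] by blast
next
  case (add x y)
  moreover have "a \<in> carrier A" using assms(1) comp_carrier by blast
  ultimately show ?case
    by (simp add: r_distr d_add sgn_mult_add a_ac)
qed

text \<open>With the sign absorbed into \<open>parity_twist\<close>, which is additive and multiplicative, the Leibniz rule
  applies to elements that need not be homogeneous.\<close>

lemma leibniz_twist:
  assumes "a \<in> carrier A" "b \<in> carrier A"
  shows "d (a \<otimes> b) = (d a \<otimes> b) \<oplus> (parity_twist A G a \<otimes> d b)"
  using assms(1)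
proof (induction a rule: graded_induct)
  case (homogeneous n a)
  moreover have "sgn_mult A n (a \<otimes> d b) = sgn_mult A n a \<otimes> d b"
    using homogeneous assms(2) by (simp add: sgn_mult_def l_minus comp_carrier)
  ultimately show ?case
    using leibniz_left[OF homogeneous assms(2)] by (simp add: parity_twist_homogeneous)
next
  case (add x y)
  then show ?case
    using assms(2) by (simp add: l_distr d_add additive_add[OF parity_twist_additive] a_ac)
qed

lemma d_one [simp]: "d \<one> = \<zero>"
proof -
  have "d (\<one> \<otimes> \<one>) = d \<one> \<oplus> d \<one>"
    using leibniz_left[OF one_comp one_closed] by (simp add: sgn_mult_def)
  then show ?thesis by simp
qed

lemma carrier_dker: "x \<in> carrier (dker A d) \<longleftrightarrow> x \<in> carrier A \<and> d x = \<zero>"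
  by (simp add: dker_def)

lemma d_mult_cycle_right:
  "a \<in> carrier A \<Longrightarrow> b \<in> carrier (dker A d) \<Longrightarrow> d (a \<otimes> b) = d a \<otimes> b"
  by (simp add: leibniz_twist carrier_dker)

lemma comp_of_d: "x \<in> carrier A \<Longrightarrow> comp_of A G (d x) (n + 1) = d (comp_of A G x n)"
  using comp_of_additive[OF graded_ring_axioms d_additive d_degree] .

lemma subring_cycles: "subring (carrier (dker A d)) A"
  by (rule subringI) (auto simp: carrier_dker d_uminus d_add leibniz_twist)

lemma dker_eq: "dker A d = A\<lparr>carrier := carrier (dker A d)\<rparr>"
  by (simp add: dker_def)

lemma dker_simps [simp]:
  "monoid.mult (dker A d) = monoid.mult A" "one (dker A d) = one A" "ring.zero (dker A d) = ring.zero A"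
  "ring.add (dker A d) = ring.add A"
  by (simp_all add: dker_def)

lemma a_inv_dker: "x \<in> carrier (dker A d) \<Longrightarrow> a_inv (dker A d) x = \<ominus> x"
  using a_inv_subring[OF ring_axioms subring_cycles] by (simp flip: dker_eq)

lemma graded_ring_dker: "graded_ring (dker A d) (dker_grading A G d)"
proof -
  have "comp_of A G x n \<in> carrier (dker A d)" if "x \<in> carrier (dker A d)" for x n
    using that comp_of_d[of x n, symmetric] comp_of_closed[of x n] comp_of_homogeneous[OF comp_zero]
    by (simp add: carrier_dker)
  from graded_subring[OF graded_ring_axioms subring_cycles this] show ?thesis
    unfolding dker_eq[symmetric] by (simp add: dker_grading_def[abs_def])
qed

lemma graded_commutative_dker:
  assumes "graded_commutative A G"
  shows "graded_commutative (dker A d) (dker_grading A G d)"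
proof -
  interpret k: graded_ring "dker A d" "dker_grading A G d" by (rule graded_ring_dker)
  have "sgn_mult (dker A d) i x = sgn_mult A i x" if "x \<in> carrier (dker A d)" for i x
    using that by (simp add: sgn_mult_def a_inv_dker)
  then show ?thesis
    using assms k.m_closed
    unfolding graded_commutative_def dker_grading_def by simp
qed

lemma acyclic_iff: "acyclic_dg A d \<longleftrightarrow> carrier (dker A d) \<subseteq> d ` carrier A"
proof -
  let ?B = "d ` carrier A"
  let ?M = "add_monoid (dker A d)"
  have one: "\<one>\<^bsub>cohomology A d\<^esub> = ?B"
    by (simp add: cohomology_def FactGroup_def)
  have car: "carrier (cohomology A d) = (\<lambda>x. ?B #>\<^bsub>?M\<^esub> x) ` carrier (dker A d)"
    by (auto simp: cohomology_def FactGroup_def RCOSETS_def)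
  have mem: "y \<in> ?B #>\<^bsub>?M\<^esub> x \<longleftrightarrow> (\<exists>b\<in>carrier A. y = d b \<oplus> x)" for x y
    by (auto simp: r_coset_def)
  have self: "x \<in> ?B #>\<^bsub>?M\<^esub> x" if "x \<in> carrier A" for x
    unfolding mem using that by (intro bexI[of _ \<zero>]) auto
  have triv: "?B #>\<^bsub>?M\<^esub> x = ?B" if x: "x \<in> ?B" for x
  proof (intro equalityI subsetI)
    obtain c where c: "c \<in> carrier A" "x = d c" using x by auto
    show "y \<in> ?B" if "y \<in> ?B #>\<^bsub>?M\<^esub> x" for y
    proof -
      obtain b where b: "b \<in> carrier A" "y = d b \<oplus> x" using \<open>y \<in> _\<close> mem by auto
      then show ?thesis using c by (auto intro!: image_eqI[of _ _ "b \<oplus> c"] simp: d_add)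
    qed
    show "y \<in> ?B #>\<^bsub>?M\<^esub> x" if "y \<in> ?B" for y
    proof -
      obtain b where b: "b \<in> carrier A" "y = d b" using \<open>y \<in> ?B\<close> by auto
      then show ?thesis
        unfolding mem using c
        by (intro bexI[of _ "b \<ominus> c"]) (simp_all add: d_add d_uminus a_minus_def a_assoc l_neg)
    qed
  qed
  show ?thesis
  proof
    assume "acyclic_dg A d"
    then have "?B #>\<^bsub>?M\<^esub> x = ?B" if "x \<in> carrier (dker A d)" for x
      using that unfolding acyclic_dg_def car one by blast
    moreover have "x \<in> ?B #>\<^bsub>?M\<^esub> x" if "x \<in> carrier (dker A d)" for x
      using that self[of x] by (simp only: carrier_dker)
    ultimately show "carrier (dker A d) \<subseteq> ?B" by blast
  next
    assume "carrier (dker A d) \<subseteq> ?B"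
    then have *: "?B #>\<^bsub>?M\<^esub> x = ?B" if "x \<in> carrier (dker A d)" for x
      using triv that by blast
    have "\<zero> \<in> carrier (dker A d)" by (simp add: carrier_dker)
    then show "acyclic_dg A d"
      unfolding acyclic_dg_def car one using * by (auto simp: image_iff)
  qed
qed

text \<open>Acyclicity amounts to a primitive \<open>z\<close> of \<open>1\<close>: multiplication by \<open>z\<close> is then a contracting
  homotopy, \<open>d (z x) + z d x = x\<close>.\<close>

lemma acyclic_imp_primitive:
  assumes "acyclic_dg A d" obtains z where "z \<in> G (-1)" "d z = \<one>"
proof -
  have "\<one> \<in> d ` carrier A"
    using assms unfolding acyclic_iff by (rule subsetD) (simp add: carrier_dker)
  then obtain y where y: "y \<in> carrier A" "d y = \<one>" by auto
  have "d (comp_of A G y (-1)) = \<one>"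
    using comp_of_d[OF y(1), of "-1"] y(2) comp_of_homogeneous[OF one_comp] by simp
  then show ?thesis using that comp_of_in[OF y(1)] by blast
qed

lemma d_mult_primitive:
  assumes "z \<in> G (-1)" "d z = \<one>" "x \<in> carrier A"
  shows "d (z \<otimes> x) = x \<ominus> z \<otimes> d x"
  using leibniz_left[OF assms(1,3)] assms(2,3) by (simp add: sgn_mult_def a_minus_def)

lemma primitive_imp_acyclic:
  assumes "z \<in> G (-1)" "d z = \<one>" shows "acyclic_dg A d"
  unfolding acyclic_iff
proof
  fix x assume "x \<in> carrier (dker A d)"
  then have "x \<in> carrier A" "d (z \<otimes> x) = x"
    using d_mult_primitive[OF assms] comp_carrier[OF assms(1)]
    by (simp_all add: carrier_dker a_minus_def)
  then show "x \<in> d ` carrier A"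
    using comp_carrier[OF assms(1)] by (metis image_eqI m_closed)
qed

text \<open>This is the only way in which the characteristic of \<open>K\<close> is used below.\<close>

lemma two_torsion_free:
  assumes "field K" "ring_char K \<noteq> 2" "x \<in> carrier A" "x \<oplus> x = \<zero>"
  shows "x = \<zero>"
proof -
  interpret K: field K by fact
  let ?two = "\<one>\<^bsub>K\<^esub> \<oplus>\<^bsub>K\<^esub> \<one>\<^bsub>K\<^esub>"
  have "?two \<noteq> \<zero>\<^bsub>K\<^esub>"
  proof
    assume two: "?two = \<zero>\<^bsub>K\<^esub>"
    have 1: "[(1::nat)] \<cdot>\<^bsub>K\<^esub> \<one>\<^bsub>K\<^esub> = \<one>\<^bsub>K\<^esub>"
      by simp
    have 2: "[(2::nat)] \<cdot>\<^bsub>K\<^esub> \<one>\<^bsub>K\<^esub> = \<zero>\<^bsub>K\<^esub>"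
      using two by (simp add: numeral_2_eq_2)
    have "(LEAST n. n > 0 \<and> [n] \<cdot>\<^bsub>K\<^esub> \<one>\<^bsub>K\<^esub> = \<zero>\<^bsub>K\<^esub>) = (2::nat)"
    proof (rule Least_equality)
      show "0 < (2::nat) \<and> [(2::nat)] \<cdot>\<^bsub>K\<^esub> \<one>\<^bsub>K\<^esub> = \<zero>\<^bsub>K\<^esub>" using 2 by simp
    next
      fix n :: nat assume n: "n > 0 \<and> [n] \<cdot>\<^bsub>K\<^esub> \<one>\<^bsub>K\<^esub> = \<zero>\<^bsub>K\<^esub>"
      then have "n \<noteq> 1" using 1 K.one_not_zero by metis
      with n show "2 \<le> n" by linarith
    qed
    then have "ring_char K = 2"
      using 2 zero_less_numeral unfolding ring_char_def by metis
    then show False using assms(2) by simp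
  qed
  then have "?two \<in> Units K" by (simp add: K.field_Units)
  then obtain h where h: "h \<in> carrier K" "h \<otimes>\<^bsub>K\<^esub> ?two = \<one>\<^bsub>K\<^esub>"
    by (auto simp: Units_def)
  have "x = (h \<otimes>\<^bsub>K\<^esub> ?two) \<odot> x" using h assms(3) by simp
  also have "\<dots> = h \<odot> (?two \<odot> x)"
    using h(1) assms(3) by (intro smult_assoc1) simp_all
  also have "?two \<odot> x = x \<oplus> x"
    using assms(3) by (simp add: smult_l_distr)
  finally show ?thesis using assms(4) h by simp
qed

end


section \<open>Graded commutative dg-division rings\<close>

context dg_algebra
begin

text \<open>The ideal is stable under \<open>d\<close> because \<open>d x = 0\<close> gives \<open>d (a x) = d a x\<close>.\<close>

lemma dg_left_ideal_of_cycle: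
  assumes x: "x \<in> G n" "d x = \<zero>"
  shows "dg_left_ideal ((\<lambda>a. a \<otimes> x) ` carrier A) A G d"
proof -
  let ?I = "(\<lambda>a. a \<otimes> x) ` carrier A"
  have xc: "x \<in> carrier A" using x(1) comp_carrier by blast
  have add: "(\<lambda>a. a \<otimes> x) \<in> hom (add_monoid A) (add_monoid A)"
    using xc by (intro additiveI) (simp_all add: l_distr)
  have "additive_subgroup ?I A"
  proof (intro additive_subgroup.intro subgroup.intro)
    fix y assume "y \<in> ?I"
    then obtain a where "a \<in> carrier A" "y = a \<otimes> x" by auto
    then show "inv\<^bsub>add_monoid A\<^esub> y \<in> ?I"
      using xc by (auto intro!: image_eqI[of _ _ "\<ominus> a"] simp: l_minus simp flip: a_inv_def)
  next
    fix y y' assume "y \<in> ?I" "y' \<in> ?I"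
    then obtain a b where "a \<in> carrier A" "y = a \<otimes> x" "b \<in> carrier A" "y' = b \<otimes> x" by auto
    then show "y \<otimes>\<^bsub>add_monoid A\<^esub> y' \<in> ?I"
      using xc by (auto intro!: image_eqI[of _ _ "a \<oplus> b"] simp: l_distr)
  next
    show "\<one>\<^bsub>add_monoid A\<^esub> \<in> ?I"
      using xc by (auto intro!: image_eqI[of _ _ \<zero>])
  qed (use xc in auto)
  moreover have "r \<otimes> y \<in> ?I" if r: "r \<in> carrier A" and y: "y \<in> ?I" for r y
  proof -
    obtain a where "a \<in> carrier A" "y = a \<otimes> x" using y by auto
    then show ?thesis
      using r xc by (auto intro!: image_eqI[of _ _ "r \<otimes> a"] simp: m_assoc)
  qed
  moreover have "comp_of A G y m \<in> ?I" if y: "y \<in> ?I" for y m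
  proof -
    obtain a where a: "a \<in> carrier A" "y = a \<otimes> x" using y by auto
    have "comp_of A G y (m - n + n) = comp_of A G a (m - n) \<otimes> x"
      unfolding a(2)
      by (rule comp_of_additive[OF graded_ring_axioms add _ a(1)]) (use x(1) comp_mult in auto)
    then show ?thesis
      using comp_of_closed[OF a(1)] by auto
  qed
  moreover have "d y \<in> ?I" if y: "y \<in> ?I" for y
  proof -
    obtain a where a: "a \<in> carrier A" "y = a \<otimes> x" using y by auto
    then have "d y = d a \<otimes> x"
      using x xc by (simp add: leibniz_twist)
    then show ?thesis using a by auto
  qed
  ultimately show ?thesis
    by (auto simp: dg_left_ideal_def left_ideal_def graded_subset_def)
qed

end

locale dg_division = dg_algebra K A G d
  for K :: "('k, 'l) ring_scheme" and A :: "('k, 'a, 'm) module_scheme" (structure)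
    and G :: "int \<Rightarrow> 'a set" and d :: "'a \<Rightarrow> 'a" +
  assumes division: "dg_division_ring K A G d" and comm: "graded_commutative A G"
begin

lemma graded_comm: "x \<in> G i \<Longrightarrow> y \<in> G j \<Longrightarrow> x \<otimes> y = sgn_mult A (i * j) (y \<otimes> x)"
  using comm unfolding graded_commutative_def by blast

lemma one_nonzero: "\<one> \<noteq> \<zero>"
proof
  assume "\<one> = \<zero>"
  then have "carrier A = {\<zero>}" by (rule one_zeroD)
  moreover have "carrier A \<noteq> {\<zero>}"
    using division unfolding dg_division_ring_def by (elim conjE)
  ultimately show False by contradiction
qed

text \<open>The dg-ideal \<open>A x\<close> contains \<open>x\<close> and hence is all of \<open>A\<close>, so \<open>x\<close> has a left inverse, which may
  be replaced by its component of degree \<open>- n\<close>. By graded commutativity the latter is a right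
  inverse up to sign, hence a two-sided one, and the Leibniz rule for \<open>d 1 = 0\<close> makes it a cycle.\<close>

lemma homogeneous_cycle_inverse:
  assumes x: "x \<in> G n" "d x = \<zero>" "x \<noteq> \<zero>"
  obtains y where "y \<in> G (- n)" "d y = \<zero>" "x \<otimes> y = \<one>" "y \<otimes> x = \<one>"
proof -
  let ?I = "(\<lambda>a. a \<otimes> x) ` carrier A"
  have xc: "x \<in> carrier A" using x(1) comp_carrier by blast
  have "x \<in> ?I" using xc by (auto intro!: image_eqI[of _ _ \<one>])
  then have "?I = carrier A"
    using dg_left_ideal_of_cycle[OF x(1,2)] division x(3)
    unfolding dg_division_ring_def by blast
  then obtain a where a: "a \<in> carrier A" "a \<otimes> x = \<one>"
    by (metis one_closed imageE)
  define y where "y = comp_of A G a (- n)"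
  have y: "y \<in> G (- n)" "y \<in> carrier A"
    using a comp_of_in comp_of_closed by (auto simp: y_def)
  have "(\<lambda>a. a \<otimes> x) \<in> hom (add_monoid A) (add_monoid A)"
    using xc by (intro additiveI) (simp_all add: l_distr)
  then have "comp_of A G (a \<otimes> x) (- n + n) = y \<otimes> x"
    unfolding y_def
    by (rule comp_of_additive[OF graded_ring_axioms _ _ a(1)]) (use x(1) comp_mult in auto)
  then have yx: "y \<otimes> x = \<one>"
    using a comp_of_homogeneous[OF one_comp] by simp
  \<comment> \<open>The sign has no effect after all: a left inverse \<open>y\<close> and a right inverse \<open>y'\<close>
    coincide.\<close>
  define y' where "y' = sgn_mult A (n * - n) y"
  have y': "y' \<in> carrier A" using y by (simp add: y'_def)
  have "x \<otimes> y = sgn_mult A (n * - n) \<one>"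
    using graded_comm[OF x(1) y(1)] yx by simp
  then have "x \<otimes> y' = \<one>"
    using xc y by (auto simp: y'_def sgn_mult_def r_minus)
  moreover from this have "y = y'"
    using yx xc y y' by (metis m_assoc l_one r_one)
  ultimately have xy: "x \<otimes> y = \<one>" by simp
  have "d (y \<otimes> x) = d y \<otimes> x"
    using x xc y by (simp add: leibniz_twist)
  then have "d y \<otimes> x = \<zero>"
    using yx by simp
  then have "d y = \<zero>"
    using xy y(2) xc by (metis d_closed m_assoc r_one l_null)
  then show ?thesis using that y(1) xy yx by blast
qed

theorem graded_division_ring_dker: "graded_division_ring (dker A d) (dker_grading A G d)"
proof -
  have "x \<in> Units (dker A d)" if x': "x \<in> dker_grading A G d n" "x \<noteq> \<zero>" for n x
  proof -
    have x: "x \<in> G n" "d x = \<zero>" using x' by (auto simp: dker_grading_def carrier_dker)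
    obtain y where y: "y \<in> G (- n)" "d y = \<zero>" "x \<otimes> y = \<one>" "y \<otimes> x = \<one>"
      using homogeneous_cycle_inverse[OF x x'(2)] .
    have "x \<in> carrier (dker A d)" "y \<in> carrier (dker A d)"
      using x y comp_carrier unfolding carrier_dker by blast+
    then show ?thesis
      using y(3,4) unfolding Units_def by auto
  qed
  moreover have "carrier (dker A d) \<noteq> {\<zero>}"
    using one_nonzero carrier_dker[of \<one>] by auto
  ultimately show ?thesis
    using graded_ring_dker by (simp add: graded_division_ring_def)
qed

lemma homogeneous_odd_square:
  assumes "\<And>x. x \<in> carrier A \<Longrightarrow> x \<oplus> x = \<zero> \<Longrightarrow> x = \<zero>" "x \<in> G n" "odd n"
  shows "x \<otimes> x = \<zero>"
proof -
  have "x \<in> carrier A" using assms(2) comp_carrier by blast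
  moreover have "x \<otimes> x = \<ominus> (x \<otimes> x)"
    using graded_comm[OF assms(2,2)] assms(3) by (simp add: sgn_mult_def)
  ultimately have "x \<otimes> x \<oplus> x \<otimes> x = \<zero>"
    by (metis l_neg m_closed)
  then show ?thesis using assms(1)[of "x \<otimes> x"] \<open>x \<in> carrier A\<close> by blast
qed

text \<open>Odd cycles vanish because a nonzero one would be both nilpotent and invertible.\<close>

lemma odd_cycle_zero:
  assumes "\<And>x. x \<in> carrier A \<Longrightarrow> x \<oplus> x = \<zero> \<Longrightarrow> x = \<zero>"
    "x \<in> dker_grading A G d n" "odd n"
  shows "x = \<zero>"
proof (rule ccontr)
  assume "x \<noteq> \<zero>"
  have x: "x \<in> G n" "d x = \<zero>" "x \<in> carrier A"
    using assms(2) comp_carrier[of x n] by (auto simp: dker_grading_def carrier_dker)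
  obtain y where "y \<in> G (- n)" "x \<otimes> y = \<one>"
    using homogeneous_cycle_inverse[OF x(1,2) \<open>x \<noteq> \<zero>\<close>] .
  then have "(x \<otimes> x) \<otimes> y = x"
    using x comp_carrier[of y "- n"] by (simp add: m_assoc)
  then show False
    using homogeneous_odd_square[OF assms(1) x(1) assms(3)] \<open>x \<noteq> \<zero>\<close>
      comp_carrier[OF \<open>y \<in> G (- n)\<close>] by simp
qed

end

text \<open>In this situation \<open>A = ker A \<oplus> z A\<close>, and \<open>z A\<close> is a two-sided ideal; \<open>retract\<close> is the projection
  to \<open>ker A\<close> along it.\<close>

locale dg_retraction = dg_division K A G d
  for K :: "('k, 'l) ring_scheme" and A :: "('k, 'a, 'm) module_scheme" (structure)
    and G :: "int \<Rightarrow> 'a set" and d :: "'a \<Rightarrow> 'a" +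
  fixes z :: 'a
  assumes z_degree: "z \<in> G (-1)" and d_z: "d z = \<one>" and z_square: "z \<otimes> z = \<zero>"
begin

definition retract :: "'a \<Rightarrow> 'a" where "retract x = d (z \<otimes> x)"

lemma z_closed [simp]: "z \<in> carrier A"
  using z_degree comp_carrier by blast

lemma retract_eq: "x \<in> carrier A \<Longrightarrow> retract x = x \<ominus> z \<otimes> d x"
  unfolding retract_def by (rule d_mult_primitive[OF z_degree d_z])

lemma retract_closed: "x \<in> carrier A \<Longrightarrow> retract x \<in> carrier (dker A d)"
  by (simp add: retract_def carrier_dker d_squared)

lemma retract_additive: "retract \<in> hom (add_monoid A) (add_monoid A)"
  by (rule additiveI) (simp_all add: retract_def r_distr d_add)

lemma retract_cycle: "x \<in> carrier (dker A d) \<Longrightarrow> retract x = x"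
  by (simp add: retract_eq carrier_dker a_minus_def)

lemma retract_one: "retract \<one> = \<one>"
  by (simp add: retract_def d_z)

lemma z_mult_z: "x \<in> carrier A \<Longrightarrow> z \<otimes> (z \<otimes> x) = \<zero>"
  by (simp add: z_square flip: m_assoc)

text \<open>Graded commutativity moves the two factors \<open>z\<close> next to each other.\<close>

lemma z_sandwich:
  assumes "x \<in> carrier A" shows "z \<otimes> x \<otimes> z = \<zero>"
  using assms
proof (induction x rule: graded_induct)
  case (homogeneous n x)
  have x: "x \<in> carrier A" using homogeneous comp_carrier by blast
  have "z \<otimes> x \<otimes> z = z \<otimes> sgn_mult A (n * (- 1)) (z \<otimes> x)"
    using graded_comm[OF homogeneous z_degree] x by (simp add: m_assoc)
  also have "\<dots> = sgn_mult A (n * (- 1)) (z \<otimes> (z \<otimes> x))"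
    using x by (simp add: sgn_mult_def r_minus)
  also have "\<dots> = \<zero>"
    using x by (simp add: z_mult_z)
  finally show ?case .
next
  case (add x y)
  then show ?case by (simp add: l_distr r_distr)
qed

lemma retract_z_mult: "x \<in> carrier A \<Longrightarrow> retract (z \<otimes> x) = \<zero>"
  by (simp add: retract_def z_mult_z)

lemma retract_mult_z: "x \<in> carrier A \<Longrightarrow> retract (x \<otimes> z) = \<zero>"
  using z_sandwich[of x] by (simp add: retract_def m_assoc)

text \<open>As \<open>d y' = 0\<close> for \<open>y' = retract y\<close>, the right-hand side is \<open>d (z x y')\<close>, and \<open>z x y' = z x y\<close>
  because \<open>y' - y\<close> is a multiple of \<open>z\<close> from the left.\<close>

lemma retract_mult:
  assumes "x \<in> carrier A" "y \<in> carrier A"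
  shows "retract (x \<otimes> y) = retract x \<otimes> retract y"
proof -
  have "z \<otimes> x \<otimes> z \<otimes> d y = z \<otimes> x \<otimes> (z \<otimes> d y)"
    using assms by (intro m_assoc) auto
  then have "z \<otimes> x \<otimes> (z \<otimes> d y) = \<zero>"
    using assms by (simp add: z_sandwich)
  then have "z \<otimes> x \<otimes> retract y = z \<otimes> x \<otimes> y"
    using assms by (simp add: retract_eq a_minus_def r_distr r_minus)
  then have "retract (x \<otimes> y) = d (z \<otimes> x \<otimes> retract y)"
    using assms by (simp add: retract_def m_assoc)
  also have "\<dots> = retract x \<otimes> retract y"
    using assms retract_closed[of y]
    by (subst d_mult_cycle_right) (simp_all add: retract_def)
  finally show ?thesis .
qed

lemma retract_ring_hom: "retract \<in> ring_hom A (dker A d)"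
  by (rule ring_hom_memI)
    (simp_all add: retract_closed retract_mult retract_one additive_add[OF retract_additive])

lemma retract_onto: "retract ` carrier A = carrier (dker A d)"
proof (intro equalityI subsetI)
  fix x assume "x \<in> carrier (dker A d)"
  then show "x \<in> retract ` carrier A"
    using retract_cycle by (auto intro!: image_eqI[of _ _ x] simp: carrier_dker)
qed (use retract_closed in auto)

lemma retract_degree:
  assumes "x \<in> G n" shows "retract x \<in> dker_grading A G d n"
proof -
  have "z \<otimes> x \<in> G (n - 1)" using comp_mult[OF z_degree assms] by simp
  then have "retract x \<in> G n" using d_degree by (fastforce simp: retract_def)
  then show ?thesis
    using retract_closed comp_carrier[OF assms] by (simp add: dker_grading_def)
qed

end


section \<open>Separability of dg-extensions\<close>

locale dg_extension_pair =
  B: dg_division K B GB dB + A: dg_division K A GA dA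
  for K :: "('k, 'l) ring_scheme"
    and B :: "('k, 'b, 'n) module_scheme" and GB :: "int \<Rightarrow> 'b set" and dB :: "'b \<Rightarrow> 'b"
    and A :: "('k, 'a, 'm) module_scheme" and GA :: "int \<Rightarrow> 'a set" and dA :: "'a \<Rightarrow> 'a" +
  fixes \<phi> :: "'b \<Rightarrow> 'a"
  assumes extension: "dg_extension K B GB dB A GA dA \<phi>"
begin

abbreviation kB where "kB \<equiv> dker B dB"
abbreviation kA where "kA \<equiv> dker A dA"
abbreviation gA where "gA \<equiv> dker_grading A GA dA"

lemma \<phi>_hom: "\<phi> \<in> ring_hom B A"
  and \<phi>_degree: "b \<in> GB n \<Longrightarrow> \<phi> b \<in> GA n"
  and \<phi>_d: "b \<in> carrier B \<Longrightarrow> dA (\<phi> b) = \<phi> (dB b)"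
  using extension by (simp_all add: dg_extension_def image_subset_iff)

lemma \<phi>_in: "b \<in> carrier B \<Longrightarrow> \<phi> b \<in> carrier A"
  using \<phi>_hom by (rule ring_hom_closed)

lemma \<phi>_mult: "b \<in> carrier B \<Longrightarrow> b' \<in> carrier B \<Longrightarrow> \<phi> (b \<otimes>\<^bsub>B\<^esub> b') = \<phi> b \<otimes>\<^bsub>A\<^esub> \<phi> b'"
  using \<phi>_hom by (rule ring_hom_mult)

lemma \<phi>_additive: "\<phi> \<in> hom (add_monoid B) (add_monoid A)"
  using \<phi>_hom by (auto simp: ring_hom_def hom_def)

lemma \<phi>_zero: "\<phi> \<zero>\<^bsub>B\<^esub> = \<zero>\<^bsub>A\<^esub>"
  using additive_zero[OF B.abelian_group_axioms A.abelian_group_axioms \<phi>_additive] .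

lemma \<phi>_uminus: "b \<in> carrier B \<Longrightarrow> \<phi> (\<ominus>\<^bsub>B\<^esub> b) = \<ominus>\<^bsub>A\<^esub> \<phi> b"
  using additive_uminus[OF B.abelian_group_axioms A.abelian_group_axioms \<phi>_additive] .

lemma \<phi>_cycle: "b \<in> carrier kB \<Longrightarrow> \<phi> b \<in> carrier kA"
  using \<phi>_in \<phi>_d \<phi>_zero by (simp add: A.carrier_dker B.carrier_dker)

sublocale T: tensor_square B A \<phi>
  by unfold_locales (rule \<phi>_in)

lemma tensor_square_cycles: "tensor_square kB kA \<phi>"
proof -
  interpret graded_ring kA gA by (rule A.graded_ring_dker)
  show ?thesis by unfold_locales (rule \<phi>_cycle)
qed

lemma \<phi>_primitive: "z \<in> GB (-1) \<Longrightarrow> dB z = \<one>\<^bsub>B\<^esub> \<Longrightarrow> \<phi> z \<in> GA (-1) \<and> dA (\<phi> z) = \<one>\<^bsub>A\<^esub>"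
  using \<phi>_degree \<phi>_d B.comp_carrier ring_hom_one[OF \<phi>_hom] by metis

lemma \<phi>_parity_twist:
  assumes "b \<in> carrier B"
  shows "\<phi> (parity_twist B GB b) = parity_twist A GA (\<phi> b)"
proof -
  have "(\<lambda>b. \<phi> (parity_twist B GB b)) \<in> hom (add_monoid B) (add_monoid A)"
    by (rule additiveI)
      (simp_all add: \<phi>_in additive_add[OF \<phi>_additive] additive_add[OF B.parity_twist_additive])
  moreover have "(\<lambda>b. parity_twist A GA (\<phi> b)) \<in> hom (add_monoid B) (add_monoid A)"
    by (rule additiveI)
      (simp_all add: \<phi>_in additive_add[OF \<phi>_additive] additive_add[OF A.parity_twist_additive])
  moreover have "\<phi> (parity_twist B GB b) = parity_twist A GA (\<phi> b)" if "b \<in> GB n" for n b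
    using that \<phi>_degree[OF that] B.comp_carrier[OF that]
    by (simp add: B.parity_twist_homogeneous A.parity_twist_homogeneous sgn_mult_def \<phi>_uminus)
  ultimately show ?thesis
    using B.additive_eq_on_homogeneous[OF A.abelian_group_axioms] assms by blast
qed

lemma inclusion_additive: "(\<lambda>x. x) \<in> hom (add_monoid kA) (add_monoid A)"
  by (rule additiveI) (simp_all add: A.carrier_dker)

lemma rels_cycles:
  assumes "c \<in> tensor_rel kB kA \<phi>" shows "c \<in> T.rels"
proof -
  interpret k: tensor_square kB kA \<phi> by (rule tensor_square_cycles)
  have "frag_map (\<lambda>x. x) (\<lambda>y. y) c \<in> T.rels"
    using T.tensor_square_axioms inclusion_additive inclusion_additive _ assms
    by (rule k.frag_map_rels) (auto simp: B.carrier_dker)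
  then show ?thesis by simp
qed

definition diff_frag :: "'a \<times> 'a \<Rightarrow> ('a \<times> 'a \<Rightarrow>\<^sub>0 int)"
  where "diff_frag = (\<lambda>(x, y). frag_of (dA x, y) + frag_of (parity_twist A GA x, dA y))"

text \<open>\<open>diff_frag\<close> gives the differential of the tensor square on generators, so this is its
  well-definedness over \<open>B\<close>. It needs that the scalars are stable under \<open>d\<close> and under the parity
  twist.\<close>

lemma diff_frag_rels:
  assumes "c \<in> T.rels" shows "frag_extend diff_frag c \<in> T.rels"
  using assms
proof (induction c rule: T.rels_induct)
  case zero
  then show ?case by simp
next
  case (add_left x x' y)
  let ?tw = "parity_twist A GA"
  have "(frag_of (dA x \<oplus>\<^bsub>A\<^esub> dA x', y) - frag_of (dA x, y) - frag_of (dA x', y))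
      + (frag_of (?tw x \<oplus>\<^bsub>A\<^esub> ?tw x', dA y) - frag_of (?tw x, dA y) - frag_of (?tw x', dA y)) \<in> T.rels"
    using add_left by (intro T.rels_add T.rels_add_left) simp_all
  then show ?case
    using add_left
    by (simp add: frag_extend_diff frag_extend_add diff_frag_def A.d_add additive_add[OF A.parity_twist_additive] algebra_simps)
next
  case (add_right x y y')
  let ?tw = "parity_twist A GA"
  have "(frag_of (dA x, y \<oplus>\<^bsub>A\<^esub> y') - frag_of (dA x, y) - frag_of (dA x, y'))
      + (frag_of (?tw x, dA y \<oplus>\<^bsub>A\<^esub> dA y') - frag_of (?tw x, dA y) - frag_of (?tw x, dA y')) \<in> T.rels"
    using add_right by (intro T.rels_add T.rels_add_right) simp_all
  then show ?case
    using add_right by (simp add: frag_extend_diff frag_extend_add diff_frag_def A.d_add algebra_simps)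
next
  case (balance x r y)
  let ?tw = "parity_twist A GA" and ?tr = "parity_twist B GB r"
  note [simp] = balance \<phi>_in
  \<comment> \<open>Expand the differentials of \<open>x r \<otimes> y\<close> and \<open>x \<otimes> r y\<close>, and move \<open>r\<close>, \<open>d r\<close> and the
    twist of \<open>r\<close> across the tensor sign.\<close>
  have "(frag_of (dA x \<otimes>\<^bsub>A\<^esub> \<phi> r \<oplus>\<^bsub>A\<^esub> ?tw x \<otimes>\<^bsub>A\<^esub> \<phi> (dB r), y) - frag_of (dA x \<otimes>\<^bsub>A\<^esub> \<phi> r, y)
        - frag_of (?tw x \<otimes>\<^bsub>A\<^esub> \<phi> (dB r), y))
      + (frag_of (dA x \<otimes>\<^bsub>A\<^esub> \<phi> r, y) - frag_of (dA x, \<phi> r \<otimes>\<^bsub>A\<^esub> y))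
      + (frag_of (?tw x \<otimes>\<^bsub>A\<^esub> \<phi> (dB r), y) - frag_of (?tw x, \<phi> (dB r) \<otimes>\<^bsub>A\<^esub> y))
      + (frag_of (?tw x \<otimes>\<^bsub>A\<^esub> \<phi> ?tr, dA y) - frag_of (?tw x, \<phi> ?tr \<otimes>\<^bsub>A\<^esub> dA y))
      - (frag_of (?tw x, \<phi> (dB r) \<otimes>\<^bsub>A\<^esub> y \<oplus>\<^bsub>A\<^esub> \<phi> ?tr \<otimes>\<^bsub>A\<^esub> dA y)
        - frag_of (?tw x, \<phi> (dB r) \<otimes>\<^bsub>A\<^esub> y) - frag_of (?tw x, \<phi> ?tr \<otimes>\<^bsub>A\<^esub> dA y)) \<in> T.rels"
    by (intro T.rels_add T.rels_diff T.rels_add_left T.rels_add_right T.rels_balance)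
      simp_all
  then show ?case
    by (simp add: frag_extend_diff frag_extend_add diff_frag_def A.leibniz_twist \<phi>_d A.parity_twist_mult
      \<phi>_parity_twist[symmetric] algebra_simps)
next
  case (diff a b)
  then show ?case by (simp add: frag_extend_diff T.rels_diff)
qed

lemma tensor_diff_cls: "tensor_diff B A GA dA \<phi> (T.cls c) = T.cls (frag_extend diff_frag c)"
  unfolding tensor_diff_def diff_frag_def[symmetric]
  by (rule T.tensor_map_cls) (rule diff_frag_rels)

text \<open>The element commutes with cycles by assumption and with \<open>\<phi> z\<close> because \<open>z\<close> is a scalar; these
  generate \<open>A\<close>, since \<open>a = d (z a) + z d a\<close>.\<close>

lemma separability_element_cycles:
  assumes z: "z \<in> GB (-1)" "dB z = \<one>\<^bsub>B\<^esub>"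
    and c: "separability_element kB kA \<phi> c" "Poly_Mapping.keys c \<subseteq> {(x, y). \<exists>i j. i + j = 0 \<and> x \<in> gA i \<and> y \<in> gA j}"
  shows "separability_element B A \<phi> c"
proof -
  interpret k: tensor_square kB kA \<phi> by (rule tensor_square_cycles)
  note c' = separability_elementD[OF c(1)]
  have sub: "k.pairs \<subseteq> T.pairs" by (auto simp: A.carrier_dker)
  have keys: "Poly_Mapping.keys c \<subseteq> T.pairs" using c'(1) sub by (rule subset_trans)
  have "T.mult_eval (frag_map (\<lambda>x. x) (\<lambda>y. y) c) = (\<lambda>x. x) (k.mult_eval c)"
    by (rule frag_eval_frag_map[OF k.abelian_group_axioms A.abelian_group_axioms c'(1) inclusion_additive])
      (auto simp: A.carrier_dker A.leibniz_twist)
  then have one: "T.mult_eval c = \<one>\<^bsub>A\<^esub>"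
    using c'(2) by simp
  have cyc: "T.centralizes c u" if "u \<in> carrier kA" for u
    using rels_cycles[OF c'(3)[OF that]] that
    by (simp add: T.centralizes_def A.carrier_dker)
  have zc: "z \<in> carrier B" "\<phi> z \<in> carrier A"
    using z(1) B.comp_carrier \<phi>_in by blast+
  have z': "\<phi> z \<in> GA (-1)" "dA (\<phi> z) = \<one>\<^bsub>A\<^esub>" using \<phi>_primitive[OF z] by auto
  \<comment> \<open>The two Koszul signs in \<open>z x \<otimes> y = \<plusminus> x z \<otimes> y = \<plusminus> x \<otimes> z y = x \<otimes> y z\<close> cancel, since the degrees
    of \<open>x\<close> and \<open>y\<close> add up to zero.\<close>
  have "T.lact (\<phi> z) c - T.ract (\<phi> z) c \<in> T.rels"
    using c(2)
  proof (induction c rule: frag_supported_induct)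
    case zero
    show ?case by simp
  next
    case (one p)
    then obtain x y i where p: "p = (x, y)" "x \<in> GA i" "y \<in> GA (- i)"
      by (auto simp: dker_grading_def add_eq_0_iff)
    have xy: "x \<in> carrier A" "y \<in> carrier A" using p A.comp_carrier by blast+
    define w where "w = (if even i then z else \<ominus>\<^bsub>B\<^esub> z)"
    have w: "w \<in> carrier B" using zc by (simp add: w_def)
    have "\<phi> z \<otimes>\<^bsub>A\<^esub> x = x \<otimes>\<^bsub>A\<^esub> \<phi> w"
      using A.graded_comm[OF z'(1) p(2)] xy zc
      by (simp add: w_def sgn_mult_def \<phi>_uminus A.r_minus)
    moreover have "y \<otimes>\<^bsub>A\<^esub> \<phi> z = \<phi> w \<otimes>\<^bsub>A\<^esub> y"
      using A.graded_comm[OF p(3) z'(1)] xy zc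
      by (simp add: w_def sgn_mult_def \<phi>_uminus A.l_minus)
    ultimately show ?case
      using T.rels_balance[OF xy(1) w xy(2)] p(1) by simp
  next
    case (diff a b)
    then show ?case
      using T.rels_diff[OF diff(3,4)] by (simp add: frag_map_diff algebra_simps)
  qed
  then have cz: "T.centralizes c (\<phi> z)"
    using zc by (simp add: T.centralizes_def)
  have "T.centralizes c a" if a: "a \<in> carrier A" for a
  proof -
    have "a = dA (\<phi> z \<otimes>\<^bsub>A\<^esub> a) \<oplus>\<^bsub>A\<^esub> \<phi> z \<otimes>\<^bsub>A\<^esub> dA a"
      using A.d_mult_primitive[OF z' a] a zc by (simp add: a_minus_def A.a_assoc A.l_neg)
    moreover have "dA (\<phi> z \<otimes>\<^bsub>A\<^esub> a) \<in> carrier kA" "dA a \<in> carrier kA"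
      using a zc by (simp_all add: A.carrier_dker A.d_squared)
    ultimately show ?thesis
      using T.centralizes_add[OF keys cyc T.centralizes_mult[OF keys cz cyc]] by metis
  qed
  then show ?thesis
    using keys one by (auto simp: separability_element_def T.centralizes_def)
qed

text \<open>The splitting \<open>x \<mapsto> x e\<close> commutes with the differentials because \<open>e\<close> is composed of cycles, so
  that \<open>d (x e) = d x e\<close>.\<close>

theorem dg_separable_of_cycles:
  assumes "acyclic_dg B dB" "graded_separable kB kA gA \<phi>"
  shows "dg_separable B A GA dA \<phi>"
proof -
  interpret k: tensor_square kB kA \<phi> by (rule tensor_square_cycles)
  obtain z where z: "z \<in> GB (-1)" "dB z = \<one>\<^bsub>B\<^esub>"
    using B.acyclic_imp_primitive[OF assms(1)] .
  obtain c where c: "separability_element kB kA \<phi> c" "Poly_Mapping.keys c \<subseteq> k.degree_pairs gA 0"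
    using assms(2) unfolding k.graded_separable_iff[OF A.graded_ring_dker] by blast
  have sep: "separability_element B A \<phi> c"
    using separability_element_cycles[OF z c] .
  have "k.degree_pairs gA 0 \<subseteq> T.degree_pairs GA 0"
    by (auto simp: dker_grading_def)
  with c(2) have deg: "Poly_Mapping.keys c \<subseteq> T.degree_pairs GA 0" by (rule subset_trans)
  have "T.cls (T.lact (dA x) c) = tensor_diff B A GA dA \<phi> (T.cls (T.lact x c))"
    if x: "x \<in> carrier A" for x
  proof -
    have "T.lact (dA x) c - frag_extend diff_frag (T.lact x c) \<in> T.rels"
      using separability_elementD(1)[OF c(1)]
    proof (induction c rule: frag_supported_induct)
      case zero
      show ?case by simp
    next
      case (one p)
      then obtain u v where p: "p = (u, v)" "u \<in> carrier kA" "v \<in> carrier kA" by auto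
      \<comment> \<open>On \<open>u \<otimes> v\<close> with cycles \<open>u\<close>, \<open>v\<close>, the two differ by a tensor with second factor \<open>d v = 0\<close>.\<close>
      then have "T.lact (dA x) (frag_of p) - frag_extend diff_frag (T.lact x (frag_of p))
          = - frag_of (parity_twist A GA (x \<otimes>\<^bsub>A\<^esub> u), \<zero>\<^bsub>A\<^esub>)"
        using x by (simp add: diff_frag_def A.d_mult_cycle_right A.carrier_dker A.leibniz_twist)
      moreover have "frag_of (parity_twist A GA (x \<otimes>\<^bsub>A\<^esub> u), \<zero>\<^bsub>A\<^esub>) \<in> T.rels"
        using x p by (intro T.rels_zero_right) (simp add: A.carrier_dker)
      ultimately show ?case using T.rels_uminus by simp
    next
      case (diff a b)
      then show ?case
        using T.rels_diff[OF diff(3,4)] by (simp add: frag_map_diff frag_extend_diff algebra_simps)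
    qed
    then show ?thesis by (simp add: tensor_diff_cls T.cls_eq_iff)
  qed
  then show ?thesis
    unfolding dg_separable_def
    using T.splitting_of_separability_element[OF sep] T.cls_lact_graded[OF A.graded_ring_axioms _ deg]
    by blast
qed

text \<open>The retraction with respect to \<open>\<phi> z\<close> restricts to the one of \<open>B\<close> with respect to \<open>z\<close>, so it
  carries scalars in \<open>B\<close> to scalars in \<open>ker B\<close> and transports the separability element.\<close>

theorem cycles_separable_of_dg_separable:
  assumes two: "\<And>x. x \<in> carrier A \<Longrightarrow> x \<oplus>\<^bsub>A\<^esub> x = \<zero>\<^bsub>A\<^esub> \<Longrightarrow> x = \<zero>\<^bsub>A\<^esub>"
    and "acyclic_dg B dB" "dg_separable B A GA dA \<phi>"
  shows "graded_separable kB kA gA \<phi>"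
proof -
  interpret k: tensor_square kB kA \<phi> by (rule tensor_square_cycles)
  obtain z where z: "z \<in> GB (-1)" "dB z = \<one>\<^bsub>B\<^esub>"
    using B.acyclic_imp_primitive[OF assms(2)] .
  have z': "\<phi> z \<in> GA (-1)" "dA (\<phi> z) = \<one>\<^bsub>A\<^esub>" using \<phi>_primitive[OF z] by auto
  interpret A: dg_retraction K A GA dA "\<phi> z"
    by unfold_locales (use z' A.homogeneous_odd_square[OF two z'(1)] in simp_all)
  have "graded_separable B A GA \<phi>"
    using assms(3) by (auto simp: dg_separable_def graded_separable_def)
  then obtain c where c: "separability_element B A \<phi> c" "Poly_Mapping.keys c \<subseteq> T.degree_pairs GA 0"
    unfolding T.graded_separable_iff[OF A.graded_ring_axioms] by blast
  have "A.retract (\<phi> b) \<in> \<phi> ` carrier kB" if "b \<in> carrier B" for b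
  proof -
    have "A.retract (\<phi> b) = \<phi> (dB (z \<otimes>\<^bsub>B\<^esub> b))"
      using that z(1) B.comp_carrier by (simp add: A.retract_def \<phi>_d flip: \<phi>_mult)
    then show ?thesis
      using that B.comp_carrier[OF z(1)] by (auto simp: B.carrier_dker B.d_squared)
  qed
  then have "separability_element kB kA \<phi> (frag_map A.retract A.retract c)"
    using separability_element_image[OF T.tensor_square_axioms tensor_square_cycles
        A.retract_ring_hom A.retract_onto _ c(1)] by blast
  moreover have "Poly_Mapping.keys (frag_map A.retract A.retract c) \<subseteq> k.degree_pairs gA 0"
    by (rule keys_frag_map[OF c(2)]) (use A.retract_degree in blast)
  ultimately show ?thesis
    unfolding k.graded_separable_iff[OF A.graded_ring_dker] by blast
qed

text \<open>Here \<open>d\<close> is a \<open>B\<close>-linear derivation of \<open>A\<close>. Reducing modulo \<open>z\<close>, that is, applying \<open>retract\<close>,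
  turns \<open>d (z x) = x - z d x\<close> into the rule required by the obstruction, with \<open>g = retract\<close>, and
  \<open>retract 1 = 1\<close>.\<close>

theorem not_separable_of_trivial_differential:
  assumes two: "\<And>x. x \<in> carrier A \<Longrightarrow> x \<oplus>\<^bsub>A\<^esub> x = \<zero>\<^bsub>A\<^esub> \<Longrightarrow> x = \<zero>\<^bsub>A\<^esub>"
    and dB: "\<And>b. b \<in> carrier B \<Longrightarrow> dB b = \<zero>\<^bsub>B\<^esub>" and "acyclic_dg A dA"
  shows "\<not> separable_ring_hom B A \<phi>"
proof
  assume "separable_ring_hom B A \<phi>"
  then obtain c where c: "separability_element B A \<phi> c"
    unfolding T.separable_iff by blast
  obtain z where z: "z \<in> GA (-1)" "dA z = \<one>\<^bsub>A\<^esub>"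
    using A.acyclic_imp_primitive[OF assms(3)] .
  interpret A: dg_retraction K A GA dA z
    by unfold_locales (use z A.homogeneous_odd_square[OF two z(1)] in simp_all)
  let ?F = "\<lambda>x y. A.retract (dA x \<otimes>\<^bsub>A\<^esub> y)"
  have cl: "A.retract x \<in> carrier A" if "x \<in> carrier A" for x
    using A.retract_closed[OF that] by (simp add: A.carrier_dker)
  note add = additive_add[OF A.retract_additive]
  have "balanced B A \<phi> A ?F"
  proof (rule balancedI)
    fix x r y assume "x \<in> carrier A" "r \<in> carrier B" "y \<in> carrier A"
    then show "?F (x \<otimes>\<^bsub>A\<^esub> \<phi> r) y = ?F x (\<phi> r \<otimes>\<^bsub>A\<^esub> y)"
      by (simp add: A.leibniz_twist \<phi>_in \<phi>_d dB \<phi>_zero A.m_assoc)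
  qed (simp_all add: cl A.d_add A.l_distr A.r_distr add)
  moreover have "?F (z \<otimes>\<^bsub>A\<^esub> x) y = ?F x (y \<otimes>\<^bsub>A\<^esub> z) \<oplus>\<^bsub>A\<^esub> A.retract (x \<otimes>\<^bsub>A\<^esub> y)"
    if "x \<in> carrier A" "y \<in> carrier A" for x y
  proof -
    have "dA (z \<otimes>\<^bsub>A\<^esub> x) \<otimes>\<^bsub>A\<^esub> y = x \<otimes>\<^bsub>A\<^esub> y \<ominus>\<^bsub>A\<^esub> z \<otimes>\<^bsub>A\<^esub> (dA x \<otimes>\<^bsub>A\<^esub> y)"
      using that by (simp add: A.d_mult_primitive[OF z] a_minus_def A.l_distr A.l_minus A.m_assoc)
    then have "?F (z \<otimes>\<^bsub>A\<^esub> x) y = A.retract (x \<otimes>\<^bsub>A\<^esub> y)"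
      using that cl
        additive_minus[OF A.abelian_group_axioms A.abelian_group_axioms A.retract_additive,
          of "x \<otimes>\<^bsub>A\<^esub> y" "z \<otimes>\<^bsub>A\<^esub> (dA x \<otimes>\<^bsub>A\<^esub> y)"]
      by (simp add: A.retract_z_mult a_minus_def)
    moreover have "?F x (y \<otimes>\<^bsub>A\<^esub> z) = \<zero>\<^bsub>A\<^esub>"
      using that A.retract_mult_z[of "dA x \<otimes>\<^bsub>A\<^esub> y"] by (simp add: A.m_assoc)
    ultimately show ?thesis using that cl by simp
  qed
  ultimately have "A.retract \<one>\<^bsub>A\<^esub> = \<zero>\<^bsub>A\<^esub>"
    using separability_obstruction[OF T.tensor_square_axioms c A.abelian_group_axioms _
        A.retract_additive A.z_closed] by blast
  then show False
    using A.retract_one A.one_nonzero by simp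
qed

end


section \<open>Laurent polynomial rings\<close>

locale laurent = cring D for D :: "('d, 'm) ring_scheme" (structure)
begin

abbreviation L where "L \<equiv> laurent_ring D"

definition lmonom :: "'d \<Rightarrow> int \<Rightarrow> int \<Rightarrow> 'd"
  where "lmonom c k = (\<lambda>i. if i = k then c else \<zero>)"

lemma carrier_L: "f \<in> carrier L \<longleftrightarrow> (\<forall>i. f i \<in> carrier D) \<and> finite {i. f i \<noteq> \<zero>}"
  and add_L: "f \<oplus>\<^bsub>L\<^esub> g = (\<lambda>i. f i \<oplus> g i)"
  and zero_L: "\<zero>\<^bsub>L\<^esub> = (\<lambda>i. \<zero>)"
  and one_L: "\<one>\<^bsub>L\<^esub> = lmonom \<one> 0"
  and mult_L: "f \<otimes>\<^bsub>L\<^esub> g = (\<lambda>n. \<Oplus>i\<in>{i. f i \<noteq> \<zero>}. f i \<otimes> g (n - i))"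
  by (simp_all add: laurent_ring_def lmonom_def)

lemma coeff_closed [simp]: "f \<in> carrier L \<Longrightarrow> f i \<in> carrier D"
  by (simp add: carrier_L)

lemma coeff_support: "f \<in> carrier L \<Longrightarrow> finite {i. f i \<noteq> \<zero>}"
  by (simp add: carrier_L)

lemma lmonom_closed [simp]: "c \<in> carrier D \<Longrightarrow> lmonom c k \<in> carrier L"
  unfolding carrier_L lmonom_def by (auto intro: finite_subset[of _ "{k}"])

lemma lmonom_add: "lmonom c k \<oplus>\<^bsub>L\<^esub> lmonom e k = lmonom (c \<oplus> e) k" if "c \<in> carrier D" "e \<in> carrier D"
  by (auto simp: add_L lmonom_def)

lemma L_closedI:
  assumes "\<And>i. f i \<in> carrier D" "finite I" "\<And>i. i \<notin> I \<Longrightarrow> f i = \<zero>"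
  shows "f \<in> carrier L"
  unfolding carrier_L using assms by (auto intro: finite_subset[of _ I])

lemma L_add_closed: "f \<in> carrier L \<Longrightarrow> g \<in> carrier L \<Longrightarrow> f \<oplus>\<^bsub>L\<^esub> g \<in> carrier L"
  unfolding add_L
  by (rule L_closedI[of _ "{i. f i \<noteq> \<zero>} \<union> {i. g i \<noteq> \<zero>}"]) (auto simp: coeff_support)

lemma abelian_group_L: "abelian_group L"
proof (rule abelian_groupI)
  fix f assume f: "f \<in> carrier L"
  then have "(\<lambda>i. \<ominus> f i) \<in> carrier L"
    by (intro L_closedI[of _ "{i. f i \<noteq> \<zero>}"]) (auto simp: coeff_support)
  moreover have "(\<lambda>i. \<ominus> f i) \<oplus>\<^bsub>L\<^esub> f = \<zero>\<^bsub>L\<^esub>"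
    using f by (simp add: add_L zero_L l_neg)
  ultimately show "\<exists>g\<in>carrier L. g \<oplus>\<^bsub>L\<^esub> f = \<zero>\<^bsub>L\<^esub>" by blast
next
  show "\<zero>\<^bsub>L\<^esub> \<in> carrier L" by (simp add: zero_L carrier_L)
next
  fix f g assume "f \<in> carrier L" "g \<in> carrier L"
  then show "f \<oplus>\<^bsub>L\<^esub> g \<in> carrier L" by (rule L_add_closed)
qed (simp_all add: add_L zero_L a_assoc, simp add: a_comm)

text \<open>Every identity between additive maps on Laurent polynomials is thereby reduced to monomials;
  associativity of the convolution product is an example.\<close>

lemma L_induct [consumes 1, case_names lmonom add]:
  assumes "f \<in> carrier L" and mono: "\<And>c k. c \<in> carrier D \<Longrightarrow> Q (lmonom c k)"
    and add: "\<And>f g. f \<in> carrier L \<Longrightarrow> g \<in> carrier L \<Longrightarrow> Q f \<Longrightarrow> Q g \<Longrightarrow> Q (f \<oplus>\<^bsub>L\<^esub> g)"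
  shows "Q f"
proof -
  have "\<forall>f \<in> carrier L. {i. f i \<noteq> \<zero>} \<subseteq> I \<longrightarrow> Q f" if "finite I" for I
    using that
  proof (induction I)
    case empty
    have "f = lmonom \<zero> 0" if "{i. f i \<noteq> \<zero>} \<subseteq> {}" for f
      using that by (auto simp: lmonom_def)
    then show ?case using mono[OF zero_closed, of 0] by metis
  next
    case (insert j I)
    show ?case
    proof (intro ballI impI)
      fix f assume f: "f \<in> carrier L" "{i. f i \<noteq> \<zero>} \<subseteq> insert j I"
      let ?g = "f(j := \<zero>)"
      have sub: "{i. ?g i \<noteq> \<zero>} \<subseteq> I" using f(2) by auto
      moreover have g: "?g \<in> carrier L"
      proof (rule L_closedI[OF _ insert(1)])
        show "?g i \<in> carrier D" for i using f(1) by simp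
        show "?g i = \<zero>" if "i \<notin> I" for i using sub that by blast
      qed
      ultimately have "Q ?g" using insert.IH by blast
      moreover have "f = lmonom (f j) j \<oplus>\<^bsub>L\<^esub> ?g"
        using f(1) by (auto simp: add_L lmonom_def)
      ultimately show "Q f"
        using add[OF lmonom_closed g mono] f(1) by (metis coeff_closed)
    qed
  qed
  then show ?thesis using assms(1) coeff_support[OF assms(1)] by blast
qed

lemma mult_L_superset:
  assumes "f \<in> carrier L" "g \<in> carrier L" "finite I" "{i. f i \<noteq> \<zero>} \<subseteq> I"
  shows "(f \<otimes>\<^bsub>L\<^esub> g) n = (\<Oplus>i\<in>I. f i \<otimes> g (n - i))"
  unfolding mult_L
  by (rule add.finprod_mono_neutral_cong_left) (use assms in auto)

lemma L_mult_closed: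
  assumes f: "f \<in> carrier L" and g: "g \<in> carrier L"
  shows "f \<otimes>\<^bsub>L\<^esub> g \<in> carrier L"
proof (rule L_closedI)
  let ?I = "(\<lambda>(i, j). i + j) ` ({i. f i \<noteq> \<zero>} \<times> {i. g i \<noteq> \<zero>})"
  show "finite ?I" using f g coeff_support by simp
  show "(f \<otimes>\<^bsub>L\<^esub> g) n \<in> carrier D" for n
    using f g by (auto simp: mult_L intro!: finsum_closed)
  show "(f \<otimes>\<^bsub>L\<^esub> g) n = \<zero>" if "n \<notin> ?I" for n
    unfolding mult_L
  proof (rule add.finprod_one_eqI)
    fix i assume i: "i \<in> {i. f i \<noteq> \<zero>}"
    have "g (n - i) = \<zero>"
    proof (rule ccontr)
      assume "g (n - i) \<noteq> \<zero>"
      with i have "n \<in> ?I" by (intro image_eqI[of _ _ "(i, n - i)"]) simp_all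
      with that show False by contradiction
    qed
    then show "f i \<otimes> g (n - i) = \<zero>" using f by simp
  qed
qed

lemma L_l_distr:
  assumes f: "f \<in> carrier L" and g: "g \<in> carrier L" and h: "h \<in> carrier L"
  shows "(f \<oplus>\<^bsub>L\<^esub> g) \<otimes>\<^bsub>L\<^esub> h = f \<otimes>\<^bsub>L\<^esub> h \<oplus>\<^bsub>L\<^esub> g \<otimes>\<^bsub>L\<^esub> h"
proof
  fix n
  let ?I = "{i. f i \<noteq> \<zero>} \<union> {i. g i \<noteq> \<zero>}"
  have I: "finite ?I" "{i. f i \<noteq> \<zero>} \<subseteq> ?I" "{i. g i \<noteq> \<zero>} \<subseteq> ?I" "{i. (f \<oplus>\<^bsub>L\<^esub> g) i \<noteq> \<zero>} \<subseteq> ?I"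
    using f g coeff_support by (auto simp: add_L)
  have "((f \<oplus>\<^bsub>L\<^esub> g) \<otimes>\<^bsub>L\<^esub> h) n = (\<Oplus>i\<in>?I. f i \<otimes> h (n - i) \<oplus> g i \<otimes> h (n - i))"
    unfolding mult_L_superset[OF L_add_closed[OF f g] h I(1,4)]
    by (rule add.finprod_cong') (use f g h in \<open>auto simp: add_L l_distr\<close>)
  also have "\<dots> = (\<Oplus>i\<in>?I. f i \<otimes> h (n - i)) \<oplus> (\<Oplus>i\<in>?I. g i \<otimes> h (n - i))"
    by (rule finsum_addf) (use f g h in auto)
  finally show "((f \<oplus>\<^bsub>L\<^esub> g) \<otimes>\<^bsub>L\<^esub> h) n = (f \<otimes>\<^bsub>L\<^esub> h \<oplus>\<^bsub>L\<^esub> g \<otimes>\<^bsub>L\<^esub> h) n"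
    using mult_L_superset[OF f h I(1,2)] mult_L_superset[OF g h I(1,3)] by (simp add: add_L)
qed

lemma L_r_distr:
  assumes f: "f \<in> carrier L" and g: "g \<in> carrier L" and h: "h \<in> carrier L"
  shows "f \<otimes>\<^bsub>L\<^esub> (g \<oplus>\<^bsub>L\<^esub> h) = f \<otimes>\<^bsub>L\<^esub> g \<oplus>\<^bsub>L\<^esub> f \<otimes>\<^bsub>L\<^esub> h"
proof
  fix n
  let ?I = "{i. f i \<noteq> \<zero>}"
  have "(\<Oplus>i\<in>?I. f i \<otimes> (g (n - i) \<oplus> h (n - i))) = (\<Oplus>i\<in>?I. f i \<otimes> g (n - i) \<oplus> f i \<otimes> h (n - i))"
    by (rule add.finprod_cong') (use f g h in \<open>auto simp: r_distr\<close>)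
  also have "\<dots> = (\<Oplus>i\<in>?I. f i \<otimes> g (n - i)) \<oplus> (\<Oplus>i\<in>?I. f i \<otimes> h (n - i))"
    by (rule finsum_addf) (use f g h in auto)
  finally show "(f \<otimes>\<^bsub>L\<^esub> (g \<oplus>\<^bsub>L\<^esub> h)) n = (f \<otimes>\<^bsub>L\<^esub> g \<oplus>\<^bsub>L\<^esub> f \<otimes>\<^bsub>L\<^esub> h) n"
    by (simp add: add_L mult_L)
qed

lemma lmonom_mult:
  assumes "c \<in> carrier D" "e \<in> carrier D"
  shows "lmonom c i \<otimes>\<^bsub>L\<^esub> lmonom e j = lmonom (c \<otimes> e) (i + j)"
proof
  fix n
  have "(lmonom c i \<otimes>\<^bsub>L\<^esub> lmonom e j) n = (\<Oplus>k\<in>{i}. lmonom c i k \<otimes> lmonom e j (n - k))"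
    by (rule mult_L_superset[OF lmonom_closed[OF assms(1)] lmonom_closed[OF assms(2)]])
      (auto simp: lmonom_def)
  also have "\<dots> = lmonom (c \<otimes> e) (i + j) n"
    using assms by (auto simp: lmonom_def)
  finally show "(lmonom c i \<otimes>\<^bsub>L\<^esub> lmonom e j) n = lmonom (c \<otimes> e) (i + j) n" .
qed

lemma L_comm:
  assumes "f \<in> carrier L" "g \<in> carrier L" shows "f \<otimes>\<^bsub>L\<^esub> g = g \<otimes>\<^bsub>L\<^esub> f"
  using assms
proof (induction f rule: L_induct)
  case (lmonom c k)
  from lmonom(2) show ?case
  proof (induction g rule: L_induct)
    case (lmonom e l)
    then show ?case using \<open>c \<in> carrier D\<close> by (simp add: lmonom_mult m_comm add.commute)
  next
    case (add g h)
    then show ?case using \<open>c \<in> carrier D\<close> by (simp add: L_l_distr L_r_distr)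
  qed
next
  case (add f g)
  then show ?case by (simp add: L_l_distr L_r_distr)
qed

lemma L_assoc:
  assumes "f \<in> carrier L" "g \<in> carrier L" "h \<in> carrier L"
  shows "(f \<otimes>\<^bsub>L\<^esub> g) \<otimes>\<^bsub>L\<^esub> h = f \<otimes>\<^bsub>L\<^esub> (g \<otimes>\<^bsub>L\<^esub> h)"
  using assms
proof (induction f rule: L_induct)
  case (lmonom c k)
  note c = \<open>c \<in> carrier D\<close>
  from lmonom(2,3) show ?case
  proof (induction g rule: L_induct)
    case (lmonom e l)
    note e = \<open>e \<in> carrier D\<close>
    from lmonom(2) show ?case
    proof (induction h rule: L_induct)
      case (lmonom a m)
      then show ?case using c e by (simp add: lmonom_mult m_assoc add.assoc)
    next
      case (add g h)
      then show ?case using c e by (simp add: L_r_distr L_mult_closed)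
    qed
  next
    case (add g h)
    then show ?case using c by (simp add: L_l_distr L_r_distr L_mult_closed)
  qed
next
  case (add f g)
  then show ?case by (simp add: L_l_distr L_mult_closed)
qed

lemma L_l_one:
  assumes "f \<in> carrier L" shows "\<one>\<^bsub>L\<^esub> \<otimes>\<^bsub>L\<^esub> f = f"
  using assms
proof (induction f rule: L_induct)
  case (lmonom c k)
  then show ?case by (simp add: one_L lmonom_mult)
next
  case (add f g)
  have "\<one>\<^bsub>L\<^esub> \<in> carrier L" by (simp add: one_L)
  then show ?case using add by (simp add: L_r_distr)
qed

lemma cring_L: "cring L"
proof (rule cringI)
  show "abelian_group L" by (rule abelian_group_L)
  show "Group.comm_monoid L"
  proof (rule comm_monoidI)
    show "\<one>\<^bsub>L\<^esub> \<in> carrier L" by (simp add: one_L)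
    show "f \<otimes>\<^bsub>L\<^esub> g = g \<otimes>\<^bsub>L\<^esub> f" if "f \<in> carrier L" "g \<in> carrier L" for f g
      using that by (rule L_comm)
  qed (simp_all add: L_mult_closed L_assoc L_l_one)
qed (simp add: L_l_distr)

sublocale L: cring L by (rule cring_L)

lemma finsum_L:
  assumes "finite I" "\<And>i. i \<in> I \<Longrightarrow> F i \<in> carrier L"
  shows "(\<Oplus>\<^bsub>L\<^esub>i\<in>I. F i) k = (\<Oplus>i\<in>I. F i k)"
  using assms
proof (induction I)
  case empty
  then show ?case by (simp add: zero_L)
next
  case (insert i I)
  then have "(\<Oplus>\<^bsub>L\<^esub>j\<in>insert i I. F j) = F i \<oplus>\<^bsub>L\<^esub> (\<Oplus>\<^bsub>L\<^esub>j\<in>I. F j)"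
    by (intro L.finsum_insert) auto
  moreover have "(\<Oplus>j\<in>insert i I. F j k) = F i k \<oplus> (\<Oplus>j\<in>I. F j k)"
    using insert by (intro finsum_insert) auto
  ultimately show ?case using insert by (simp add: add_L)
qed

lemma lmonom_degree: "c \<in> carrier D \<Longrightarrow> lmonom c k \<in> laurent_grading D t (k * t)"
  by (auto simp: laurent_grading_def lmonom_def[of c k] intro: lmonom_closed[unfolded lmonom_def])

lemma uminus_L: "f \<in> carrier L \<Longrightarrow> \<ominus>\<^bsub>L\<^esub> f = (\<lambda>i. \<ominus> f i)"
proof (rule L.minus_equality)
  assume f: "f \<in> carrier L"
  then show "(\<lambda>i. \<ominus> f i) \<in> carrier L"
    by (intro L_closedI[of _ "{i. f i \<noteq> \<zero>}"]) (auto simp: coeff_support)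
  show "(\<lambda>i. \<ominus> f i) \<oplus>\<^bsub>L\<^esub> f = \<zero>\<^bsub>L\<^esub>"
    using f by (simp add: add_L zero_L l_neg)
qed

lemma graded_ring_L:
  assumes "t \<noteq> 0" shows "graded_ring L (laurent_grading D t)"
proof (intro graded_ring.intro graded_ring_axioms.intro L.ring_axioms)
  let ?G = "laurent_grading D t"
  fix n
  show "additive_subgroup (?G n) L"
  proof (intro additive_subgroup.intro subgroup.intro)
    fix f assume f: "f \<in> ?G n"
    then have "inv\<^bsub>add_monoid L\<^esub> f = (\<lambda>i. \<ominus> f i)"
      using uminus_L[of f] by (simp add: a_inv_def laurent_grading_def)
    moreover have "(\<lambda>i. \<ominus> f i) \<in> carrier L"
      using f uminus_L[of f] L.a_inv_closed[of f] by (simp add: laurent_grading_def)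
    ultimately show "inv\<^bsub>add_monoid L\<^esub> f \<in> ?G n"
      using f by (auto simp: laurent_grading_def)
  next
    fix f g assume fg: "f \<in> ?G n" "g \<in> ?G n"
    then have c: "f \<in> carrier L" "g \<in> carrier L" by (simp_all add: laurent_grading_def)
    have "f i = \<zero>" "g i = \<zero>" if "i * t \<noteq> n" for i
      using fg that unfolding laurent_grading_def by blast+
    then have "f i \<oplus> g i = \<zero>" if "i * t \<noteq> n" for i
      using that by simp
    then show "f \<otimes>\<^bsub>add_monoid L\<^esub> g \<in> ?G n"
      using L.a_closed[OF c] unfolding laurent_grading_def add_L by auto
  qed (auto simp: laurent_grading_def zero_L, simp add: carrier_L)
next
  let ?G = "laurent_grading D t"
  fix f i g j assume fg: "f \<in> ?G i" "g \<in> ?G j"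
  then have c: "f \<in> carrier L" "g \<in> carrier L" by (auto simp: laurent_grading_def)
  have "n * t = i + j" if n: "(f \<otimes>\<^bsub>L\<^esub> g) n \<noteq> \<zero>" for n
  proof (rule ccontr)
    assume neq: "n * t \<noteq> i + j"
    have "f k \<otimes> g (n - k) = \<zero>" if "f k \<noteq> \<zero>" for k
    proof -
      have "k * t = i" using that fg(1) by (simp add: laurent_grading_def)
      then have "(n - k) * t \<noteq> j" using neq by (simp add: algebra_simps)
      then have "g (n - k) = \<zero>" using fg(2) by (auto simp: laurent_grading_def)
      then show ?thesis using c by simp
    qed
    then have "(f \<otimes>\<^bsub>L\<^esub> g) n = \<zero>"
      unfolding mult_L by (intro add.finprod_one_eqI) auto
    then show False using n by simp
  qed
  then show "f \<otimes>\<^bsub>L\<^esub> g \<in> ?G (i + j)"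
    using c by (simp add: laurent_grading_def)
next
  show "\<one>\<^bsub>L\<^esub> \<in> laurent_grading D t 0"
    using lmonom_degree[OF one_closed, of 0 t] by (simp add: one_L)
next
  let ?G = "laurent_grading D t"
  fix f assume f: "f \<in> carrier L"
  define F where "F = (\<lambda>n i. if i * t = n then f i else \<zero>)"
  have FG: "F n \<in> ?G n" for n
  proof -
    have "F n \<in> carrier L"
      using f by (intro L_closedI[of _ "{i. f i \<noteq> \<zero>}"]) (auto simp: F_def coeff_support)
    then show ?thesis by (auto simp: laurent_grading_def F_def)
  qed
  \<comment> \<open>Among the homogeneous parts only the one of degree \<open>k * t\<close> has a coefficient at \<open>T^k\<close>. This
    determines the parts, and it shows that they add up to \<open>f\<close>.\<close>
  have val: "(\<Oplus>\<^bsub>L\<^esub>n\<in>I. g n) k = g (k * t) k"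
    if g: "\<And>n. g n \<in> ?G n" and I: "finite I" "{n. g n \<noteq> \<zero>\<^bsub>L\<^esub>} \<subseteq> I" for g k I
  proof -
    have gc: "g n k \<in> carrier D" for n k using g[of n] by (simp add: laurent_grading_def)
    have "(\<Oplus>\<^bsub>L\<^esub>n\<in>I. g n) k = (\<Oplus>n\<in>I. g n k)"
      using I(1) g by (intro finsum_L) (auto simp: laurent_grading_def)
    also have "\<dots> = (\<Oplus>n\<in>insert (k * t) I. g n k)"
    proof (rule add.finprod_mono_neutral_cong_left)
      fix i assume "i \<in> insert (k * t) I - I"
      then have "g i = \<zero>\<^bsub>L\<^esub>" using I(2) by blast
      then show "g i k = \<zero>" by (simp add: zero_L)
    qed (use I gc in auto)
    also have "\<dots> = (\<Oplus>n\<in>insert (k * t) I. if k * t = n then g n k else \<zero>)"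
      using g gc by (intro add.finprod_cong') (auto simp: laurent_grading_def)
    also have "\<dots> = g (k * t) k"
      using I(1) gc by (intro add.finprod_singleton) auto
    finally show ?thesis .
  qed
  have "{n. F n \<noteq> \<zero>\<^bsub>L\<^esub>} \<subseteq> (\<lambda>i. i * t) ` {i. f i \<noteq> \<zero>}"
  proof
    fix m assume "m \<in> {n. F n \<noteq> \<zero>\<^bsub>L\<^esub>}"
    then obtain i where "F m i \<noteq> \<zero>" by (auto simp: zero_L)
    then show "m \<in> (\<lambda>i. i * t) ` {i. f i \<noteq> \<zero>}"
      by (auto simp: F_def split: if_splits)
  qed
  then have fin: "finite {n. F n \<noteq> \<zero>\<^bsub>L\<^esub>}"
    using coeff_support[OF f] finite_subset by blast
  show "\<exists>!F. homogeneous_decomposition L ?G f F"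
  proof (rule ex1I[of _ F])
    have "f = (\<Oplus>\<^bsub>L\<^esub>n\<in>{n. F n \<noteq> \<zero>\<^bsub>L\<^esub>}. F n)"
      using val[OF FG fin subset_refl] by (auto simp: F_def)
    then show "homogeneous_decomposition L ?G f F"
      using FG fin by (simp add: homogeneous_decomposition_def)
  next
    fix g assume "homogeneous_decomposition L ?G f g"
    then have g: "\<And>n. g n \<in> ?G n" "finite {n. g n \<noteq> \<zero>\<^bsub>L\<^esub>}" "f = (\<Oplus>\<^bsub>L\<^esub>n\<in>{n. g n \<noteq> \<zero>\<^bsub>L\<^esub>}. g n)"
      by (auto simp: homogeneous_decomposition_def)
    have "f k = g (k * t) k" for k
      using val[OF g(1,2) subset_refl] g(3) by metis
    then show "g = F"
      using g(1) by (fastforce simp: F_def laurent_grading_def)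
  qed
qed

text \<open>The derivation \<open>T d/dT\<close>.\<close>

definition euler :: "(int \<Rightarrow> 'd) \<Rightarrow> int \<Rightarrow> 'd"
  where "euler f = (\<lambda>i. add_pow D i (f i))"

lemma euler_closed: "f \<in> carrier L \<Longrightarrow> euler f \<in> carrier L"
  by (rule L_closedI[of _ "{i. f i \<noteq> \<zero>}"])
    (auto simp: euler_def coeff_support)

lemma euler_add:
  assumes "f \<in> carrier L" "g \<in> carrier L"
  shows "euler (f \<oplus>\<^bsub>L\<^esub> g) = euler f \<oplus>\<^bsub>L\<^esub> euler g"
  using assms comm_group.int_pow_distrib[OF a_comm_group, simplified]
  by (auto simp: euler_def add_L add_pow_def)

lemma euler_lmonom: "c \<in> carrier D \<Longrightarrow> euler (lmonom c k) = lmonom (add_pow D k c) k"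
  by (auto simp: euler_def lmonom_def)

lemma euler_mult:
  assumes "f \<in> carrier L" "g \<in> carrier L"
  shows "euler (f \<otimes>\<^bsub>L\<^esub> g) = euler f \<otimes>\<^bsub>L\<^esub> g \<oplus>\<^bsub>L\<^esub> f \<otimes>\<^bsub>L\<^esub> euler g"
  using assms
proof (induction f rule: L_induct)
  case (lmonom c k)
  note c = \<open>c \<in> carrier D\<close>
  from lmonom(2) show ?case
  proof (induction g rule: L_induct)
    case (lmonom e l)
    then show ?case
      using c by (simp add: lmonom_mult euler_lmonom lmonom_add int_multiple_add
        add_pow_ldistr_int add_pow_rdistr_int)
  next
    case (add g h)
    then show ?case
      using c by (simp add: L.r_distr euler_add euler_closed L.a_ac)
  qed
next
  case (add f g)
  then show ?case by (simp add: L.l_distr euler_add euler_closed L.a_ac)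
qed

text \<open>If \<open>T d/dT\<close> vanishes on the scalars, it contradicts separability because its value at \<open>T\<close> is \<open>T\<close>.
  The ring \<open>S\<close> is only assumed to map to the Laurent polynomials, so that graded rings isomorphic
  to them are covered as well.\<close>

lemma not_separable_of_euler:
  assumes "tensor_square R S \<psi>" and h: "h \<in> ring_hom S L" and "\<one> \<noteq> \<zero>"
    and T: "lmonom \<one> 1 \<in> h ` carrier S"
    and scalars: "\<And>r. r \<in> carrier R \<Longrightarrow> euler (h (\<psi> r)) = \<zero>\<^bsub>L\<^esub>"
  shows "\<not> separable_ring_hom R S \<psi>"
proof
  interpret S: tensor_square R S \<psi> by fact
  let ?T = "lmonom \<one> 1"
  assume "separable_ring_hom R S \<psi>"
  then obtain c where c: "separability_element R S \<psi> c"
    unfolding S.separable_iff by blast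
  obtain s where s: "s \<in> carrier S" "h s = ?T" using T by auto
  have cl [simp]: "h x \<in> carrier L" if "x \<in> carrier S" for x
    using h that by (rule ring_hom_closed)
  have T1: "?T \<in> carrier L" by simp
  have eT: "euler ?T = ?T"
    by (simp add: euler_lmonom)
  note hs = ring_hom_mult[OF h] ring_hom_add[OF h]
  let ?F = "\<lambda>x y. euler (h x) \<otimes>\<^bsub>L\<^esub> h y"
  have "balanced R S \<psi> L ?F"
  proof (rule balancedI)
    fix x r y assume *: "x \<in> carrier S" "r \<in> carrier R" "y \<in> carrier S"
    then show "?F (x \<otimes>\<^bsub>S\<^esub> \<psi> r) y = ?F x (\<psi> r \<otimes>\<^bsub>S\<^esub> y)"
      using S.\<phi>_closed[OF *(2)] by (simp add: hs euler_mult scalars euler_closed L.m_assoc)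
  qed (simp_all add: hs euler_add euler_closed L.l_distr L.r_distr)
  moreover have "(\<lambda>x. ?T \<otimes>\<^bsub>L\<^esub> h x) \<in> hom (add_monoid S) (add_monoid L)"
    by (rule additiveI) (simp_all add: hs L.r_distr)
  moreover have "?F (s \<otimes>\<^bsub>S\<^esub> x) y = ?F x (y \<otimes>\<^bsub>S\<^esub> s) \<oplus>\<^bsub>L\<^esub> ?T \<otimes>\<^bsub>L\<^esub> h (x \<otimes>\<^bsub>S\<^esub> y)"
    if "x \<in> carrier S" "y \<in> carrier S" for x y
    using that s
    by (simp add: hs euler_mult eT euler_closed L.l_distr L.r_distr L.m_ac L.a_ac)
  ultimately have "?T \<otimes>\<^bsub>L\<^esub> h \<one>\<^bsub>S\<^esub> = \<zero>\<^bsub>L\<^esub>"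
    using separability_obstruction[OF assms(1) c L.abelian_group_axioms _ _ s(1)] by blast
  then have "?T = \<zero>\<^bsub>L\<^esub>"
    by (simp add: ring_hom_one[OF h])
  then show False
    using assms(3) by (auto simp: lmonom_def zero_L dest: fun_cong[of _ _ 1])
qed

end


section \<open>Separability of Laurent extensions\<close>

context laurent
begin

text \<open>Evaluation at \<open>T = 1\<close>, which maps \<open>T^n\<close> to a scalar.\<close>

definition augmentation :: "(int \<Rightarrow> 'd) \<Rightarrow> 'd"
  where "augmentation f = (\<Oplus>i\<in>{i. f i \<noteq> \<zero>}. f i)"

lemma augmentation_superset:
  assumes "f \<in> carrier L" "finite I" "{i. f i \<noteq> \<zero>} \<subseteq> I"
  shows "augmentation f = (\<Oplus>i\<in>I. f i)"
  unfolding augmentation_def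
  by (rule add.finprod_mono_neutral_cong_left) (use assms in auto)

lemma augmentation_closed: "f \<in> carrier L \<Longrightarrow> augmentation f \<in> carrier D"
  unfolding augmentation_def by (rule finsum_closed) auto

lemma augmentation_add:
  assumes f: "f \<in> carrier L" and g: "g \<in> carrier L"
  shows "augmentation (f \<oplus>\<^bsub>L\<^esub> g) = augmentation f \<oplus> augmentation g"
proof -
  let ?I = "{i. f i \<noteq> \<zero>} \<union> {i. g i \<noteq> \<zero>}"
  have I: "finite ?I" "{i. f i \<noteq> \<zero>} \<subseteq> ?I" "{i. g i \<noteq> \<zero>} \<subseteq> ?I" "{i. (f \<oplus>\<^bsub>L\<^esub> g) i \<noteq> \<zero>} \<subseteq> ?I"
    using f g coeff_support by (auto simp: add_L)
  have "(\<Oplus>i\<in>?I. f i \<oplus> g i) = (\<Oplus>i\<in>?I. f i) \<oplus> (\<Oplus>i\<in>?I. g i)"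
    by (rule finsum_addf) (use f g in auto)
  then show ?thesis
    using augmentation_superset[OF L.a_closed[OF f g] I(1,4)]
      augmentation_superset[OF f I(1,2)] augmentation_superset[OF g I(1,3)]
    by (simp add: add_L)
qed

lemma augmentation_lmonom: "c \<in> carrier D \<Longrightarrow> augmentation (lmonom c k) = c"
proof -
  assume c: "c \<in> carrier D"
  have "{i. lmonom c k i \<noteq> \<zero>} \<subseteq> {k}" by (auto simp: lmonom_def)
  then have "augmentation (lmonom c k) = (\<Oplus>i\<in>{k}. lmonom c k i)"
    using c by (intro augmentation_superset) simp_all
  then show ?thesis using c by (simp add: lmonom_def)
qed

lemma augmentation_mult:
  assumes "f \<in> carrier L" "g \<in> carrier L"
  shows "augmentation (f \<otimes>\<^bsub>L\<^esub> g) = augmentation f \<otimes> augmentation g"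
  using assms
proof (induction f rule: L_induct)
  case (lmonom c k)
  note c = \<open>c \<in> carrier D\<close>
  from lmonom(2) show ?case
  proof (induction g rule: L_induct)
    case (lmonom e l)
    then show ?case using c by (simp add: lmonom_mult augmentation_lmonom)
  next
    case (add g h)
    then show ?case
      using c by (simp add: L.r_distr augmentation_add augmentation_closed augmentation_lmonom r_distr)
  qed
next
  case (add f g)
  then show ?case
    by (simp add: L.l_distr augmentation_add augmentation_closed l_distr)
qed

lemma augmentation_ring_hom: "augmentation \<in> ring_hom L D"
  by (rule ring_hom_memI)
    (simp_all add: augmentation_closed augmentation_mult augmentation_add one_L augmentation_lmonom)

end

locale laurent_extension = D1: cring D1 + laurent D2
  for D1 :: "('e, 'q) ring_scheme" and D2 :: "('f, 'r) ring_scheme" (structure) +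
  fixes \<iota> :: "'e \<Rightarrow> 'f" and n :: nat
  assumes \<iota>_hom: "\<iota> \<in> ring_hom D1 D2" and n_pos: "n \<ge> 1"
begin

abbreviation R where "R \<equiv> laurent_subring D1 n"
abbreviation \<phi> where "\<phi> \<equiv> laurent_map \<iota>"

lemma \<iota>_closed: "r \<in> carrier D1 \<Longrightarrow> \<iota> r \<in> carrier D2"
  using \<iota>_hom by (rule ring_hom_closed)

lemma \<iota>_zero: "\<iota> \<zero>\<^bsub>D1\<^esub> = \<zero>"
  using ring_hom_zero[OF \<iota>_hom D1.ring_axioms ring_axioms] .

lemma carrier_R: "r \<in> carrier R \<longleftrightarrow>
    (\<forall>i. r i \<in> carrier D1) \<and> finite {i. r i \<noteq> \<zero>\<^bsub>D1\<^esub>} \<and> (\<forall>i. r i \<noteq> \<zero>\<^bsub>D1\<^esub> \<longrightarrow> int n dvd i)"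
  by (auto simp: laurent_subring_def laurent_ring_def)

lemma laurent_map_apply: "\<phi> r i = \<iota> (r i)"
  by (simp add: laurent_map_def)

lemma \<phi>_in_L: "r \<in> carrier R \<Longrightarrow> \<phi> r \<in> carrier L"
  by (rule L_closedI[of _ "{i. r i \<noteq> \<zero>\<^bsub>D1\<^esub>}"]) (auto simp: laurent_map_apply carrier_R \<iota>_closed \<iota>_zero)

sublocale T: tensor_square R L \<phi>
  by unfold_locales (rule \<phi>_in_L)

sublocale k: tensor_square D1 D2 \<iota>
  by unfold_locales (rule \<iota>_closed)

lemma lmonom_in_R: "r \<in> carrier D1 \<Longrightarrow> int n dvd k \<Longrightarrow>
    \<exists>r'\<in>carrier R. \<phi> r' = lmonom (\<iota> r) k"
  by (rule bexI[of _ "\<lambda>i. if i = k then r else \<zero>\<^bsub>D1\<^esub>"])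
    (auto simp: fun_eq_iff laurent_map_apply carrier_R lmonom_def \<iota>_zero intro: finite_subset[of _ "{k}"])

lemma coefficients_separable:
  assumes "separable_ring_hom R L \<phi>" shows "separable_ring_hom D1 D2 \<iota>"
proof -
  obtain c where c: "separability_element R L \<phi> c"
    using assms unfolding T.separable_iff by blast
  have "augmentation ` carrier L = carrier D2"
  proof (intro equalityI subsetI)
    fix x assume "x \<in> carrier D2"
    then show "x \<in> augmentation ` carrier L"
      by (intro image_eqI[of _ _ "lmonom x 0"]) (simp_all add: augmentation_lmonom)
  qed (use augmentation_closed in auto)
  moreover have "augmentation (\<phi> r) \<in> \<iota> ` carrier D1" if r: "r \<in> carrier R" for r
  proof -
    have "(\<Oplus>i\<in>I. \<iota> (r i)) \<in> \<iota> ` carrier D1" if "finite I" for I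
      using that
    proof (induction I)
      case empty
      then show ?case using \<iota>_zero by (auto intro!: image_eqI[of _ _ "\<zero>\<^bsub>D1\<^esub>"])
    next
      case (insert i I)
      have ri: "r j \<in> carrier D1" for j using r by (simp add: carrier_R)
      obtain x where x: "x \<in> carrier D1" "(\<Oplus>i\<in>I. \<iota> (r i)) = \<iota> x" using insert.IH by auto
      have "(\<Oplus>i\<in>insert i I. \<iota> (r i)) = \<iota> (r i) \<oplus> (\<Oplus>i\<in>I. \<iota> (r i))"
        using insert ri \<iota>_closed by (intro finsum_insert) auto
      also have "\<dots> = \<iota> (r i \<oplus>\<^bsub>D1\<^esub> x)"
        using x ri[of i] by (simp add: ring_hom_add[OF \<iota>_hom])
      finally show ?case using x ri[of i] by (auto intro!: imageI)
    qed
    moreover have "finite {i. \<phi> r i \<noteq> \<zero>}"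
      using coeff_support[OF \<phi>_in_L[OF r]] .
    ultimately show ?thesis by (simp add: augmentation_def laurent_map_apply)
  qed
  ultimately show ?thesis
    unfolding k.separable_iff
    using separability_element_image[OF T.tensor_square_axioms k.tensor_square_axioms
        augmentation_ring_hom _ _ c] by blast
qed

text \<open>Otherwise \<open>n = 0\<close> in \<open>D2\<close>, and \<open>T d/dT\<close> vanishes on all \<open>T^(k n)\<close>.\<close>

lemma degree_unit:
  assumes "field D2" "separable_ring_hom R L \<phi>"
  shows "[n] \<cdot> \<one> \<in> Units D2"
proof (rule ccontr)
  interpret D2: field D2 by fact
  assume "[n] \<cdot> \<one> \<notin> Units D2"
  then have n0: "[n] \<cdot> \<one> = \<zero>"
    using D2.field_Units by auto
  have mult0: "[(k * int n)] \<cdot> x = \<zero>" if x: "x \<in> carrier D2" for k x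
  proof -
    have "[n] \<cdot> (\<one> \<otimes> x) = ([n] \<cdot> \<one>) \<otimes> x"
      using add_pow_ldistr[OF one_closed x, of n] by simp
    then have "[n] \<cdot> x = \<zero>" using x n0 by simp
    then have "[(int n)] \<cdot> x = \<zero>"
      by (simp add: add_pow_def int_pow_int)
    then have "[k] \<cdot> ([(int n)] \<cdot> x) = \<zero>" by simp
    then show ?thesis
      using group.int_pow_pow[OF a_group, of x "int n" k] x
      by (simp add: add_pow_def mult.commute)
  qed
  have "euler (\<phi> r) = \<zero>\<^bsub>L\<^esub>" if r: "r \<in> carrier R" for r
  proof
    fix i
    have ri: "\<iota> (r i) \<in> carrier D2" using r \<iota>_closed by (simp add: carrier_R)
    show "euler (\<phi> r) i = \<zero>\<^bsub>L\<^esub> i"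
    proof (cases "r i = \<zero>\<^bsub>D1\<^esub>")
      case True
      then show ?thesis by (simp add: euler_def zero_L \<iota>_zero laurent_map_apply)
    next
      case False
      then have "int n dvd i" using r by (simp add: carrier_R)
      then obtain k where "i = k * int n" by (metis dvd_def mult.commute)
      then show ?thesis using mult0[OF ri] by (simp add: euler_def zero_L laurent_map_apply)
    qed
  qed
  moreover have "(\<lambda>x. x) \<in> ring_hom L L" by (rule ring_hom_memI) auto
  moreover have "lmonom \<one> 1 \<in> (\<lambda>x. x) ` carrier L" by simp
  ultimately have "\<not> separable_ring_hom R L \<phi>"
    using not_separable_of_euler[OF T.tensor_square_axioms, of "\<lambda>x. x"] D2.one_not_zero by blast
  then show False using assms(2) by blast
qed

end

lemma (in tensor_square) rels_sum:
  assumes "finite I" "\<And>i. i \<in> I \<Longrightarrow> F i \<in> rels" shows "(\<Sum>i\<in>I. F i) \<in> rels"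
  using assms by (induction I) (auto intro: rels_add)

lemma frag_map_sum: "frag_map g h (\<Sum>i\<in>I. F i) = (\<Sum>i\<in>I. frag_map g h (F i))"
  by (induction I rule: infinite_finite_induct) (simp_all add: frag_map_add)

lemma keys_sum_subset:
  fixes F :: "'i \<Rightarrow> 'q \<Rightarrow>\<^sub>0 int"
  assumes "\<And>i. i \<in> I \<Longrightarrow> Poly_Mapping.keys (F i) \<subseteq> U"
  shows "Poly_Mapping.keys (\<Sum>i\<in>I. F i) \<subseteq> U"
  using keys_sum[of F I] assms by blast

text \<open>Multiply \<open>s e = e s\<close> by \<open>s'\<close> on both sides.\<close>

lemma (in tensor_square) centralizes_inverse:
  assumes c: "Poly_Mapping.keys c \<subseteq> pairs" and s: "centralizes c s"
    and s': "s' \<in> carrier S" "s \<otimes> s' = \<one>" "s' \<otimes> s = \<one>"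
  shows "centralizes c s'"
proof -
  have sc: "s \<in> carrier S" "lact s c - ract s c \<in> rels" using s by (auto simp: centralizes_def)
  have one: "lact \<one> c' = c'" "ract \<one> c' = c'" if "Poly_Mapping.keys c' \<subseteq> pairs" for c'
  proof -
    have "lact \<one> c' = frag_map (\<lambda>x. x) (\<lambda>y. y) c'" "ract \<one> c' = frag_map (\<lambda>x. x) (\<lambda>y. y) c'"
      by (rule frag_map_cong[OF that]; auto)+
    then show "lact \<one> c' = c'" "ract \<one> c' = c'" by simp_all
  qed
  have "lact s' (ract s' (lact s c - ract s c)) \<in> rels"
    using sc s' by (intro lact_rels ract_rels)
  moreover have "lact s' (lact s c) = c" "ract s' (ract s c) = c"
    using lact_mult[OF s'(1) sc(1) c] ract_mult[OF sc(1) s'(1) c] s'(2,3) one[OF c] by metis+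
  ultimately have "ract s' c - lact s' c \<in> rels"
    by (simp add: frag_map_diff lact_ract)
  then show ?thesis
    using rels_uminus[of "ract s' c - lact s' c"] s' by (simp add: centralizes_def)
qed

context laurent_extension
begin

text \<open>The class of \<open>u T^a e T^b\<close>, where \<open>e\<close> is the class of \<open>c\<close>. Multiplication by \<open>T\<close> from the left
  or right increments \<open>a\<close> or \<open>b\<close>, and \<open>T^n\<close> may be exchanged between the two exponents.\<close>

definition shifted :: "('f \<times> 'f \<Rightarrow>\<^sub>0 int) \<Rightarrow> 'f \<Rightarrow> int \<Rightarrow> int \<Rightarrow> ((int \<Rightarrow> 'f) \<times> (int \<Rightarrow> 'f) \<Rightarrow>\<^sub>0 int)"
  where "shifted c u a b = frag_map (\<lambda>x. lmonom (u \<otimes> x) a) (\<lambda>y. lmonom y b) c"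

lemma shifted_keys:
  assumes "Poly_Mapping.keys c \<subseteq> k.pairs" "u \<in> carrier D2"
  shows "Poly_Mapping.keys (shifted c u a b) \<subseteq> T.degree_pairs (laurent_grading D2 t) ((a + b) * t)"
  unfolding shifted_def
proof (rule keys_frag_map[OF assms(1)])
  fix x y assume "(x, y) \<in> k.pairs"
  then have "a * t + b * t = (a + b) * t \<and> lmonom (u \<otimes> x) a \<in> laurent_grading D2 t (a * t) \<and>
      lmonom y b \<in> laurent_grading D2 t (b * t)"
    using assms(2) by (auto intro!: lmonom_degree simp: algebra_simps)
  then show "(lmonom (u \<otimes> x) a, lmonom y b) \<in>
      T.degree_pairs (laurent_grading D2 t) ((a + b) * t)" by blast
qed

lemma shifted_rels:
  assumes u: "u \<in> carrier D2" and c: "c \<in> k.rels"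
  shows "shifted c u a b \<in> T.rels"
  unfolding shifted_def
  using T.tensor_square_axioms _ _ _ c
proof (rule k.frag_map_rels)
  show "(\<lambda>x. lmonom (u \<otimes> x) a) \<in> hom (add_monoid D2) (add_monoid L)"
    using u by (intro additiveI) (simp_all add: lmonom_add r_distr)
  show "(\<lambda>y. lmonom y b) \<in> hom (add_monoid D2) (add_monoid L)"
    by (intro additiveI) (simp_all add: lmonom_add)
  fix x r y assume *: "x \<in> carrier D2" "r \<in> carrier D1" "y \<in> carrier D2"
  obtain r' where "r' \<in> carrier R" "\<phi> r' = lmonom (\<iota> r) 0"
    using lmonom_in_R[OF *(2), of 0] by auto
  then show "\<exists>r'\<in>carrier R. lmonom (u \<otimes> (x \<otimes> \<iota> r)) a = lmonom (u \<otimes> x) a \<otimes>\<^bsub>L\<^esub> \<phi> r' \<and>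
      lmonom (\<iota> r \<otimes> y) b = \<phi> r' \<otimes>\<^bsub>L\<^esub> lmonom y b"
    using * u \<iota>_closed by (intro bexI[of _ r']) (simp_all add: lmonom_mult m_assoc)
qed

lemma shifted_period:
  assumes u: "u \<in> carrier D2" and c: "Poly_Mapping.keys c \<subseteq> k.pairs"
  shows "shifted c u (a + int n) b - shifted c u a (int n + b) \<in> T.rels"
  using c
proof (induction c rule: frag_supported_induct)
  case zero
  then show ?case by (simp add: shifted_def)
next
  case (one p)
  then obtain x y where p: "p = (x, y)" "x \<in> carrier D2" "y \<in> carrier D2" by auto
  obtain r where r: "r \<in> carrier R" "\<phi> r = lmonom \<one> (int n)"
    using lmonom_in_R[OF D1.one_closed, of "int n"] ring_hom_one[OF \<iota>_hom] by auto
  show ?case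
    using T.rels_balance[OF _ r(1), of "lmonom (u \<otimes> x) a" "lmonom y b"] p u
    by (simp add: shifted_def r(2) lmonom_mult)
next
  case (diff a' b')
  then show ?case
    using T.rels_diff[OF diff(3,4)] by (simp add: shifted_def frag_map_diff algebra_simps)
qed

lemma lact_shifted:
  assumes "e \<in> carrier D2" "u \<in> carrier D2" "Poly_Mapping.keys c \<subseteq> k.pairs"
  shows "T.lact (lmonom e i) (shifted c u a b) = shifted (k.lact e c) u (i + a) b"
  unfolding shifted_def frag_map_compose
  by (rule frag_map_cong[OF assms(3)]) (use assms in \<open>auto simp: lmonom_mult m_lcomm\<close>)

lemma ract_shifted:
  assumes "e \<in> carrier D2" "u \<in> carrier D2" "Poly_Mapping.keys c \<subseteq> k.pairs"
  shows "T.ract (lmonom e i) (shifted c u a b) = shifted (k.ract e c) u a (b + i)"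
  unfolding shifted_def frag_map_compose
  by (rule frag_map_cong[OF assms(3)]) (use assms in \<open>auto simp: lmonom_mult\<close>)

text \<open>Let \<open>e\<close> be a separability element of the coefficients. Then \<open>1/n \<Sum> T^j e T^(-j)\<close>, summed over
  \<open>0 \<le> j < n\<close>, commutes with \<open>T\<close>: the difference of the two products telescopes, and the boundary
  terms differ by moving the scalar \<open>T^n\<close> across the tensor sign. The \<open>n\<close> summands have product
  \<open>1/n\<close> each.\<close>

lemma laurent_separable:
  assumes sep: "separable_ring_hom D1 D2 \<iota>" and n_unit: "[n] \<cdot> \<one> \<in> Units D2" and t: "t \<noteq> 0"
  shows "graded_separable R L (laurent_grading D2 t) \<phi>"
proof -
  obtain c where c: "separability_element D1 D2 \<iota> c"
    using sep unfolding k.separable_iff by blast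
  note c' = separability_elementD[OF c]
  obtain u where u: "u \<in> carrier D2" "([n] \<cdot> \<one>) \<otimes> u = \<one>"
    using n_unit unfolding Units_def by blast
  define E where "E = (\<Sum>j<n. shifted c u (int j) (- int j))"
  have deg: "Poly_Mapping.keys (shifted c u (int j) (- int j)) \<subseteq>
      T.degree_pairs (laurent_grading D2 t) 0" for j
    using shifted_keys[OF c'(1) u(1), of "int j" "- int j" t] by simp
  have Edeg: "Poly_Mapping.keys E \<subseteq> T.degree_pairs (laurent_grading D2 t) 0"
    unfolding E_def by (rule keys_sum_subset) (rule deg)
  have sub: "T.degree_pairs (laurent_grading D2 t) 0 \<subseteq> T.pairs"
    by (auto simp: laurent_grading_def)
  have Ekeys: "Poly_Mapping.keys E \<subseteq> T.pairs" using Edeg sub by (rule subset_trans)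
  have Sk: "Poly_Mapping.keys (shifted c u (int j) (- int j)) \<subseteq> T.pairs" for j
    using deg sub by (rule subset_trans)

  have mult1: "T.mult_eval (shifted c u (int j) (- int j)) = lmonom u 0" for j
  proof -
    have "T.mult_eval (shifted c u (int j) (- int j)) = (\<lambda>x. lmonom (u \<otimes> x) 0) (k.mult_eval c)"
      unfolding shifted_def
    proof (rule frag_eval_frag_map[OF abelian_group_axioms L.abelian_group_axioms c'(1)])
      show "(\<lambda>x. lmonom (u \<otimes> x) 0) \<in> hom (add_monoid D2) (add_monoid L)"
        using u(1) by (intro additiveI) (simp_all add: lmonom_add r_distr)
    qed (use u(1) in \<open>auto simp: lmonom_mult m_assoc\<close>)
    then show ?thesis using c'(2) u(1) by simp
  qed
  have "T.mult_eval (\<Sum>j<m. shifted c u (int j) (- int j)) = lmonom ([m] \<cdot> u) 0" for m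
  proof (induction m)
    case 0
    then show ?case by (simp add: lmonom_def zero_L add_pow_def nat_pow_def)
  next
    case (Suc m)
    have "T.mult_eval ((\<Sum>j<m. shifted c u (int j) (- int j)) + shifted c u (int m) (- int m)) =
        T.mult_eval (\<Sum>j<m. shifted c u (int j) (- int j)) \<oplus>\<^bsub>L\<^esub> T.mult_eval (shifted c u (int m) (- int m))"
    proof (rule L.frag_eval_add)
      show "Poly_Mapping.keys (\<Sum>j<m. shifted c u (int j) (- int j)) \<subseteq> T.pairs"
        by (rule keys_sum_subset) (rule Sk)
      show "Poly_Mapping.keys (shifted c u (int m) (- int m)) \<subseteq> T.pairs" by (rule Sk)
      show "(\<lambda>p. fst p \<otimes>\<^bsub>L\<^esub> snd p) \<in> T.pairs \<rightarrow> carrier L"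
        by (intro Pi_I L.m_closed) (simp_all add: mem_Times_iff)
    qed
    then show ?case
      using Suc u(1) by (simp add: mult1 lmonom_add)
  qed
  moreover have "[n] \<cdot> u = \<one>"
    using add_pow_ldistr[OF one_closed u(1), of n] u by simp
  ultimately have Emult: "T.mult_eval E = \<one>\<^bsub>L\<^esub>"
    by (simp add: E_def one_L)

  have coeff: "T.centralizes E (lmonom e 0)" if e: "e \<in> carrier D2" for e
  proof -
    have "T.lact (lmonom e 0) E - T.ract (lmonom e 0) E =
        (\<Sum>j<n. shifted (k.lact e c - k.ract e c) u (int j) (- int j))"
      using lact_shifted[OF e u(1) c'(1)] ract_shifted[OF e u(1) c'(1)]
      by (simp add: E_def frag_map_sum sum_subtractf[symmetric] shifted_def frag_map_diff)
    also have "\<dots> \<in> T.rels"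
      by (rule T.rels_sum) (auto intro: shifted_rels[OF u(1) c'(3)[OF e]])
    finally show ?thesis using e by (simp add: T.centralizes_def)
  qed
  have one: "k.lact \<one> c = c" "k.ract \<one> c = c"
  proof -
    have "k.lact \<one> c = frag_map (\<lambda>x. x) (\<lambda>y. y) c" "k.ract \<one> c = frag_map (\<lambda>x. x) (\<lambda>y. y) c"
      by (rule frag_map_cong[OF c'(1)]; auto)+
    then show "k.lact \<one> c = c" "k.ract \<one> c = c" by simp_all
  qed
  have T: "T.centralizes E (lmonom \<one> 1)"
  proof -
    let ?v = "\<lambda>j. shifted c u (int j) (1 - int j)"
    have "T.lact (lmonom \<one> 1) E - T.ract (lmonom \<one> 1) E = (\<Sum>j<n. ?v (Suc j) - ?v j)"
      using lact_shifted[OF one_closed u(1) c'(1)] ract_shifted[OF one_closed u(1) c'(1)]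
      by (simp add: E_def frag_map_sum sum_subtractf one)
    also have "\<dots> = ?v n - ?v 0"
      by (rule sum_lessThan_telescope)
    also have "\<dots> \<in> T.rels"
      using shifted_period[OF u(1) c'(1), of 0 "1 - int n"] by simp
    finally show ?thesis by (simp add: T.centralizes_def)
  qed
  then have T': "T.centralizes E (lmonom \<one> (- 1))"
    by (rule T.centralizes_inverse[OF Ekeys]) (simp_all add: lmonom_mult one_L)
  have pow: "T.centralizes E (lmonom \<one> i)" for i
  proof (induction i rule: int_induct[of _ 0])
    case base
    show ?case by (rule coeff) simp
  next
    case (step1 i)
    then show ?case
      using T.centralizes_mult[OF Ekeys step1(2) T] by (simp add: lmonom_mult)
  next
    case (step2 i)
    then show ?case
      using T.centralizes_mult[OF Ekeys step2(2) T'] by (simp add: lmonom_mult)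
  qed
  have "T.centralizes E f" if "f \<in> carrier L" for f
    using that
  proof (induction f rule: L_induct)
    case (lmonom e i)
    then show ?case
      using T.centralizes_mult[OF Ekeys coeff pow, of e i] by (simp add: lmonom_mult)
  next
    case (add f g)
    then show ?case using T.centralizes_add[OF Ekeys] by blast
  qed
  then have "separability_element R L \<phi> E"
    using Ekeys Emult by (simp add: separability_element_def T.centralizes_def)
  then show ?thesis
    using Edeg unfolding T.graded_separable_iff[OF graded_ring_L[OF t]] by blast
qed

theorem laurent_separable_iff:
  assumes "field D2" "t \<noteq> 0"
  shows "graded_separable R L (laurent_grading D2 t) \<phi> \<longleftrightarrow>
    separable_ring_hom D1 D2 \<iota> \<and> [n] \<cdot> \<one> \<in> Units D2"
proof
  assume "graded_separable R L (laurent_grading D2 t) \<phi>"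
  then have "separable_ring_hom R L \<phi>"
    unfolding graded_separable_def separable_ring_hom_def by blast
  then show "separable_ring_hom D1 D2 \<iota> \<and> [n] \<cdot> \<one> \<in> Units D2"
    using coefficients_separable degree_unit[OF assms(1)] by blast
qed (use laurent_separable[OF _ _ assms(2)] in blast)

end


section \<open>Graded fields are Laurent polynomial rings\<close>

locale commutative_graded_division = graded_ring S G + cring S
  for S :: "('c, 'm) ring_scheme" (structure) and G :: "int \<Rightarrow> 'c set" +
  assumes units: "x \<in> G n \<Longrightarrow> x \<noteq> \<zero> \<Longrightarrow> x \<in> Units S" and nontrivial: "\<one> \<noteq> \<zero>"
begin

text \<open>The component of degree \<open>- n\<close> of any inverse is an inverse.\<close>

lemma homogeneous_inverse:
  assumes x: "x \<in> G n" "x \<noteq> \<zero>"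
  obtains y where "y \<in> G (- n)" "x \<otimes> y = \<one>"
proof -
  have xc: "x \<in> carrier S" using x(1) comp_carrier by blast
  obtain w where w: "w \<in> carrier S" "x \<otimes> w = \<one>"
    using units[OF x] unfolding Units_def by blast
  have "(\<lambda>y. x \<otimes> y) \<in> hom (add_monoid S) (add_monoid S)"
    using xc by (intro additiveI) (simp_all add: r_distr)
  then have "comp_of S G (x \<otimes> w) (- n + n) = x \<otimes> comp_of S G w (- n)"
  proof (rule comp_of_additive[OF graded_ring_axioms _ _ w(1)])
    fix m y assume "y \<in> G m"
    then show "x \<otimes> y \<in> G (m + n)" using comp_mult[OF x(1), of y m] by (simp add: add.commute)
  qed
  then have "x \<otimes> comp_of S G w (- n) = \<one>"
    using w(2) comp_of_homogeneous[OF one_comp] by simp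
  then show ?thesis using that comp_of_in[OF w(1)] by blast
qed

lemma homogeneous_mult_nonzero:
  assumes "x \<in> G m" "x \<noteq> \<zero>" "y \<in> G n" "y \<noteq> \<zero>" shows "x \<otimes> y \<noteq> \<zero>"
proof
  assume xy: "x \<otimes> y = \<zero>"
  obtain w where w: "w \<in> G (- m)" "x \<otimes> w = \<one>" using homogeneous_inverse[OF assms(1,2)] .
  have c: "x \<in> carrier S" "y \<in> carrier S" "w \<in> carrier S" using assms w comp_carrier by blast+
  have "y = (x \<otimes> w) \<otimes> y" using c w by simp
  also have "\<dots> = w \<otimes> (x \<otimes> y)" using c by (simp add: m_ac)
  finally show False using xy c assms(4) by simp
qed

text \<open>The record is built afresh, as restricting the carrier of \<open>S\<close> would keep additional fields of
  \<open>S\<close> in its type.\<close>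

definition degree_zero_field :: "'c ring"
  where "degree_zero_field =
    \<lparr>carrier = G 0, monoid.mult = (\<otimes>), one = \<one>, ring.zero = \<zero>, ring.add = (\<oplus>)\<rparr>"

lemma degree_zero_simps [simp]:
  "carrier degree_zero_field = G 0" "monoid.mult degree_zero_field = (\<otimes>)"
  "one degree_zero_field = \<one>" "ring.zero degree_zero_field = \<zero>" "ring.add degree_zero_field = (\<oplus>)"
  by (simp_all add: degree_zero_field_def)

lemma field_degree_zero: "field degree_zero_field"
proof -
  have c: "x \<in> carrier S" if "x \<in> G 0" for x using that comp_carrier by blast
  have m: "x \<otimes> y \<in> G 0" if "x \<in> G 0" "y \<in> G 0" for x y using comp_mult[OF that] by simp
  have "cring degree_zero_field"
  proof (rule cringI)
    show "abelian_group degree_zero_field"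
    proof (rule abelian_groupI)
      fix x assume "x \<in> carrier degree_zero_field"
      then show "\<exists>y\<in>carrier degree_zero_field. y \<oplus>\<^bsub>degree_zero_field\<^esub> x = \<zero>\<^bsub>degree_zero_field\<^esub>"
        using comp_uminus c by (intro bexI[of _ "\<ominus> x"]) (simp_all add: l_neg)
    next
      fix x y assume "x \<in> carrier degree_zero_field" "y \<in> carrier degree_zero_field"
      then show "x \<oplus>\<^bsub>degree_zero_field\<^esub> y = y \<oplus>\<^bsub>degree_zero_field\<^esub> x"
        using c by (simp add: a_comm)
    qed (simp_all add: comp_add c a_assoc)
    show "Group.comm_monoid degree_zero_field"
    proof (rule comm_monoidI)
      fix x y assume "x \<in> carrier degree_zero_field" "y \<in> carrier degree_zero_field"
      then show "x \<otimes>\<^bsub>degree_zero_field\<^esub> y = y \<otimes>\<^bsub>degree_zero_field\<^esub> x"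
        using c by (simp add: m_comm)
    qed (simp_all add: m c m_assoc one_comp)
  qed (simp add: c l_distr)
  then interpret D: cring degree_zero_field .
  have "Units degree_zero_field = carrier degree_zero_field - {\<zero>\<^bsub>degree_zero_field\<^esub>}"
  proof (intro equalityI subsetI)
    fix x assume x: "x \<in> Units degree_zero_field"
    then obtain y where "y \<in> G 0" "x \<otimes> y = \<one>" by (auto simp: Units_def)
    then have "x \<noteq> \<zero>" using nontrivial c by auto
    then show "x \<in> carrier degree_zero_field - {\<zero>\<^bsub>degree_zero_field\<^esub>}" using x by auto
  next
    fix x assume "x \<in> carrier degree_zero_field - {\<zero>\<^bsub>degree_zero_field\<^esub>}"
    then have x: "x \<in> G 0" "x \<noteq> \<zero>" by auto
    obtain y where y: "y \<in> G (- 0)" "x \<otimes> y = \<one>" using homogeneous_inverse[OF x] .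
    then have "y \<otimes> x = \<one>" using x c m_comm[of x y] by simp
    then show "x \<in> Units degree_zero_field"
      using x y by (auto simp: Units_def)
  qed
  then show ?thesis by (rule D.cring_fieldI)
qed

text \<open>The degrees that occur form a subgroup of the integers; a generator \<open>s\<close> and a nonzero \<open>T\<close> of
  degree \<open>s\<close> provide a homogeneous unit in each of these degrees.\<close>

lemma obtain_uniformizer:
  assumes "\<not> concentrated_in_degree_zero S G"
  obtains s U where "s \<noteq> 0" "G s \<noteq> {\<zero>}" "\<And>n. \<not> s dvd n \<Longrightarrow> G n = {\<zero>}"
    "\<And>k. U k \<in> G (k * s)" "\<And>k l. U k \<otimes> U l = U (k + l)" "U 0 = \<one>"
proof -
  have nz: "G n \<noteq> {\<zero>} \<longleftrightarrow> (\<exists>x\<in>G n. x \<noteq> \<zero>)" for n using comp_zero[of n] by blast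
  obtain n where n: "n \<noteq> 0" "\<exists>x\<in>G n. x \<noteq> \<zero>"
    using assms nz by (auto simp: concentrated_in_degree_zero_def)
  have neg: "\<exists>x\<in>G (- m). x \<noteq> \<zero>" if m: "\<exists>x\<in>G m. x \<noteq> \<zero>" for m
  proof -
    obtain x where x: "x \<in> G m" "x \<noteq> \<zero>" using m by blast
    obtain y where y: "y \<in> G (- m)" "x \<otimes> y = \<one>" using homogeneous_inverse[OF x] .
    have "y \<noteq> \<zero>" using y x comp_carrier nontrivial by auto
    then show ?thesis using y by blast
  qed
  let ?P = "\<lambda>k::nat. k > 0 \<and> (\<exists>x\<in>G (int k). x \<noteq> \<zero>)"
  have "?P (nat \<bar>n\<bar>)"
    using n neg[OF n(2)] by (cases "n \<ge> 0") auto
  define k0 where "k0 = (LEAST k. ?P k)"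
  have k0: "?P k0" and least: "?P k \<Longrightarrow> k0 \<le> k" for k
    unfolding k0_def using LeastI[of ?P, OF \<open>?P (nat \<bar>n\<bar>)\<close>] Least_le[of ?P k] by blast+
  define s where "s = int k0"
  obtain T where T: "T \<in> G s" "T \<noteq> \<zero>" using k0 by (auto simp: s_def)
  have TU: "T \<in> Units S" using units[OF T] .
  interpret U: group "units_of S" by (rule units_group)
  define U where "U = (\<lambda>k::int. T [^]\<^bsub>units_of S\<^esub> k)"
  have TU': "T \<in> carrier (units_of S)" using TU by (simp add: units_of_carrier)
  have U0: "U 0 = \<one>" by (simp add: U_def units_of_one)
  have U1: "U 1 = T" using TU' by (simp add: U_def)
  have add: "U k \<otimes> U l = U (k + l)" for k l
    using U.int_pow_mult[OF TU', of k l] by (simp add: U_def units_of_mult)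
  have "U k \<in> Units S" for k
    using U.int_pow_closed[OF TU', of k] by (simp add: U_def units_of_carrier)
  then have Uc: "U k \<in> carrier S" for k by (rule Units_closed)
  obtain y where y: "y \<in> G (- s)" "T \<otimes> y = \<one>" using homogeneous_inverse[OF T] .
  have yc: "y \<in> carrier S" using y comp_carrier by blast
  \<comment> \<open>The inverse of \<open>T\<close> in the group of units is the homogeneous one.\<close>
  have "U (- 1) = U (- 1) \<otimes> (U 1 \<otimes> y)" using y(2) U1 Uc by simp
  also have "\<dots> = y" using add[of "- 1" 1] U0 Uc yc by (simp flip: m_assoc)
  finally have Um: "U (- 1) \<in> G (- s)" using y by simp
  have deg: "U k \<in> G (k * s)" for k
  proof (induction k rule: int_induct[of _ 0])
    case base
    then show ?case using one_comp U0 by simp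
  next
    case (step1 i)
    then show ?case
      using comp_mult[OF step1(2), of T s] T U1 add[of i 1] by (simp add: algebra_simps)
  next
    case (step2 i)
    then show ?case
      using comp_mult[OF step2(2) Um] add[of i "- 1"] by (simp add: algebra_simps)
  qed
  have "G m = {\<zero>}" if m: "\<not> s dvd m" for m
  proof (rule ccontr)
    assume "G m \<noteq> {\<zero>}"
    then obtain x where x: "x \<in> G m" "x \<noteq> \<zero>" using nz by blast
    \<comment> \<open>Division with remainder: \<open>x\<close> times \<open>T^(-q)\<close> has degree \<open>m mod s\<close>, which is less than \<open>s\<close>.\<close>
    define q where "q = m div s"
    have "U (- q) \<noteq> \<zero>"
      using add[of q "- q"] U0 nontrivial Uc by auto
    then have "x \<otimes> U (- q) \<noteq> \<zero>"
      using homogeneous_mult_nonzero[OF x deg] by blast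
    moreover have "m + - q * s = m mod s"
      by (simp add: q_def minus_div_mult_eq_mod)
    then have "x \<otimes> U (- q) \<in> G (m mod s)"
      using comp_mult[OF x(1) deg[of "- q"]] by metis
    moreover have "0 \<le> m mod s" "m mod s < s" "m mod s \<noteq> 0"
      using k0 m by (auto simp: s_def dvd_eq_mod_eq_0)
    ultimately have "?P (nat (m mod s))" by auto
    then have "k0 \<le> nat (m mod s)" by (rule least)
    moreover have "nat (m mod s) < k0"
      using \<open>m mod s < s\<close> \<open>0 \<le> m mod s\<close> by (simp add: s_def nat_less_iff)
    ultimately show False by simp
  qed
  moreover have "s \<noteq> 0" using k0 by (simp add: s_def)
  moreover have "G s \<noteq> {\<zero>}" using T by blast
  ultimately show ?thesis using that deg add U0 by blast
qed

text \<open>A homogeneous \<open>x\<close> of degree \<open>k s\<close> corresponds to the monomial \<open>(x T^(-k)) T^k\<close> with coefficient in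
  degree zero.\<close>

theorem laurent_isomorphism:
  assumes "\<not> concentrated_in_degree_zero S G"
  obtains s h where "s \<noteq> 0" "G s \<noteq> {\<zero>}"
    "graded_ring_iso S G (laurent_ring degree_zero_field) (laurent_grading degree_zero_field s) h"
proof -
  obtain s U where s: "s \<noteq> 0" "G s \<noteq> {\<zero>}" "\<And>n. \<not> s dvd n \<Longrightarrow> G n = {\<zero>}"
    and U: "\<And>k. U k \<in> G (k * s)" "\<And>k l. U k \<otimes> U l = U (k + l)" "U 0 = \<one>"
    using obtain_uniformizer[OF assms] by blast
  let ?D = degree_zero_field
  interpret D: field ?D by (rule field_degree_zero)
  interpret D: laurent ?D by unfold_locales
  have Uc [simp]: "U k \<in> carrier S" for k using U(1) comp_carrier by blast
  have deg: "x \<otimes> U (- k) \<in> G 0" if "x \<in> G (k * s)" for x k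
    using comp_mult[OF that U(1)[of "- k"]] by simp
  define h where "h = (\<lambda>x k. comp_of S G x (k * s) \<otimes> U (- k))"
  have h_homogeneous: "h x = D.lmonom (x \<otimes> U (- k)) k" if "x \<in> G (k * s)" for x k
    using s(1) comp_carrier[OF that]
    by (auto simp: h_def D.lmonom_def comp_of_homogeneous[OF that] fun_eq_iff)
  have cases: "(\<exists>k. n = k * s) \<or> x = \<zero>" if "x \<in> G n" for x n
    using s(3)[of n] that by (metis dvd_def mult.commute singletonD)
  have h_zero: "h \<zero> = \<zero>\<^bsub>D.L\<^esub>"
    by (auto simp: h_def comp_of_homogeneous[OF comp_zero[of 0]] D.zero_L)
  have h_closed: "h x \<in> carrier D.L" if x: "x \<in> carrier S" for x
  proof (rule D.L_closedI)
    show "h x k \<in> carrier ?D" for k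
      using deg[OF comp_of_in[OF x, of "k * s"]] by (simp add: h_def)
    have "inj (\<lambda>k. k * s)" using s(1) by (auto intro: injI)
    then show "finite ((\<lambda>k. k * s) -` {i. comp_of S G x i \<noteq> \<zero>})"
      by (intro finite_vimageI finite_comp_of[OF x])
    show "h x k = \<zero>\<^bsub>?D\<^esub>" if "k \<notin> (\<lambda>k. k * s) -` {i. comp_of S G x i \<noteq> \<zero>}" for k
      using that by (simp add: h_def)
  qed
  have h_add: "h (x \<oplus> y) = h x \<oplus>\<^bsub>D.L\<^esub> h y" if "x \<in> carrier S" "y \<in> carrier S" for x y
    using that by (simp add: h_def comp_of_add D.add_L comp_of_closed l_distr)
  have h_mult: "h (x \<otimes> y) = h x \<otimes>\<^bsub>D.L\<^esub> h y" if "x \<in> carrier S" "y \<in> carrier S" for x y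
    using that
  proof (induction x rule: graded_induct)
    case (homogeneous m x)
    note x = \<open>x \<in> G m\<close>
    have xc: "x \<in> carrier S" using x comp_carrier by blast
    from homogeneous(2) show ?case
    proof (induction y rule: graded_induct)
      case (homogeneous n y)
      have yc: "y \<in> carrier S" using homogeneous comp_carrier by blast
      show ?case
      proof (cases "x = \<zero> \<or> y = \<zero>")
        case True
        then show ?thesis using xc yc h_closed h_zero by auto
      next
        case False
        then obtain k l where kl: "m = k * s" "n = l * s"
          using cases[OF x] cases[OF homogeneous] by blast
        have "x \<otimes> y \<in> G ((k + l) * s)"
          using comp_mult[OF x homogeneous] kl by (simp add: algebra_simps)
        then have "h (x \<otimes> y) = D.lmonom ((x \<otimes> y) \<otimes> U (- (k + l))) (k + l)"
          by (rule h_homogeneous)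
        also have "(x \<otimes> y) \<otimes> U (- (k + l)) = (x \<otimes> U (- k)) \<otimes> (y \<otimes> U (- l))"
          using xc yc U(2)[of "- k" "- l", symmetric] by (simp add: m_ac)
        also have "D.lmonom \<dots> (k + l) = h x \<otimes>\<^bsub>D.L\<^esub> h y"
          using h_homogeneous[of x k] h_homogeneous[of y l] x homogeneous kl deg
          by (simp add: D.lmonom_mult)
        finally show ?thesis .
      qed
    next
      case (add y z)
      then show ?case using xc h_closed by (simp add: r_distr h_add D.L.r_distr)
    qed
  next
    case (add x z)
    then show ?case using h_closed by (simp add: l_distr h_add D.L.l_distr)
  qed
  have h_one: "h \<one> = \<one>\<^bsub>D.L\<^esub>"
    using h_homogeneous[of \<one> 0] one_comp U(3) by (simp add: D.one_L)
  have hom: "h \<in> ring_hom S D.L"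
    by (rule ring_hom_memI) (simp_all add: h_closed h_mult h_add h_one)
  have inj: "inj_on h (carrier S)"
  proof (rule inj_onI)
    fix x y assume xy: "x \<in> carrier S" "y \<in> carrier S" "h x = h y"
    have "comp_of S G x n = comp_of S G y n" for n
    proof (cases "s dvd n")
      case True
      then obtain k where n: "n = k * s" by (metis dvd_def mult.commute)
      have *: "h z k \<otimes> U k = comp_of S G z n" if "z \<in> carrier S" for z
        using that comp_of_closed[OF that] U(2)[of "- k" k] U(3) by (simp add: h_def n m_assoc)
      show ?thesis using *[OF xy(1)] *[OF xy(2)] xy(3) by simp
    next
      case False
      then show ?thesis
        using s(3) comp_of_in[OF xy(1), of n] comp_of_in[OF xy(2), of n] by simp
    qed
    then have comps: "comp_of S G x = comp_of S G y" by (rule ext)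
    have "x = (\<Oplus>i\<in>{i. comp_of S G x i \<noteq> \<zero>}. comp_of S G x i)"
      by (rule comp_of_sum[OF xy(1) finite_comp_of[OF xy(1)] subset_refl])
    also have "\<dots> = y"
      unfolding comps by (rule comp_of_sum[OF xy(2) finite_comp_of[OF xy(2)] subset_refl, symmetric])
    finally show "x = y" .
  qed
  have hits_lmonom: "h (c \<otimes> U k) = D.lmonom c k \<and> c \<otimes> U k \<in> G (k * s)" if c: "c \<in> G 0" for c k
  proof -
    have cU: "c \<otimes> U k \<in> G (k * s)" using comp_mult[OF c U(1)[of k]] by simp
    have "c \<otimes> U k \<otimes> U (- k) = c"
      using comp_carrier[OF c] U(2)[of k "- k"] U(3) by (simp add: m_assoc)
    then show ?thesis using h_homogeneous[OF cU] cU by simp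
  qed
  have "f \<in> h ` carrier S" if "f \<in> carrier D.L" for f
    using that
  proof (induction f rule: D.L_induct)
    case (lmonom c k)
    then have c: "c \<in> G 0" by simp
    show ?case
      using hits_lmonom[OF c, of k] comp_carrier[of "c \<otimes> U k" "k * s"]
      by (intro image_eqI[of _ _ "c \<otimes> U k"]) simp_all
  next
    case (add f g)
    then obtain x y where "x \<in> carrier S" "f = h x" "y \<in> carrier S" "g = h y" by blast
    then show ?case by (intro image_eqI[of _ _ "x \<oplus> y"]) (simp_all add: h_add)
  qed
  then have "bij_betw h (carrier S) (carrier D.L)"
    using inj h_closed unfolding bij_betw_def by blast
  then have iso: "h \<in> ring_iso S D.L" using hom by (simp add: ring_iso_def)
  have "h ` G n = laurent_grading ?D s n" for n
  proof (intro equalityI subsetI)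
    fix f assume "f \<in> h ` G n"
    then obtain x where x: "x \<in> G n" "f = h x" by blast
    have "h x k = \<zero>" if "k * s \<noteq> n" for k
      using that by (simp add: h_def comp_of_homogeneous[OF x(1)])
    then show "f \<in> laurent_grading ?D s n"
      using x h_closed[OF comp_carrier[OF x(1)]] unfolding laurent_grading_def by auto
  next
    fix f assume f: "f \<in> laurent_grading ?D s n"
    then have fc: "f \<in> carrier D.L" "\<And>i. f i \<noteq> \<zero> \<Longrightarrow> i * s = n"
      by (simp_all add: laurent_grading_def)
    show "f \<in> h ` G n"
    proof (cases "s dvd n")
      case True
      then obtain k where n: "n = k * s" by (metis dvd_def mult.commute)
      have "f i = \<zero>" if "i \<noteq> k" for i using fc(2)[of i] that s(1) n by auto
      then have "f = D.lmonom (f k) k" by (auto simp: D.lmonom_def)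
      moreover have "f k \<in> G 0" using D.coeff_closed[OF fc(1), of k] by simp
      ultimately show ?thesis using hits_lmonom[of "f k" k] n by (metis imageI)
    next
      case False
      then have "f i = \<zero>" for i using fc(2)[of i] by fastforce
      then have "f = h \<zero>" unfolding h_zero D.zero_L by auto
      then show ?thesis using comp_zero by blast
    qed
  qed
  then have "graded_ring_iso S G D.L (laurent_grading ?D s) h"
    using iso by (simp add: graded_ring_iso_def)
  then show ?thesis using that s by blast
qed

end


section \<open>Cycles outside characteristic two\<close>

context dg_division
begin

text \<open>The signs in graded commutativity are trivial since cycles live in even degrees.\<close>

lemma commutative_graded_division_dker:
  assumes "\<And>x. x \<in> carrier A \<Longrightarrow> x \<oplus> x = \<zero> \<Longrightarrow> x = \<zero>"
  shows "commutative_graded_division (dker A d) (dker_grading A G d)"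
proof -
  interpret k: graded_ring "dker A d" "dker_grading A G d" by (rule graded_ring_dker)
  have "x \<otimes> y = y \<otimes> x" if "x \<in> carrier (dker A d)" "y \<in> carrier (dker A d)" for x y
    using that
  proof (induction x rule: k.graded_induct)
    case (homogeneous m x)
    note x = \<open>x \<in> dker_grading A G d m\<close>
    have xc: "x \<in> carrier A" using k.comp_carrier[OF x] by (simp add: carrier_dker)
    from homogeneous(2) show ?case
    proof (induction y rule: k.graded_induct)
      case (homogeneous n y)
      have yc: "y \<in> carrier A" using k.comp_carrier[OF homogeneous] by (simp add: carrier_dker)
      show ?case
      proof (cases "even m")
        case True
        then show ?thesis
          using graded_comm[of x m y n] x homogeneous by (simp add: dker_grading_def sgn_mult_def)
      next
        case False
        then show ?thesis using odd_cycle_zero[OF assms x] yc by simp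
      qed
    next
      case (add y z)
      then show ?case using xc by (simp add: carrier_dker l_distr r_distr)
    qed
  next
    case (add x z)
    then show ?case by (simp add: carrier_dker l_distr r_distr)
  qed
  then have "Group.comm_monoid (dker A d)"
    by (intro k.monoid_comm_monoidI) simp
  then have "cring (dker A d)"
    by (intro cring.intro k.ring_axioms)
  then show ?thesis
    using graded_division_ring_dker one_nonzero graded_ring_dker
    unfolding commutative_graded_division_def commutative_graded_division_axioms_def
      graded_division_ring_def by simp
qed

end

context dg_extension_pair
begin

text \<open>The extension of cycles becomes one of a Laurent polynomial ring over scalars in degree zero.
  These are constants for \<open>T d/dT\<close>.\<close>

theorem not_dg_separable_of_degrees:
  assumes two: "\<And>x. x \<in> carrier A \<Longrightarrow> x \<oplus>\<^bsub>A\<^esub> x = \<zero>\<^bsub>A\<^esub> \<Longrightarrow> x = \<zero>\<^bsub>A\<^esub>"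
    and "acyclic_dg B dB" "concentrated_in_degree_zero kB (dker_grading B GB dB)"
    "\<not> concentrated_in_degree_zero kA gA"
  shows "\<not> dg_separable B A GA dA \<phi>"
proof
  assume "dg_separable B A GA dA \<phi>"
  then have sep: "separable_ring_hom kB kA \<phi>"
    using cycles_separable_of_dg_separable[OF two assms(2)]
    unfolding graded_separable_def separable_ring_hom_def by blast
  interpret k: commutative_graded_division kA gA
    by (rule A.commutative_graded_division_dker[OF two])
  interpret kB: graded_ring kB "dker_grading B GB dB" by (rule B.graded_ring_dker)
  obtain s h where s: "s \<noteq> 0"
    and iso: "graded_ring_iso kA gA (laurent_ring k.degree_zero_field)
      (laurent_grading k.degree_zero_field s) h"
    using k.laurent_isomorphism[OF assms(4)] .
  interpret D: field k.degree_zero_field by (rule k.field_degree_zero)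
  interpret D: laurent k.degree_zero_field by unfold_locales
  have h: "h \<in> ring_hom kA D.L" "h ` carrier kA = carrier D.L" "\<And>n. h ` gA n = laurent_grading k.degree_zero_field s n"
    using iso by (auto simp: graded_ring_iso_def ring_iso_def bij_betw_def)
  have "D.euler (h (\<phi> b)) = \<zero>\<^bsub>D.L\<^esub>" if b: "b \<in> carrier kB" for b
  proof -
    have "b \<in> dker_grading B GB dB 0"
      using b
    proof (induction b rule: kB.graded_induct)
      case (homogeneous n x)
      then show ?case
        using assms(3) kB.comp_zero[of 0] unfolding concentrated_in_degree_zero_def by (cases "n = 0") auto
    next
      case (add x y)
      then show ?case using kB.comp_add by blast
    qed
    then have "\<phi> b \<in> gA 0"
      using \<phi>_degree \<phi>_cycle by (simp add: dker_grading_def)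
    then have hb: "h (\<phi> b) \<in> laurent_grading k.degree_zero_field s 0"
      using h(3)[of 0] by blast
    show ?thesis
    proof
      fix i
      show "D.euler (h (\<phi> b)) i = \<zero>\<^bsub>D.L\<^esub> i"
      proof (cases "h (\<phi> b) i = \<zero>\<^bsub>k.degree_zero_field\<^esub>")
        case True
        then show ?thesis unfolding D.euler_def D.zero_L by (simp only: D.int_multiple_zero)
      next
        case False
        then have "i = 0" using hb s by (auto simp: laurent_grading_def)
        then show ?thesis unfolding D.euler_def D.zero_L by (simp only: D.int_multiple_0)
      qed
    qed
  qed
  then have "\<not> separable_ring_hom kB kA \<phi>"
    by (intro D.not_separable_of_euler[OF tensor_square_cycles h(1) D.one_not_zero])
      (simp_all only: h(2) D.lmonom_closed D.one_closed)
  then show False using sep by contradiction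
qed

end


section \<open>Dg-extensions of graded commutative dg-division rings\<close>

theorem theorem3p5:
  fixes K :: "('k, 'l) ring_scheme"
    and A :: "('k, 'a, 'm) module_scheme" and GA :: "int \<Rightarrow> 'a set" and dA :: "'a \<Rightarrow> 'a"
    and B :: "('k, 'b, 'n) module_scheme" and GB :: "int \<Rightarrow> 'b set" and dB :: "'b \<Rightarrow> 'b"
    and \<phi> :: "'b \<Rightarrow> 'a"
    and C :: "('k, 'c, 'p) module_scheme" and GC :: "int \<Rightarrow> 'c set" and dC :: "'c \<Rightarrow> 'c"
    and D1 :: "('e, 'q) ring_scheme" and D2 :: "('f, 'r) ring_scheme" and \<iota> :: "'e \<Rightarrow> 'f"
    and n :: nat and t :: int
  assumes K: "field K"
    and A: "dg_division_ring K A GA dA" "graded_commutative A GA"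
    and B: "dg_division_ring K B GB dB" "graded_commutative B GB"
    and \<phi>: "dg_extension K B GB dB A GA dA \<phi>"
  shows
    \<comment> \<open>(1)\<close>
    "(graded_division_ring (dker A dA) (dker_grading A GA dA) \<and>
      graded_commutative (dker A dA) (dker_grading A GA dA) \<and>
      graded_division_ring (dker B dB) (dker_grading B GB dB) \<and>
      graded_commutative (dker B dB) (dker_grading B GB dB)) \<and>
     \<comment> \<open>(2)\<close>
     (acyclic_dg B dB \<longrightarrow>
      acyclic_dg A dA \<and>
      (graded_separable (dker B dB) (dker A dA) (dker_grading A GA dA) \<phi> \<longrightarrow>
        dg_separable B A GA dA \<phi>) \<and>
      (ring_char K \<noteq> 2 \<longrightarrow>
        (dg_separable B A GA dA \<phi> \<longleftrightarrow>
         graded_separable (dker B dB) (dker A dA) (dker_grading A GA dA) \<phi>))) \<and>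
     (ring_char K \<noteq> 2 \<longrightarrow>
      \<comment> \<open>(3)\<close>
      ((\<forall>b \<in> carrier B. dB b = \<zero>\<^bsub>B\<^esub>) \<and> acyclic_dg A dA \<longrightarrow> \<not> dg_separable B A GA dA \<phi>) \<and>
      \<comment> \<open>(4)\<close>
      (acyclic_dg B dB \<and>
       concentrated_in_degree_zero (dker B dB) (dker_grading B GB dB) \<and>
       \<not> concentrated_in_degree_zero (dker A dA) (dker_grading A GA dA) \<longrightarrow>
        \<not> dg_separable B A GA dA \<phi>) \<and>
      \<comment> \<open>(5)\<close>
      (dg_division_ring K C GC dC \<and> graded_commutative C GC \<and> acyclic_dg C dC \<and>
       \<not> concentrated_in_degree_zero (dker C dC) (dker_grading C GC dC) \<longrightarrow>
        (\<exists>(D :: 'c ring) s h. field D \<and> s \<noteq> 0 \<and> even s \<and>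
          graded_ring_iso (dker C dC) (dker_grading C GC dC)
            (laurent_ring D) (laurent_grading D s) h)) \<and>
      (field D1 \<and> field D2 \<and> \<iota> \<in> ring_hom D1 D2 \<and> n \<ge> 1 \<and> t \<noteq> 0 \<and> even t \<longrightarrow>
        (graded_separable (laurent_subring D1 n) (laurent_ring D2) (laurent_grading D2 t)
           (laurent_map \<iota>) \<longleftrightarrow>
         separable_ring_hom D1 D2 \<iota> \<and> [n] \<cdot>\<^bsub>D2\<^esub> \<one>\<^bsub>D2\<^esub> \<in> Units D2)))"
proof -
  have division: "dg_division K S G d" if "dg_division_ring K S G d" "graded_commutative S G"
    for S :: "('k, 's, 'z) module_scheme" and G d
    using that unfolding dg_division_def dg_division_axioms_def dg_division_ring_def by blast
  interpret dg_extension_pair K B GB dB A GA dA \<phi>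
    using division[OF A] division[OF B] \<phi>
    unfolding dg_extension_pair_def dg_extension_pair_axioms_def by blast
  have two: "x = \<zero>\<^bsub>A\<^esub>" if "ring_char K \<noteq> 2" "x \<in> carrier A" "x \<oplus>\<^bsub>A\<^esub> x = \<zero>\<^bsub>A\<^esub>" for x
    using A.two_torsion_free[OF K that] .
  have part1: "graded_division_ring kA gA \<and> graded_commutative kA gA \<and>
      graded_division_ring kB (dker_grading B GB dB) \<and> graded_commutative kB (dker_grading B GB dB)"
    by (intro conjI A.graded_division_ring_dker B.graded_division_ring_dker
      A.graded_commutative_dker B.graded_commutative_dker assms)
  have acyclic: "acyclic_dg A dA" if B: "acyclic_dg B dB"
  proof -
    obtain z where "z \<in> GB (-1)" "dB z = \<one>\<^bsub>B\<^esub>" using B.acyclic_imp_primitive[OF B] .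
    then show ?thesis using \<phi>_primitive A.primitive_imp_acyclic by blast
  qed
  have part3: "\<not> dg_separable B A GA dA \<phi>"
    if "ring_char K \<noteq> 2" "\<forall>b\<in>carrier B. dB b = \<zero>\<^bsub>B\<^esub>" "acyclic_dg A dA"
  proof -
    have "\<not> separable_ring_hom B A \<phi>"
      by (rule not_separable_of_trivial_differential[OF two[OF that(1)] _ that(3)])
        (use that(2) in blast)+
    then show ?thesis unfolding dg_separable_def separable_ring_hom_def by blast
  qed
  have part5: "\<exists>(D :: 'c ring) s h. field D \<and> s \<noteq> 0 \<and> even s \<and>
      graded_ring_iso (dker C dC) (dker_grading C GC dC) (laurent_ring D) (laurent_grading D s) h"
    if char: "ring_char K \<noteq> 2"
      and C: "dg_division_ring K C GC dC" "graded_commutative C GC"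
        "\<not> concentrated_in_degree_zero (dker C dC) (dker_grading C GC dC)"
  proof -
    interpret C: dg_division K C GC dC by (rule division[OF C(1,2)])
    have two': "x = \<zero>\<^bsub>C\<^esub>" if "x \<in> carrier C" "x \<oplus>\<^bsub>C\<^esub> x = \<zero>\<^bsub>C\<^esub>" for x
      using C.two_torsion_free[OF K char that] .
    interpret k: commutative_graded_division "dker C dC" "dker_grading C GC dC"
      by (rule C.commutative_graded_division_dker[OF two'])
    obtain s h where sh: "s \<noteq> 0" "dker_grading C GC dC s \<noteq> {\<zero>\<^bsub>dker C dC\<^esub>}"
      "graded_ring_iso (dker C dC) (dker_grading C GC dC) (laurent_ring k.degree_zero_field)
        (laurent_grading k.degree_zero_field s) h"
      using k.laurent_isomorphism[OF C(3)] .
    \<comment> \<open>The degree of \<open>T\<close> carries a nonzero cycle, and odd cycles vanish.\<close>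
    have "even s"
    proof (rule ccontr)
      assume "odd s"
      then have "dker_grading C GC dC s \<subseteq> {\<zero>\<^bsub>C\<^esub>}"
        using C.odd_cycle_zero[OF two'] by blast
      then show False using sh(2) k.comp_zero[of s] by auto
    qed
    then show ?thesis using k.field_degree_zero sh by blast
  qed
  have part6: "graded_separable (laurent_subring D1 n) (laurent_ring D2) (laurent_grading D2 t)
        (laurent_map \<iota>) \<longleftrightarrow> separable_ring_hom D1 D2 \<iota> \<and> [n] \<cdot>\<^bsub>D2\<^esub> \<one>\<^bsub>D2\<^esub> \<in> Units D2"
    if D: "field D1" "field D2" "\<iota> \<in> ring_hom D1 D2" "n \<ge> 1" "t \<noteq> 0"
  proof -
    interpret D1: field D1 by (rule D)
    interpret D2: field D2 by (rule D)
    interpret E: laurent_extension D1 D2 \<iota> n by unfold_locales (rule D)+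
    show ?thesis using E.laurent_separable_iff[OF D(2,5)] .
  qed
  have part2: "dg_separable B A GA dA \<phi>" if "acyclic_dg B dB" "graded_separable kB kA gA \<phi>"
    using dg_separable_of_cycles[OF that] .
  have part2b: "dg_separable B A GA dA \<phi> \<longleftrightarrow> graded_separable kB kA gA \<phi>"
    if "acyclic_dg B dB" "ring_char K \<noteq> 2"
    using part2[OF that(1)] cycles_separable_of_dg_separable[OF two[OF that(2)] that(1)] by (rule iffI[rotated])
  have part4: "\<not> dg_separable B A GA dA \<phi>"
    if "ring_char K \<noteq> 2" "acyclic_dg B dB" "concentrated_in_degree_zero kB (dker_grading B GB dB)"
      "\<not> concentrated_in_degree_zero kA gA"
    using not_dg_separable_of_degrees[OF two[OF that(1)] that(2-4)] .
  show ?thesis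
    by (intro conjI impI; (elim conjE)?)
      (rule part1[THEN conjunct1] part1[THEN conjunct2, THEN conjunct1]
        part1[THEN conjunct2, THEN conjunct2, THEN conjunct1]
        part1[THEN conjunct2, THEN conjunct2, THEN conjunct2]
        acyclic part2b part2 part3 part4 part5 part6; assumption)+
qed

end
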